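(* Let $\xi$ be an $\mathbb{R}^m$-valued random variable on a probability space $(\Omega,\mathcal F,\mathbb P)$ whose distribution $\mathbb P_\xi$ is absolutely continuous with an essentially bounded probability density $p_\xi:\mathbb{R}^m\to[0,\infty)$, and assume that $p_\xi$ is either positive or compactly supported. Let $\mathbf f=(\mathbf f_1,\dots,\mathbf f_{d+m})\in C^1(\mathbb{R},\mathbb{R}^{d+m})$ satisfy $\mathbf f_{d+j}\equiv 0$ for $j=1,\dots,m$. Let $\bar u_0$ be an $L^1(\mathbb{R}^d)$-valued random variable with $\bar u_0(\cdot;\omega_\xi)\in (L^1\cap L^\infty)(\mathbb{R}^d)$ for $\mathbb P_\xi$-a.s. $\omega_\xi\in\mathbb{R}^m$, and let $u_0\in L^\infty(\mathbb{R}^{d+m})$ satisfy $$u_0((x,\omega_\xi))=\bar u_0(x;\omega_\xi)\quad\text{for }\mathbb P_\xi\text{-a.s. }\omega_\xi\in\mathbb{R}^m\text{ and a.e. }x\in\mathbb{R}^d.$$ Let $\bar u$ be the unique random entropy solution of the stochastic Cauchy problem $$\partial_t\bar u(t,x;\omega_\xi)+\sum_{j=1}^d\partial_{x_j}\mathbf f_j(\bar u(t,x;\omega_\xi))=0,\qquad \bar u(0,x;\omega_\xi)=\bar u_0(x;\omega_\xi),$$ and let $u$ be the unique entropy solution of the deterministic Cauchy problem $$\partial_t u(t,y)+\sum_{j=1}^{d+m}\partial_{y_j}\mathbf f_j(u(t,y))=0,\quad y\in\mathbb{R}^{d+m},\qquad u(0,y)=u_0(y).$$ Then $$u(t,(x,\omega_\xi))=\bar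 u(t,x;\omega_\xi)\quad\text{for }\mathbb P_\xi\text{-a.s. }\omega_\xi\in\mathbb{R}^m\text{ and a.e. }x\in\mathbb{R}^d.$$
   Context: $\mathbb P_\xi(B)=\mathbb P(\xi^{-1}(B))=\int_B p_\xi\,d\xi$ for Borel $B\subset\mathbb{R}^m$; write $\Omega_\xi=\mathbb{R}^m$. Fix $T>0$. Random entropy solution: a map $\bar u:\Omega_\xi\to C_b([0,T];L^1(\mathbb{R}^d))$ such that for $\mathbb P_\xi$-a.s. $\omega_\xi$: (i) for all $\bar\varphi\in C^1_0([0,T]\times\mathbb{R}^d)$, $\int_0^\infty\int_{\mathbb{R}^d}\big(\bar u\,\bar\varphi_t+\sum_{j=1}^d\mathbf f_j(\bar u)\partial_{x_j}\bar\varphi\big)\,dx\,dt+\int_{\mathbb{R}^d}\bar u_0(x;\omega_\xi)\bar\varphi(0,x)\,dx=0$; (ii) for every entropy–entropy flux pair $(\eta,\mathbf Q)$ ($\eta:\mathbb{R}\to\mathbb{R}$ convex, $\mathbf Q_j'=\eta'\mathbf f_j'$) and every $\bar\varphi\in C^1_0([0,T]\times\mathbb{R}^d)$ with $\bar\varphi\ge0$, $\int_0^\infty\int_{\mathbb{R}^d}\big(\eta(\bar u)\bar\varphi_t+\sum_{j=1}^d\mathbf Q_j(\bar u)\partial_{x_j}\bar\varphi\big)\,dx\,dt+\int_{\mathbb{R}^d}\eta(\bar u_0(x;\omega_\xi))\bar\varphi(0,x)\,dx\ge0$. Entropy solution of the deterministic problem: $u\in C_b([0,T];L^1_{\mathrm{loc}}(\mathbb{R}^{d+m}))$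 satisfying the analogous weak formulation and entropy inequalities on $\mathbb{R}^{d+m}$ with the full flux $(\mathbf f_1,\dots,\mathbf f_{d+m})$, entropy fluxes $\mathbf Q_j'=\eta'\mathbf f_j'$ for $j=1,\dots,d+m$, initial data $u_0$ and test functions $\varphi\in C^1_0([0,T]\times\mathbb{R}^{d+m})$ (nonnegative for the entropy inequality). Here $y=(x,\omega_\xi)$ with $x\in\mathbb{R}^d$, $\omega_\xi\in\mathbb{R}^m$. *)

theory Defs
  imports "HOL-Analysis.Analysis" "HOL-Probability.Probability"
begin

definition C1_fun :: "(real \<Rightarrow> 'a::real_normed_vector) \<Rightarrow> bool" where
  "C1_fun F \<longleftrightarrow> (\<exists>F'. continuous_on UNIV F' \<and> (\<forall>v. (F has_vector_derivative F' v) (at v)))"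

text \<open>Test functions: C^1 on R x R^n, with compact support contained in [-inf,T) x R^n
  (i.e. the usual C^1_0([0,T) x R^n) after restriction to t >= 0).\<close>
definition test_fun :: "real \<Rightarrow> (real \<times> 'a::euclidean_space \<Rightarrow> real) \<Rightarrow> bool" where
  "test_fun T \<phi> \<longleftrightarrow>
     (\<exists>D. continuous_on UNIV D \<and> (\<forall>p. (\<phi> has_derivative blinfun_apply (D p)) (at p))) \<and>
     (\<exists>K. compact K \<and> K \<subseteq> {..<T} \<times> UNIV \<and> (\<forall>p. p \<notin> K \<longrightarrow> \<phi> p = 0))"

definition dt_test :: "(real \<times> 'a::euclidean_space \<Rightarrow> real) \<Rightarrow> real \<times> 'a \<Rightarrow> real" where
  "dt_test \<phi> p = frechet_derivative \<phi> (at p) (1, 0)"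

definition flux_test :: "(real \<times> 'a::euclidean_space \<Rightarrow> real) \<Rightarrow> real \<times> 'a \<Rightarrow> 'a \<Rightarrow> real" where
  "flux_test \<phi> p G = frechet_derivative \<phi> (at p) (0, G)"

definition entropy_pair :: "(real \<Rightarrow> 'a::euclidean_space) \<Rightarrow> (real \<Rightarrow> real) \<Rightarrow> (real \<Rightarrow> 'a) \<Rightarrow> bool" where
  "entropy_pair F \<eta> Q \<longleftrightarrow> convex_on UNIV \<eta> \<and> (\<forall>v. \<eta> differentiable (at v)) \<and>
     (\<forall>v. (Q has_vector_derivative (deriv \<eta> v *\<^sub>R vector_derivative F (at v))) (at v))"

definition weak_sol :: "real \<Rightarrow> (real \<Rightarrow> 'a::euclidean_space) \<Rightarrow> (real \<Rightarrow> 'a \<Rightarrow> real) \<Rightarrow> ('a \<Rightarrow> real) \<Rightarrow> bool" where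
  "weak_sol T F u u0 \<longleftrightarrow> (\<forall>\<phi>. test_fun T \<phi> \<longrightarrow>
     (let g = (\<lambda>(t, y). indicator {0..T} t * (u t y * dt_test \<phi> (t, y) + flux_test \<phi> (t, y) (F (u t y))));
          h = (\<lambda>y. u0 y * \<phi> (0, y))
      in integrable lborel g \<and> integrable lborel h \<and>
         (\<integral>p. g p \<partial>lborel) + (\<integral>y. h y \<partial>lborel) = 0))"

definition entropy_ineq :: "real \<Rightarrow> (real \<Rightarrow> 'a::euclidean_space) \<Rightarrow> (real \<Rightarrow> 'a \<Rightarrow> real) \<Rightarrow> ('a \<Rightarrow> real) \<Rightarrow> bool" where
  "entropy_ineq T F u u0 \<longleftrightarrow> (\<forall>\<eta> Q \<phi>. entropy_pair F \<eta> Q \<and> test_fun T \<phi> \<and> (\<forall>p. 0 \<le> \<phi> p) \<longrightarrow>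
     (let g = (\<lambda>(t, y). indicator {0..T} t * (\<eta> (u t y) * dt_test \<phi> (t, y) + flux_test \<phi> (t, y) (Q (u t y))));
          h = (\<lambda>y. \<eta> (u0 y) * \<phi> (0, y))
      in integrable lborel g \<and> integrable lborel h \<and>
         (\<integral>p. g p \<partial>lborel) + (\<integral>y. h y \<partial>lborel) \<ge> 0))"

definition Cb_L1 :: "real \<Rightarrow> (real \<Rightarrow> 'a::euclidean_space \<Rightarrow> real) \<Rightarrow> bool" where
  "Cb_L1 T u \<longleftrightarrow> (\<forall>t\<in>{0..T}. integrable lborel (u t)) \<and>
     (\<forall>t\<in>{0..T}. ((\<lambda>s. \<integral>y. \<bar>u s y - u t y\<bar> \<partial>lborel) \<longlongrightarrow> 0) (at t within {0..T})) \<and>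
     (\<exists>B. \<forall>t\<in>{0..T}. (\<integral>y. \<bar>u t y\<bar> \<partial>lborel) \<le> B)"

definition Cb_L1loc :: "real \<Rightarrow> (real \<Rightarrow> 'a::euclidean_space \<Rightarrow> real) \<Rightarrow> bool" where
  "Cb_L1loc T u \<longleftrightarrow> (\<forall>K. compact K \<longrightarrow>
     (\<forall>t\<in>{0..T}. set_integrable lborel K (u t)) \<and>
     (\<forall>t\<in>{0..T}. ((\<lambda>s. \<integral>y\<in>K. \<bar>u s y - u t y\<bar> \<partial>lborel) \<longlongrightarrow> 0) (at t within {0..T})) \<and>
     (\<exists>B. \<forall>t\<in>{0..T}. (\<integral>y\<in>K. \<bar>u t y\<bar> \<partial>lborel) \<le> B))"

definition random_entropy_sol ::
  "('m::euclidean_space) measure \<Rightarrow> real \<Rightarrow> (real \<Rightarrow> 'd::euclidean_space) \<Rightarrow> ('m \<Rightarrow> 'd \<Rightarrow> real)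
     \<Rightarrow> ('m \<Rightarrow> real \<Rightarrow> 'd \<Rightarrow> real) \<Rightarrow> bool" where
  "random_entropy_sol P T f ubar0 ubar \<longleftrightarrow> (\<forall>\<omega>. Cb_L1 T (ubar \<omega>)) \<and>
     (AE \<omega> in P. weak_sol T f (ubar \<omega>) (ubar0 \<omega>) \<and> entropy_ineq T f (ubar \<omega>) (ubar0 \<omega>))"

definition entropy_sol :: "real \<Rightarrow> (real \<Rightarrow> 'a::euclidean_space) \<Rightarrow> (real \<Rightarrow> 'a \<Rightarrow> real) \<Rightarrow> ('a \<Rightarrow> real) \<Rightarrow> bool" where
  "entropy_sol T F u u0 \<longleftrightarrow> Cb_L1loc T u \<and> weak_sol T F u u0 \<and> entropy_ineq T F u u0"

end

theory Submission
  imports Defs "HOL-Library.Diagonal_Subsequence"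
begin

text \<open>
  The solution classes contain unbounded functions, for which no uniqueness theory is available, so the
  two given solutions are not compared directly; both are compared with the limit of one scheme.
  Brenier's transport-collapse operator moves the indicator of \<open>{x. v < u x}\<close> with velocity
  \<open>F'(v)\<close> and then integrates over \<open>v\<close>. It is an \<open>L\<^sup>1\<close> contraction commuting with translations, its
  iterates are compact in \<open>C([0,T]; L\<^sup>1)\<close>, and their limits are entropy solutions. Because the flux has
  no component in the parameter directions, the scheme on the product space acts slicewise. Uniqueness of
  the random solution turns compactness into convergence on almost every slice to \<open>ubar\<close>, so (dominated
  convergence) the scheme on the product space converges to an entropy solution \<open>W\<close> over the set where
  the density is positive. Outside that set nothing is known about the data, and there one keeps the given
  \<open>u\<close>: entropy solutions may be glued along Borel sets of parameters. The glued function is an entropy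
  solution for \<open>u0\<close>, hence equals \<open>u\<close> by uniqueness.
\<close>

section \<open>Translations and Lipschitz approximation in \<open>L\<^sup>1\<close>\<close>

text \<open>\<open>ubar\<close> is given slice by slice, with no joint measurability in the
  parameter, so it cannot be inserted into the weak formulation on the product space; the iterates
  of the scheme are Borel in all variables and pass this on to \<open>W\<close>. Boundedness of the
  data by \<open>B\<close> confines the kinetic variable to \<open>[-B, B]\<close>, where a C1 flux
  has a finite speed bound \<open>S\<close>; this bound controls tails and the modulus in time.
  Compactness in space rests on the continuity of translations in L1: a contraction that commutes
  with translations cannot enlarge the modulus of its datum. The entropy inequality has a one-step
  origin: collapsing keeps the mass and lowers every convex entropy, while free transport is exact
  up to the Taylor remainder of the test function. Gluing works because the derivative of a factor
  depending on the parameter alone meets only vanishing flux components, so the entropy inequality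
  localises to Borel sets of parameters.\<close>

definition L1d :: "('a::euclidean_space \<Rightarrow> real) \<Rightarrow> ('a \<Rightarrow> real) \<Rightarrow> ennreal" where
  "L1d f g = (\<integral>\<^sup>+x. ennreal \<bar>f x - g x\<bar> \<partial>lborel)"

lemma L1d_commute: "L1d f g = L1d g f"
  by (simp add: L1d_def abs_minus_commute)

lemma L1d_triangle:
  assumes [measurable]: "f \<in> borel_measurable borel" "g \<in> borel_measurable borel" "h \<in> borel_measurable borel"
  shows "L1d f h \<le> L1d f g + L1d g h"
proof -
  have "L1d f h \<le> (\<integral>\<^sup>+x. ennreal \<bar>f x - g x\<bar> + ennreal \<bar>g x - h x\<bar> \<partial>lborel)"
    unfolding L1d_def by (intro nn_integral_mono) (simp flip: ennreal_plus)
  also have "\<dots> = L1d f g + L1d g h"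
    unfolding L1d_def by (intro nn_integral_add) auto
  finally show ?thesis .
qed

lemma nn_integral_lborel_shift:
  fixes f :: "'a::euclidean_space \<Rightarrow> ennreal"
  assumes [measurable]: "f \<in> borel_measurable borel"
  shows "(\<integral>\<^sup>+x. f (x + c) \<partial>lborel) = (\<integral>\<^sup>+x. f x \<partial>lborel)"
proof -
  have "(\<integral>\<^sup>+x. f x \<partial>lborel) = (\<integral>\<^sup>+x. f x \<partial>distr lborel borel ((+) c))"
    by (simp add: lborel_distr_plus)
  also have "\<dots> = (\<integral>\<^sup>+x. f (c + x) \<partial>lborel)"
    by (rule nn_integral_distr) auto
  finally show ?thesis by (simp add: add.commute)
qed

lemma L1d_shift:
  assumes [measurable]: "f \<in> borel_measurable borel" "g \<in> borel_measurable borel"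
  shows "L1d (\<lambda>x. f (x + c)) (\<lambda>x. g (x + c)) = L1d f g"
  unfolding L1d_def by (rule nn_integral_lborel_shift[of "\<lambda>x. ennreal \<bar>f x - g x\<bar>"]) auto

text \<open>Density of compactly supported Lipschitz functions in L1, phrased for a single
  \<open>f\<close> so that it can be carried through the induction that builds integrable functions
  from indicators. Later estimates consume both the Lipschitz constant \<open>L\<close> and the
  support radius \<open>R\<close>.\<close>

definition lip_approx :: "('a::euclidean_space \<Rightarrow> real) \<Rightarrow> bool" where
  "lip_approx f \<longleftrightarrow> (\<forall>e>0. \<exists>g L R. 0 \<le> L \<and> 0 \<le> R \<and> (\<forall>x y. \<bar>g x - g y\<bar> \<le> L * dist x y) \<and>
     (\<forall>x. R < norm x \<longrightarrow> g x = 0) \<and> L1d f g < ennreal e)"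

lemma lipschitz_borel:
  fixes g :: "'a::euclidean_space \<Rightarrow> real"
  assumes "0 \<le> L" "\<forall>x y. \<bar>g x - g y\<bar> \<le> L * dist x y"
  shows "g \<in> borel_measurable borel"
proof -
  have "L-lipschitz_on UNIV g"
    using assms by (intro lipschitz_onI) (auto simp: dist_real_def)
  then show ?thesis
    by (intro borel_measurable_continuous_onI lipschitz_on_continuous_on)
qed

lemma lip_approxE:
  assumes "lip_approx f" "e > 0"
  obtains g L R where "0 \<le> L" "0 \<le> R" "\<And>x y. \<bar>g x - g y\<bar> \<le> L * dist x y"
    "\<And>x. R < norm x \<Longrightarrow> g x = 0" "L1d f g < ennreal e" "g \<in> borel_measurable borel"
proof -
  obtain g L R where *: "0 \<le> L" "0 \<le> R" "\<forall>x y. \<bar>g x - g y\<bar> \<le> L * dist x y"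
     "\<forall>x. R < norm x \<longrightarrow> g x = 0" "L1d f g < ennreal e"
    using assms unfolding lip_approx_def by blast
  with that[OF *(1,2)] show ?thesis using lipschitz_borel[OF *(1,3)] by blast
qed

lemma lip_approx_closed:
  assumes [measurable]: "f \<in> borel_measurable borel"
    and ex: "\<And>e. e > 0 \<Longrightarrow> \<exists>h\<in>borel_measurable borel. lip_approx h \<and> L1d f h < ennreal e"
  shows "lip_approx f"
  unfolding lip_approx_def
proof (intro allI impI)
  fix e :: real assume e: "e > 0"
  obtain h where h[measurable]: "h \<in> borel_measurable borel" "lip_approx h" and hf: "L1d f h < ennreal (e/2)"
    using ex[of "e/2"] e by auto
  obtain g L R where g: "0 \<le> L" "0 \<le> R" "\<And>x y. \<bar>g x - g y\<bar> \<le> L * dist x y"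
    "\<And>x. R < norm x \<Longrightarrow> g x = 0" "L1d h g < ennreal (e/2)" and [measurable]: "g \<in> borel_measurable borel"
    by (rule lip_approxE[OF h(2), of "e/2"]) (use e in auto)
  have "L1d f g \<le> L1d f h + L1d h g" by (rule L1d_triangle) auto
  also have "\<dots> < ennreal (e/2) + ennreal (e/2)" using hf g(5) by (rule add_strict_mono)
  also have "\<dots> = ennreal e" using e by (simp flip: ennreal_plus)
  finally show "\<exists>g L R. 0 \<le> L \<and> 0 \<le> R \<and> (\<forall>x y. \<bar>g x - g y\<bar> \<le> L * dist x y) \<and>
     (\<forall>x. R < norm x \<longrightarrow> g x = 0) \<and> L1d f g < ennreal e"
    using g by blast
qed

lemma lip_approx_add:
  assumes [measurable]: "f \<in> borel_measurable borel" "h \<in> borel_measurable borel"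
    and "lip_approx f" "lip_approx h"
  shows "lip_approx (\<lambda>x. f x + h x)"
  unfolding lip_approx_def
proof (intro allI impI)
  fix e :: real assume e: "e > 0"
  obtain g L R where g: "0 \<le> L" "0 \<le> R" "\<And>x y. \<bar>g x - g y\<bar> \<le> L * dist x y"
    "\<And>x. R < norm x \<Longrightarrow> g x = 0" "L1d f g < ennreal (e/2)" and [measurable]: "g \<in> borel_measurable borel"
    by (rule lip_approxE[OF assms(3), of "e/2"]) (use e in auto)
  obtain k L' R' where k: "0 \<le> L'" "0 \<le> R'" "\<And>x y. \<bar>k x - k y\<bar> \<le> L' * dist x y"
    "\<And>x. R' < norm x \<Longrightarrow> k x = 0" "L1d h k < ennreal (e/2)" and [measurable]: "k \<in> borel_measurable borel"
    by (rule lip_approxE[OF assms(4), of "e/2"]) (use e in auto)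
  have "L1d (\<lambda>x. f x + h x) (\<lambda>x. g x + k x) \<le> (\<integral>\<^sup>+x. ennreal \<bar>f x - g x\<bar> + ennreal \<bar>h x - k x\<bar> \<partial>lborel)"
    unfolding L1d_def by (intro nn_integral_mono) (simp flip: ennreal_plus)
  also have "\<dots> = L1d f g + L1d h k"
    unfolding L1d_def by (intro nn_integral_add) auto
  also have "\<dots> < ennreal (e/2) + ennreal (e/2)" using g(5) k(5) by (rule add_strict_mono)
  also have "\<dots> = ennreal e" using e by (simp flip: ennreal_plus)
  finally have 1: "L1d (\<lambda>x. f x + h x) (\<lambda>x. g x + k x) < ennreal e" .
  have 2: "\<bar>(g x + k x) - (g y + k y)\<bar> \<le> (L + L') * dist x y" for x y
    using g(3)[of x y] k(3)[of x y] by (simp add: ring_distribs abs_le_iff)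
  have 3: "max R R' < norm x \<Longrightarrow> g x + k x = 0" for x
    using g(4) k(4) by simp
  show "\<exists>g L R. 0 \<le> L \<and> 0 \<le> R \<and> (\<forall>x y. \<bar>g x - g y\<bar> \<le> L * dist x y) \<and>
     (\<forall>x. R < norm x \<longrightarrow> g x = 0) \<and> L1d (\<lambda>x. f x + h x) g < ennreal e"
    using 1 2 3 g(1,2) k(1,2)
    by (intro exI[of _ "\<lambda>x. g x + k x"] exI[of _ "L + L'"] exI[of _ "max R R'"]) auto
qed

lemma lip_approx_scale:
  assumes [measurable]: "f \<in> borel_measurable borel" and "lip_approx f"
  shows "lip_approx (\<lambda>x. c * f x)"
  unfolding lip_approx_def
proof (intro allI impI)
  fix e :: real assume e: "e > 0"
  \<comment> \<open>The \<open>+ 1\<close> keeps the quotient meaningful for \<open>c = 0\<close>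
    and makes the final inequality strict.\<close>
  define d where "d = e / (\<bar>c\<bar> + 1)"
  have d: "d > 0" using e by (simp add: d_def)
  obtain g L R where g: "0 \<le> L" "0 \<le> R" "\<And>x y. \<bar>g x - g y\<bar> \<le> L * dist x y"
    "\<And>x. R < norm x \<Longrightarrow> g x = 0" "L1d f g < ennreal d" and [measurable]: "g \<in> borel_measurable borel"
    by (rule lip_approxE[OF assms(2) d]) auto
  have "L1d (\<lambda>x. c * f x) (\<lambda>x. c * g x) = (\<integral>\<^sup>+x. ennreal \<bar>c\<bar> * ennreal \<bar>f x - g x\<bar> \<partial>lborel)"
    unfolding L1d_def by (intro nn_integral_cong) (simp flip: ennreal_mult' right_diff_distrib add: abs_mult)
  also have "\<dots> = ennreal \<bar>c\<bar> * L1d f g"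
    unfolding L1d_def by (intro nn_integral_cmult) auto
  also have "\<dots> \<le> ennreal \<bar>c\<bar> * ennreal d" using g(5) by (intro mult_left_mono) auto
  also have "\<dots> < ennreal e" using e unfolding d_def
    by (simp flip: ennreal_mult add: field_simps ennreal_lessI)
  finally have 1: "L1d (\<lambda>x. c * f x) (\<lambda>x. c * g x) < ennreal e" .
  have 2: "\<bar>c * g x - c * g y\<bar> \<le> (\<bar>c\<bar> * L) * dist x y" for x y
    using mult_left_mono[OF g(3)[of x y], of "\<bar>c\<bar>"] by (simp add: mult.assoc flip: right_diff_distrib abs_mult)
  show "\<exists>g L R. 0 \<le> L \<and> 0 \<le> R \<and> (\<forall>x y. \<bar>g x - g y\<bar> \<le> L * dist x y) \<and>
     (\<forall>x. R < norm x \<longrightarrow> g x = 0) \<and> L1d (\<lambda>x. c * f x) g < ennreal e"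
    using 1 2 g(1,2,4)
    by (intro exI[of _ "\<lambda>x. c * g x"] exI[of _ "\<bar>c\<bar> * L"] exI[of _ R]) auto
qed

lemma L1d_dominated:
  fixes s :: "nat \<Rightarrow> 'a::euclidean_space \<Rightarrow> real"
  assumes [measurable]: "\<And>i. s i \<in> borel_measurable borel" "f \<in> borel_measurable borel"
    and "integrable lborel w" "\<And>i x. \<bar>s i x\<bar> \<le> w x" "\<And>x. (\<lambda>i. s i x) \<longlonglongrightarrow> f x"
  shows "(\<lambda>i. L1d f (s i)) \<longlonglongrightarrow> 0"
proof -
  have "(\<lambda>i. \<integral>\<^sup>+x. norm (f x - s i x) \<partial>lborel) \<longlonglongrightarrow> 0"
  proof (rule nn_integral_dominated_convergence_norm[where w=w])
    show "(\<integral>\<^sup>+x. ennreal (w x) \<partial>lborel) < \<infinity>"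
    proof -
      have "(\<integral>\<^sup>+x. ennreal (w x) \<partial>lborel) \<le> (\<integral>\<^sup>+x. ennreal (norm (w x)) \<partial>lborel)"
        by (intro nn_integral_mono ennreal_leI) auto
      also have "\<dots> < \<infinity>" using assms(3) by (simp add: integrable_iff_bounded)
      finally show ?thesis .
    qed
  qed (use assms(3-5) in auto)
  then show ?thesis by (simp add: L1d_def)
qed

lemma lip_approx_lim:
  fixes s :: "nat \<Rightarrow> 'a::euclidean_space \<Rightarrow> real"
  assumes [measurable]: "\<And>i. s i \<in> borel_measurable borel" "f \<in> borel_measurable borel"
    and "integrable lborel w" "\<And>i x. \<bar>s i x\<bar> \<le> w x" "\<And>x. (\<lambda>i. s i x) \<longlonglongrightarrow> f x"
    and "\<And>i. lip_approx (s i)"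
  shows "lip_approx f"
proof (rule lip_approx_closed)
  fix e :: real assume "e > 0"
  have "(\<lambda>i. L1d f (s i)) \<longlonglongrightarrow> 0" by (rule L1d_dominated[OF assms(1-5)])
  from order_tendstoD(2)[OF this, of "ennreal e"] \<open>e > 0\<close>
  obtain i where "L1d f (s i) < ennreal e"
    by (auto simp: eventually_sequentially)
  then show "\<exists>h\<in>borel_measurable borel. lip_approx h \<and> L1d f h < ennreal e"
    using assms(6) by (intro bexI[of _ "s i"]) auto
qed fact

text \<open>The truncated multiples \<open>min 1 (n * infdist x (- V))\<close> of the distance to
  the complement are \<open>n\<close>-Lipschitz, vanish off \<open>V\<close> and increase to its
  indicator, which is an integrable majorant because \<open>V\<close> is bounded.\<close>

lemma lip_approx_open:
  fixes V :: "'a::euclidean_space set"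
  assumes V: "open V" "V \<subseteq> ball 0 R"
  shows "lip_approx (indicator V)"
proof -
  \<comment> \<open>\<open>infdist\<close> to the empty set is 0 by convention, so positivity on
    \<open>V\<close> needs a nonempty complement.\<close>
  have ne: "- V \<noteq> {}" 
  proof
    assume "- V = {}"
    then have "ball 0 R = (UNIV::'a set)" using V by auto
    then show False by (metis bounded_ball not_bounded_UNIV)
  qed
  define w where "w n x = min 1 (real n * infdist x (- V))" for n x
  have lip: "\<bar>w n x - w n y\<bar> \<le> real n * dist x y" for n x y
  proof -
    have "infdist x (-V) \<le> dist x y + infdist y (-V)" "infdist y (-V) \<le> dist x y + infdist x (-V)"
      using infdist_triangle[of x "-V" y] infdist_triangle[of y "-V" x] by (auto simp: dist_commute)
    from mult_left_mono[OF this(1), of "real n"] mult_left_mono[OF this(2), of "real n"]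
    show ?thesis unfolding w_def by (auto simp: ring_distribs min_def)
  qed
  have [measurable]: "w n \<in> borel_measurable borel" for n
    using lip by (intro lipschitz_borel[of "real n"]) auto
  have supp: "w n x = 0" if "x \<notin> V" for n x using that by (simp add: w_def)
  have le: "\<bar>w n x\<bar> \<le> indicator V x" for n x
    using supp[of x n] by (auto simp: w_def infdist_nonneg split: split_indicator)
  have lim: "(\<lambda>n. w n x) \<longlonglongrightarrow> indicator V x" for x
  proof (cases "x \<in> V")
    case True
    have pos: "infdist x (-V) > 0"
      using in_closed_iff_infdist_zero[of "-V" x] V(1) ne True infdist_nonneg[of x "-V"]
      by (auto simp: closed_Compl less_le)
    obtain N :: nat where "1 / infdist x (-V) \<le> real N" using real_arch_simple by blast
    then have "1 \<le> real N * infdist x (-V)" using pos by (simp add: field_simps)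
    moreover have "real N * infdist x (-V) \<le> real n * infdist x (-V)" if "n \<ge> N" for n
      using pos that by (intro mult_right_mono) auto
    ultimately have "w n x = 1" if "n \<ge> N" for n
      unfolding w_def using that by (meson min_absorb1 order_trans)
    then have "(\<lambda>n. w n x) \<longlonglongrightarrow> 1"
      by (intro tendsto_eventually) (auto simp: eventually_sequentially)
    then show ?thesis using True by simp
  qed (simp add: supp)
  have int: "integrable lborel (indicator V :: 'a \<Rightarrow> real)"
    using V(1) emeasure_bounded_finite[OF bounded_subset[OF bounded_ball V(2)]]
    by (intro integrable_real_indicator) auto
  have w0: "w n x = 0" if "max 0 R < norm x" for n x
    using that V(2) by (intro supp) auto
  have lw: "lip_approx (w n)" for n
    unfolding lip_approx_def
  proof (intro allI impI)
    fix e :: real assume "0 < e"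
    then have "L1d (w n) (w n) < ennreal e" by (simp add: L1d_def)
    then show "\<exists>g L R. 0 \<le> L \<and> 0 \<le> R \<and> (\<forall>x y. \<bar>g x - g y\<bar> \<le> L * dist x y) \<and>
     (\<forall>x. R < norm x \<longrightarrow> g x = 0) \<and> L1d (w n) g < ennreal e"
      using lip[of n] w0[of _ n] by (meson max.cobounded1 of_nat_0_le_iff)
  qed
  show ?thesis
    by (rule lip_approx_lim[where s=w and w="indicator V"]) (use V le lim int lw in simp_all)
qed

text \<open>Outer regularity gives an open set around \<open>A\<close> with small excess; cutting it
  by the ball that contains \<open>A\<close> keeps it bounded and loses no point of
  \<open>A\<close>.\<close>

lemma lip_approx_bounded_set:
  fixes A :: "'a::euclidean_space set"
  assumes [measurable]: "A \<in> sets borel" and A: "A \<subseteq> ball 0 R"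
  shows "lip_approx (indicator A)"
proof (rule lip_approx_closed)
  fix e :: real assume "e > 0"
  obtain U where U: "open U" "A \<subseteq> U" "emeasure lebesgue (U - A) < ennreal e"
    by (rule sets_lebesgue_outer_open[of A e]) (use assms(1) \<open>e > 0\<close> in auto)
  let ?V = "U \<inter> ball 0 R"
  have [measurable]: "U \<in> sets borel" using U by auto
  have "L1d (indicator A) (indicator ?V) \<le> (\<integral>\<^sup>+x. indicator (U - A) x \<partial>lborel)"
    unfolding L1d_def using A U by (intro nn_integral_mono) (auto split: split_indicator)
  also have "\<dots> = emeasure lebesgue (U - A)" by simp
  also have "\<dots> < ennreal e" by fact
  finally show "\<exists>h\<in>borel_measurable borel. lip_approx h \<and> L1d (indicator A) h < ennreal e"
    using lip_approx_open[of ?V R] U by (intro bexI[of _ "indicator ?V"] borel_measurable_indicator) auto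
qed (use assms(1) in simp)

lemma lip_approx_integrable:
  fixes f :: "'a::euclidean_space \<Rightarrow> real"
  assumes "integrable lborel f"
  shows "lip_approx f"
  using assms
proof (induction rule: integrable_induct)
  case (base A c)
  have [measurable]: "A \<in> sets borel" using base by auto
  \<comment> \<open>A set of finite measure may be unbounded; it is exhausted by its intersections
    with balls, dominated by its own indicator.\<close>
  have "lip_approx (indicator A :: 'a \<Rightarrow> real)"
  proof (rule lip_approx_lim[where s="\<lambda>n. indicator (A \<inter> ball 0 (real n))" and w="indicator A"])
    show "integrable lborel (indicator A :: 'a \<Rightarrow> real)"
      using base by (intro integrable_real_indicator) auto
    show "lip_approx (indicator (A \<inter> ball 0 (real i)))" for i
      by (rule lip_approx_bounded_set[of _ "real i"]) auto
    fix x :: 'a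
    obtain N :: nat where "norm x < real N" using reals_Archimedean2 by blast
    then have "indicator (A \<inter> ball 0 (real n)) x = (indicator A x :: real)" if "n \<ge> N" for n
      using that by (auto split: split_indicator)
    then show "(\<lambda>n. indicator (A \<inter> ball 0 (real n)) x :: real) \<longlonglongrightarrow> indicator A x"
      by (intro tendsto_eventually) (auto simp: eventually_sequentially)
    show "indicator (A \<inter> ball 0 (real i)) \<in> borel_measurable (borel :: 'a measure)" for i
      by (intro borel_measurable_indicator) auto
  qed (auto split: split_indicator)
  from lip_approx_scale[OF _ this, of c] show ?case by (simp add: mult.commute)
next
  case (add f g)
  then show ?case by (auto intro: lip_approx_add)
next
  case (lim f s)
  show ?case
    by (rule lip_approx_lim[where s=s and w="\<lambda>x. 2 * \<bar>f x\<bar>"]) (use lim in auto)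
qed

text \<open>A translation is an L1 isometry, so replacing \<open>f\<close> by a Lipschitz
  \<open>g\<close> costs the approximation error twice, and \<open>g\<close> itself moves by at most
  \<open>L * norm y\<close> on a fixed ball.\<close>

lemma L1d_translation_tendsto:
  fixes f :: "'a::euclidean_space \<Rightarrow> real"
  assumes f: "integrable lborel f" and e: "e > 0"
  obtains d where "d > 0" "\<And>y. norm y < d \<Longrightarrow> L1d (\<lambda>x. f (x + y)) f \<le> ennreal e"
proof -
  have [measurable]: "f \<in> borel_measurable borel" using f by auto
  obtain g L R where g: "0 \<le> L" "0 \<le> R" "\<And>x y. \<bar>g x - g y\<bar> \<le> L * dist x y"
    "\<And>x. R < norm x \<Longrightarrow> g x = 0" "L1d f g < ennreal (e/4)" and [measurable]: "g \<in> borel_measurable borel"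
    by (rule lip_approxE[OF lip_approx_integrable[OF f], of "e/4"]) (use e in auto)
  define m where "m = measure lborel (cball (0::'a) (R + 1))"
  have "emeasure lborel (cball (0::'a) (R + 1)) < \<infinity>"
    by (rule emeasure_bounded_finite) (rule bounded_cball)
  then have m: "emeasure lborel (cball (0::'a) (R + 1)) = ennreal m"
    unfolding m_def by (metis emeasure_eq_ennreal_measure infinity_ennreal_def less_irrefl)
  have m0: "m \<ge> 0" by (simp add: m_def)
  \<comment> \<open>The bound 1 keeps the support of the translate of \<open>g\<close> inside radius
    \<open>R + 1\<close>; the other bound makes the displacement cost at most \<open>e/2\<close>,
    with \<open>+ 1\<close> guarding against \<open>L * m = 0\<close>.\<close>
  define d where "d = min 1 (e / (2 * (L * m + 1)))"
  have Lm: "L * m + 1 > 0" using g m0 by (simp add: add_nonneg_pos)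
  have "d > 0" using e Lm by (simp add: d_def)
  moreover have "L1d (\<lambda>x. f (x + y)) f \<le> ennreal e" if y: "norm y < d" for y
  proof -
    have "L1d (\<lambda>x. g (x + y)) g \<le> (\<integral>\<^sup>+x. ennreal (L * norm y) * indicator (cball (0::'a) (R+1)) x \<partial>lborel)"
      unfolding L1d_def
    proof (intro nn_integral_mono)
      fix x
      show "ennreal \<bar>g (x + y) - g x\<bar> \<le> ennreal (L * norm y) * indicator (cball 0 (R+1)) x"
      proof (cases "norm x \<le> R + 1")
        case True then show ?thesis using g(3)[of "x+y" x] by (simp add: dist_norm)
      next
        case False
        then have "norm (x + y) > R" using y norm_triangle_ineq2[of x "-y"] by (simp add: d_def)
        then show ?thesis using False g(4) by auto
      qed
    qed
    also have "\<dots> = ennreal (L * norm y * m)"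
      using m0 g by (subst nn_integral_cmult_indicator) (auto simp: m ennreal_mult)
    also have "\<dots> \<le> ennreal (e/2)"
    proof (rule ennreal_leI)
      have "L * norm y * m \<le> (L * m + 1) * norm y" by (simp add: algebra_simps)
      also have "\<dots> \<le> (L * m + 1) * (e / (2 * (L * m + 1)))"
        using y Lm by (intro mult_left_mono) (auto simp: d_def)
      also have "\<dots> = e/2" using Lm by (simp add: field_simps)
      finally show "L * norm y * m \<le> e/2" .
    qed
    finally have 1: "L1d (\<lambda>x. g (x + y)) g \<le> ennreal (e/2)" .
    have "L1d (\<lambda>x. f (x + y)) f \<le> L1d (\<lambda>x. f (x + y)) (\<lambda>x. g (x + y)) + L1d (\<lambda>x. g (x + y)) f"
      by (rule L1d_triangle) auto
    also have "L1d (\<lambda>x. g (x + y)) f \<le> L1d (\<lambda>x. g (x + y)) g + L1d g f"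
      by (rule L1d_triangle) auto
    also have "L1d (\<lambda>x. f (x + y)) (\<lambda>x. g (x + y)) = L1d f g" by (rule L1d_shift) auto
    finally have "L1d (\<lambda>x. f (x + y)) f \<le> L1d f g + (L1d (\<lambda>x. g (x + y)) g + L1d f g)"
      by (simp add: L1d_commute add_left_mono)
    also have "\<dots> \<le> ennreal (e/4) + (ennreal (e/2) + ennreal (e/4))"
      using g(5) 1 by (intro add_mono) auto
    also have "\<dots> = ennreal e" using e by (simp flip: ennreal_plus)
    finally show ?thesis .
  qed
  ultimately show ?thesis using that by blast
qed

section \<open>C1 kernels and averages in L1\<close>

lemma ex_C1_kernel:
  assumes e: "e > 0"
  obtains k :: "'a::euclidean_space \<Rightarrow> real" and C and D where
    "k \<in> borel_measurable borel" "\<And>y. 0 \<le> k y" "\<And>y. k y \<le> C" "(\<integral>\<^sup>+y. ennreal (k y) \<partial>lborel) = 1"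
    "\<And>y. e \<le> norm y \<Longrightarrow> k y = 0"
    "continuous_on UNIV D" "\<And>y. (k has_derivative blinfun_apply (D y)) (at y)"
proof -
  \<comment> \<open>Squaring the positive part of the polynomial
    \<open>e\<^sup>2 - y \<bullet> y\<close> removes the kink at the sphere of radius
    \<open>e\<close>: the bump is C1 with an explicit derivative, and one derivative is all that
    test functions require.\<close>
  define q :: "'a \<Rightarrow> real" where "q y = (max 0 (e\<^sup>2 - y \<bullet> y))\<^sup>2" for y
  have q0: "0 \<le> q y" for y by (simp add: q_def)
  have qz: "q y = 0" if "e \<le> norm y" for y
    using power_mono[OF that, of 2] e by (simp add: q_def dot_square_norm)
  have qpos: "0 < q y" if "norm y < e" for y
    using power_strict_mono[OF that, of 2] e by (auto simp: q_def dot_square_norm)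
  have qle: "q y \<le> (e\<^sup>2)\<^sup>2" for y
    unfolding q_def by (intro power_mono) auto
  have [measurable]: "q \<in> borel_measurable borel"
    unfolding q_def[abs_def] by measurable
  have "integrable lborel (\<lambda>y. indicator (ball 0 e) y *\<^sub>R q y)"
  proof (rule integrableI_bounded_set_indicator[where B="(e\<^sup>2)\<^sup>2"])
    show "emeasure lborel (ball (0::'a) e) < \<infinity>"
      by (rule emeasure_bounded_finite) (rule bounded_ball)
  qed (use q0 qle in auto)
  moreover have "(\<lambda>y. indicator (ball 0 e) y *\<^sub>R q y) = q"
    using qz by (auto simp: fun_eq_iff split: split_indicator)
  ultimately have int: "integrable lborel q" by simp
  define c where "c = integral\<^sup>L lborel q"
  have c0: "c > 0"
  proof -
    have "c \<noteq> 0"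
    proof
      assume "c = 0"
      then have "AE y in lborel. q y = 0"
        using integral_nonneg_eq_0_iff_AE[OF int] q0 by (simp add: c_def)
      then have "AE y in lborel. y \<notin> ball (0::'a) e"
        by (rule eventually_mono) (metis less_irrefl mem_ball_0 qpos)
      then have "ball 0 e \<in> null_sets (lborel :: 'a measure)"
        by (subst (asm) AE_iff_null_sets[symmetric]) auto
      then have "ball (0::'a) e = {}"
        by (metis null_sets_completionI negligible_iff_null_sets open_ball open_not_negligible)
      then show False using e by simp
    qed
    moreover have "c \<ge> 0" unfolding c_def using q0 by (intro integral_nonneg_AE) auto
    ultimately show ?thesis by simp
  qed
  define k where "k y = q y / c" for y
  define D :: "'a \<Rightarrow> 'a \<Rightarrow>\<^sub>L real" where "D y = (- 4 * max 0 (e\<^sup>2 - y \<bullet> y) / c) *\<^sub>R blinfun_inner_left y" for y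
  have 1: "k \<in> borel_measurable borel" unfolding k_def[abs_def] by measurable
  have "(\<integral>\<^sup>+y. ennreal (k y) \<partial>lborel) = ennreal (\<integral>y. k y \<partial>lborel)"
    using int q0 c0 by (intro nn_integral_eq_integral) (auto simp: k_def)
  also have "(\<integral>y. k y \<partial>lborel) = 1" using c0 by (simp add: k_def[abs_def] c_def)
  finally have 2: "(\<integral>\<^sup>+y. ennreal (k y) \<partial>lborel) = 1" by simp
  have 3: "continuous_on UNIV D"
    unfolding D_def using c0
    by (intro continuous_intros bounded_linear.continuous_on[OF bounded_linear_blinfun_inner_left]) auto
  have sq: "((\<lambda>s::real. (max 0 s)\<^sup>2) has_real_derivative 2 * max 0 s) (at s)" for s
  proof -
    consider "s > 0" | "s < 0" | "s = 0" by linarith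
    then show ?thesis
    proof cases
      case 1
      have "((\<lambda>s::real. s\<^sup>2) has_real_derivative 2 * s) (at s)" by (auto intro!: derivative_eq_intros)
      moreover have "eventually (\<lambda>x. x\<^sup>2 = (max 0 x)\<^sup>2) (nhds s)"
        using eventually_nhds_in_open[of "{0<..}" s] 1 by (auto elim!: eventually_mono)
      ultimately show ?thesis using 1
        by (subst (asm) DERIV_cong_ev[OF refl _ refl]) auto
    next
      case 2
      have "((\<lambda>s::real. 0) has_real_derivative 0) (at s)" by simp
      moreover have "eventually (\<lambda>x. 0 = (max 0 x)\<^sup>2) (nhds s)"
        using eventually_nhds_in_open[of "{..<0}" s] 2 by (auto elim!: eventually_mono)
      ultimately show ?thesis using 2
        by (subst (asm) DERIV_cong_ev[OF refl _ refl]) auto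
    next
      case 3
      have "((\<lambda>h::real. (max 0 (0 + h))\<^sup>2 / h) \<longlongrightarrow> 0) (at 0)"
      proof (rule Lim_null_comparison)
        have "norm ((max 0 h)\<^sup>2 / h) \<le> \<bar>h\<bar>" for h :: real
          by (auto simp: max_def power2_eq_square)
        then show "\<forall>\<^sub>F h in at 0. norm ((max 0 (0 + h))\<^sup>2 / h) \<le> \<bar>h\<bar>" by simp
        show "((\<lambda>h. \<bar>h\<bar>) \<longlongrightarrow> 0) (at (0::real))" by (auto intro!: tendsto_eq_intros)
      qed
      then show ?thesis using 3 by (simp add: DERIV_def)
    qed
  qed
  have 4: "(k has_derivative blinfun_apply (D y)) (at y)" for y
  proof -
    have "((\<lambda>y. e\<^sup>2 - y \<bullet> y) has_derivative (\<lambda>h. - (2 * (y \<bullet> h)))) (at y)"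
      by (auto intro!: derivative_eq_intros simp: inner_commute)
    from has_derivative_compose[OF this sq[of "e\<^sup>2 - y \<bullet> y", unfolded has_field_derivative_def]]
    have "(q has_derivative (\<lambda>h. 2 * max 0 (e\<^sup>2 - y \<bullet> y) * (- (2 * (y \<bullet> h))))) (at y)"
      by (simp add: q_def[abs_def])
    then have "((\<lambda>y. q y * (1/c)) has_derivative (\<lambda>h. 2 * max 0 (e\<^sup>2 - y \<bullet> y) * (- (2 * (y \<bullet> h))) * (1/c))) (at y)"
      by (rule has_derivative_mult_left)
    moreover have "(\<lambda>h. 2 * max 0 (e\<^sup>2 - y \<bullet> y) * (- (2 * (y \<bullet> h))) * (1/c)) = blinfun_apply (D y)"
      by (auto simp: D_def fun_eq_iff blinfun.scaleR_left blinfun.minus_left inner_commute)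
    ultimately show ?thesis by (simp add: k_def[abs_def])
  qed
  show ?thesis
    by (rule that[of k "(e\<^sup>2)\<^sup>2 / c" D]) (use 1 2 3 4 q0 qle qz c0 in \<open>auto simp: k_def divide_right_mono\<close>)
qed

lemma integrable_bounded_mult:
  fixes k f :: "'a::euclidean_space \<Rightarrow> real"
  assumes [measurable]: "k \<in> borel_measurable borel" and k: "\<And>x. \<bar>k x\<bar> \<le> C" and f: "integrable lborel f"
  shows "integrable lborel (\<lambda>x. k x * f x)"
proof (rule Bochner_Integration.integrable_bound)
  show "integrable lborel (\<lambda>x. C * f x)" using f by simp
  have [measurable]: "f \<in> borel_measurable borel" using f by auto
  show "(\<lambda>x. k x * f x) \<in> borel_measurable lborel" by simp
  show "AE x in lborel. norm (k x * f x) \<le> norm (C * f x)"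
    using k by (intro AE_I2) (simp add: abs_mult mult_right_mono order_trans[OF _ abs_ge_self])
qed

lemma integrable_lborel_shift:
  fixes f :: "'a::euclidean_space \<Rightarrow> 'b::{banach, second_countable_topology}"
  assumes "integrable lborel f"
  shows "integrable lborel (\<lambda>x. f (c + x))"
proof -
  have "integrable (distr lborel borel ((+) c)) f" using assms by (simp add: lborel_distr_plus)
  then show ?thesis by (rule integrable_distr[rotated]) simp
qed

lemma integral_lborel_shift:
  fixes f :: "'a::euclidean_space \<Rightarrow> 'b::{banach, second_countable_topology}"
  assumes "f \<in> borel_measurable borel"
  shows "(\<integral>x. f (c + x) \<partial>lborel) = (\<integral>x. f x \<partial>lborel)"
proof -
  have "(\<integral>x. f x \<partial>lborel) = (\<integral>x. f x \<partial>distr lborel borel ((+) c))" by (simp add: lborel_distr_plus)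
  also have "\<dots> = (\<integral>x. f (c + x) \<partial>lborel)" using assms by (intro integral_distr) auto
  finally show ?thesis by simp
qed

text \<open>A correlation rather than a convolution: it averages the translates
  \<open>u (x + y)\<close>, the form to which the translation modulus applies directly.\<close>

definition avg :: "('a::euclidean_space \<Rightarrow> real) \<Rightarrow> ('a \<Rightarrow> real) \<Rightarrow> 'a \<Rightarrow> real" where
  "avg k u x = (\<integral>y. k y * u (x + y) \<partial>lborel)"

lemma avg_borel [measurable]:
  assumes [measurable]: "k \<in> borel_measurable borel" "u \<in> borel_measurable borel"
  shows "avg k u \<in> borel_measurable borel"
  unfolding avg_def[abs_def] by measurable

text \<open>Since \<open>k\<close> has mass 1, the difference is an average of translation
  differences; by Tonelli its L1 norm is at most the average of their norms, and only displacements
  with \<open>norm y < e\<close> carry weight.\<close>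

lemma L1d_avg:
  fixes k u :: "'a::euclidean_space \<Rightarrow> real"
  assumes [measurable]: "k \<in> borel_measurable borel" and k: "\<And>y. 0 \<le> k y" "\<And>y. k y \<le> C"
    "(\<integral>\<^sup>+y. ennreal (k y) \<partial>lborel) = 1" "\<And>y. e \<le> norm y \<Longrightarrow> k y = 0"
    and u: "integrable lborel u" and d: "\<And>y. norm y < e \<Longrightarrow> L1d (\<lambda>x. u (x + y)) u \<le> d"
  shows "L1d (avg k u) u \<le> d"
proof -
  have [measurable]: "u \<in> borel_measurable borel" using u by auto
  have ki: "integrable lborel k" "integral\<^sup>L lborel k = 1"
  proof -
    show "integrable lborel k" using k by (intro integrableI_nonneg) auto
    then show "integral\<^sup>L lborel k = 1"
      using k by (subst integral_eq_nn_integral) auto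
  qed
  have pt: "ennreal \<bar>avg k u x - u x\<bar> \<le> (\<integral>\<^sup>+y. ennreal (k y) * ennreal \<bar>u (x + y) - u x\<bar> \<partial>lborel)" for x
  proof -
    have i1: "integrable lborel (\<lambda>y. k y * u (x + y))"
      using k by (intro integrable_bounded_mult[where C=C] integrable_lborel_shift u) auto
    have i2: "integrable lborel (\<lambda>y. k y * u x)" using ki by simp
    have "avg k u x - u x = (\<integral>y. k y * u (x + y) - k y * u x \<partial>lborel)"
      using i1 i2 ki by (simp add: avg_def)
    also have "ennreal \<bar>\<dots>\<bar> \<le> (\<integral>\<^sup>+y. ennreal (norm (k y * u (x + y) - k y * u x)) \<partial>lborel)"
      using integral_norm_bound_ennreal[OF Bochner_Integration.integrable_diff[OF i1 i2]] by simp
    also have "\<dots> = (\<integral>\<^sup>+y. ennreal (k y) * ennreal \<bar>u (x + y) - u x\<bar> \<partial>lborel)"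
      using k by (intro nn_integral_cong) (simp flip: ennreal_mult right_diff_distrib add: abs_mult)
    finally show ?thesis .
  qed
  have "L1d (avg k u) u \<le> (\<integral>\<^sup>+x. \<integral>\<^sup>+y. ennreal (k y) * ennreal \<bar>u (x + y) - u x\<bar> \<partial>lborel \<partial>lborel)"
    unfolding L1d_def by (intro nn_integral_mono pt)
  also have "\<dots> = (\<integral>\<^sup>+y. \<integral>\<^sup>+x. ennreal (k y) * ennreal \<bar>u (x + y) - u x\<bar> \<partial>lborel \<partial>lborel)"
    by (rule lborel_pair.Fubini') measurable
  also have "\<dots> = (\<integral>\<^sup>+y. ennreal (k y) * L1d (\<lambda>x. u (x + y)) u \<partial>lborel)"
    unfolding L1d_def by (intro nn_integral_cong nn_integral_cmult) measurable
  also have "\<dots> \<le> (\<integral>\<^sup>+y. ennreal (k y) * d \<partial>lborel)"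
  proof (intro nn_integral_mono)
    fix y show "ennreal (k y) * L1d (\<lambda>x. u (x + y)) u \<le> ennreal (k y) * d"
      by (cases "norm y < e") (use d k(4) in \<open>auto intro: mult_left_mono\<close>)
  qed
  also have "\<dots> = d" using k(3) by (simp add: nn_integral_multc)
  finally show ?thesis .
qed

section \<open>The transport-collapse operator\<close>

text \<open>Subtracting \<open>B\<close> normalises the height: for
  \<open>\<bar>s\<bar> \<le> B\<close> the part of \<open>[-B, B]\<close> below \<open>s\<close> has
  length \<open>s + B\<close>, so \<open>\<tau> = 0\<close> returns every \<open>u\<close> with
  values in that range.\<close>

definition tc :: "(real \<Rightarrow> 'a::euclidean_space) \<Rightarrow> real \<Rightarrow> real \<Rightarrow> ('a \<Rightarrow> real) \<Rightarrow> 'a \<Rightarrow> real" where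
  "tc a B \<tau> u x = (\<integral>v. indicator {-B..B} v * (if v < u (x - \<tau> *\<^sub>R a v) then 1 else 0) \<partial>lborel) - B"

text \<open>\<open>a\<close> stands for the derivative of the flux. Its bound is demanded on the
  slab \<open>[-B, B]\<close>, where continuity provides it; \<open>S\<close> bounds the speed of
  propagation.\<close>

locale collapse =
  fixes a :: "real \<Rightarrow> 'a::euclidean_space" and B S :: real
  assumes a_meas [measurable]: "a \<in> borel_measurable borel"
    and B_nonneg: "0 \<le> B"
    and S_nonneg: "0 \<le> S"
    and a_bound: "\<And>v. \<bar>v\<bar> \<le> B \<Longrightarrow> norm (a v) \<le> S"
begin

abbreviation T :: "real \<Rightarrow> ('a \<Rightarrow> real) \<Rightarrow> 'a \<Rightarrow> real" where "T \<equiv> tc a B"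

lemma T_borel [measurable]:
  assumes [measurable]: "u \<in> borel_measurable borel"
  shows "T \<tau> u \<in> borel_measurable borel"
  unfolding tc_def[abs_def] by measurable

lemma integrable_slab:
  fixes g :: "real \<Rightarrow> real"
  assumes [measurable]: "g \<in> borel_measurable borel" and "\<And>v. \<bar>v\<bar> \<le> B \<Longrightarrow> \<bar>g v\<bar> \<le> C"
  shows "integrable lborel (\<lambda>v. indicator {-B..B} v * g v)"
proof -
  have "integrable lborel (\<lambda>v. indicator {-B..B} v *\<^sub>R g v)"
    by (rule integrableI_bounded_set_indicator[where B=C])
       (use assms(2) in \<open>auto simp: emeasure_lborel_Icc_eq\<close>)
  then show ?thesis by simp
qed

lemma integral_slab_less:
  assumes "\<bar>s\<bar> \<le> B"
  shows "(\<integral>v. indicator {-B..B} v * (if v < s then 1 else 0) \<partial>lborel) = s + B"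
proof -
  have "(\<lambda>v. indicator {-B..B} v * (if v < s then 1 else 0 :: real)) = indicator {-B..<s}"
    using assms by (auto simp: fun_eq_iff split: split_indicator)
  then show ?thesis using assms by simp
qed

lemma T_range:
  assumes [measurable]: "u \<in> borel_measurable borel"
  shows "\<bar>T \<tau> u x\<bar> \<le> B"
proof -
  let ?g = "\<lambda>v. indicator {-B..B} v * (if v < u (x - \<tau> *\<^sub>R a v) then 1 else 0 :: real)"
  have i: "integrable lborel ?g" by (rule integrable_slab[where C=1]) auto
  have "0 \<le> integral\<^sup>L lborel ?g" by (intro integral_nonneg_AE) auto
  moreover have "integral\<^sup>L lborel ?g \<le> (\<integral>v. indicator {-B..B} v \<partial>lborel)"
    using i B_nonneg
    by (intro integral_mono integrable_real_indicator) (auto simp: emeasure_lborel_Icc_eq split: split_indicator)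
  moreover have "(\<integral>v. indicator {-B..B} v \<partial>lborel) = 2 * B" using B_nonneg by simp
  ultimately show ?thesis unfolding tc_def by linarith
qed

text \<open>With the absolute value inside the integral over \<open>v\<close>, what remains is the
  length of the set of levels at which exactly one of the two transported indicators is 1; in this
  nonnegative form Tonelli applies.\<close>

lemma T_diff_le:
  assumes [measurable]: "u \<in> borel_measurable borel" "w \<in> borel_measurable borel"
  shows "ennreal \<bar>T \<tau> u x - T \<tau> w x\<bar> \<le> (\<integral>\<^sup>+v. indicator {-B..B} v *
     (if (v < u (x - \<tau> *\<^sub>R a v)) = (v < w (x - \<tau> *\<^sub>R a v)) then 0 else 1) \<partial>lborel)"
proof -
  let ?g = "\<lambda>u v. indicator {-B..B} v * (if v < u (x - \<tau> *\<^sub>R a v) then 1 else 0 :: real)"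
  have i: "integrable lborel (?g u)" "integrable lborel (?g w)"
    by (rule integrable_slab[where C=1]; auto)+
  have eq: "T \<tau> u x - T \<tau> w x = (\<integral>v. ?g u v - ?g w v \<partial>lborel)"
    using i by (simp add: tc_def)
  have "ennreal \<bar>T \<tau> u x - T \<tau> w x\<bar> \<le> (\<integral>\<^sup>+v. ennreal (norm (?g u v - ?g w v)) \<partial>lborel)"
    unfolding eq using integral_norm_bound_ennreal[OF Bochner_Integration.integrable_diff[OF i]] by simp
  also have "\<dots> = (\<integral>\<^sup>+v. indicator {-B..B} v *
     (if (v < u (x - \<tau> *\<^sub>R a v)) = (v < w (x - \<tau> *\<^sub>R a v)) then 0 else 1) \<partial>lborel)"
    by (intro nn_integral_cong) (auto split: split_indicator)
  finally show ?thesis .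
qed

lemma nn_integral_slab_diff_le:
  "(\<integral>\<^sup>+v. indicator {-B..B} v * (if (v < s) = (v < r) then 0 else 1) \<partial>lborel) \<le> ennreal \<bar>s - r\<bar>"
proof -
  have "(\<integral>\<^sup>+v. indicator {-B..B} v * (if (v < s) = (v < r) then 0 else 1) \<partial>lborel)
      \<le> (\<integral>\<^sup>+v. indicator {min s r..<max s r} v \<partial>lborel)"
    by (intro nn_integral_mono) (auto split: split_indicator)
  also have "\<dots> = ennreal \<bar>s - r\<bar>"
    by (simp add: max_def min_def)
  finally show ?thesis .
qed

text \<open>Each velocity only translates, so the contraction survives a weight up to the distance travelled.\<close>

lemma T_weighted_contraction:
  assumes [measurable]: "u \<in> borel_measurable borel" "w \<in> borel_measurable borel"
    and [measurable]: "\<psi> \<in> borel_measurable borel" "\<psi>' \<in> borel_measurable borel"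
    and le: "\<And>x v. \<bar>v\<bar> \<le> B \<Longrightarrow> \<psi> (x + \<tau> *\<^sub>R a v) \<le> (\<psi>' x :: ennreal)"
  shows "(\<integral>\<^sup>+x. \<psi> x * ennreal \<bar>T \<tau> u x - T \<tau> w x\<bar> \<partial>lborel) \<le> (\<integral>\<^sup>+x. \<psi>' x * ennreal \<bar>u x - w x\<bar> \<partial>lborel)"
proof -
  define h where "h s r v = indicator {-B..B} v * (if (v < s) = (v < r) then 0 else 1 :: ennreal)" for s r v :: real
  have [measurable]: "(\<lambda>x. h (s x) (r x) (v x)) \<in> borel_measurable M"
    if [measurable]: "s \<in> borel_measurable M" "r \<in> borel_measurable M" "v \<in> borel_measurable M" for M s r v
    unfolding h_def by measurable
  have "(\<integral>\<^sup>+x. \<psi> x * ennreal \<bar>T \<tau> u x - T \<tau> w x\<bar> \<partial>lborel)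
      \<le> (\<integral>\<^sup>+x. \<psi> x * (\<integral>\<^sup>+v. h (u (x - \<tau> *\<^sub>R a v)) (w (x - \<tau> *\<^sub>R a v)) v \<partial>lborel) \<partial>lborel)"
    unfolding h_def by (intro nn_integral_mono mult_left_mono T_diff_le) auto
  also have "\<dots> = (\<integral>\<^sup>+x. \<integral>\<^sup>+v. \<psi> x * h (u (x - \<tau> *\<^sub>R a v)) (w (x - \<tau> *\<^sub>R a v)) v \<partial>lborel \<partial>lborel)"
    by (intro nn_integral_cong nn_integral_cmult[symmetric]) measurable
  also have "\<dots> = (\<integral>\<^sup>+v. \<integral>\<^sup>+x. \<psi> x * h (u (x - \<tau> *\<^sub>R a v)) (w (x - \<tau> *\<^sub>R a v)) v \<partial>lborel \<partial>lborel)"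
    by (rule lborel_pair.Fubini') measurable
  \<comment> \<open>For fixed \<open>v\<close> the displacement \<open>\<tau> *\<^sub>R a v\<close>
    is a constant, so a translation in \<open>x\<close> removes it from \<open>u\<close> and
    \<open>w\<close> and puts it on the weight.\<close>
  also have "\<dots> = (\<integral>\<^sup>+v. \<integral>\<^sup>+x. \<psi> (x + \<tau> *\<^sub>R a v) * h (u x) (w x) v \<partial>lborel \<partial>lborel)"
  proof (rule nn_integral_cong)
    fix v
    show "(\<integral>\<^sup>+x. \<psi> x * h (u (x - \<tau> *\<^sub>R a v)) (w (x - \<tau> *\<^sub>R a v)) v \<partial>lborel) =
       (\<integral>\<^sup>+x. \<psi> (x + \<tau> *\<^sub>R a v) * h (u x) (w x) v \<partial>lborel)"
      by (subst nn_integral_lborel_shift[where c="\<tau> *\<^sub>R a v", symmetric]) auto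
  qed
  also have "\<dots> \<le> (\<integral>\<^sup>+v. \<integral>\<^sup>+x. \<psi>' x * h (u x) (w x) v \<partial>lborel \<partial>lborel)"
  proof (intro nn_integral_mono)
    fix v x
    show "\<psi> (x + \<tau> *\<^sub>R a v) * h (u x) (w x) v \<le> \<psi>' x * h (u x) (w x) v"
      by (cases "v \<in> {-B..B}") (auto intro!: mult_right_mono le simp: h_def)
  qed
  also have "\<dots> = (\<integral>\<^sup>+x. \<integral>\<^sup>+v. \<psi>' x * h (u x) (w x) v \<partial>lborel \<partial>lborel)"
    by (rule lborel_pair.Fubini') measurable
  also have "\<dots> = (\<integral>\<^sup>+x. \<psi>' x * (\<integral>\<^sup>+v. h (u x) (w x) v \<partial>lborel) \<partial>lborel)"
    by (intro nn_integral_cong nn_integral_cmult) measurable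
  also have "\<dots> \<le> (\<integral>\<^sup>+x. \<psi>' x * ennreal \<bar>u x - w x\<bar> \<partial>lborel)"
    unfolding h_def by (intro nn_integral_mono mult_left_mono nn_integral_slab_diff_le) auto
  finally show ?thesis .
qed

lemma T_contraction:
  assumes "u \<in> borel_measurable borel" "w \<in> borel_measurable borel"
  shows "L1d (T \<tau> u) (T \<tau> w) \<le> L1d u w"
  using T_weighted_contraction[OF assms, of "\<lambda>_. 1" "\<lambda>_. 1"] by (simp add: L1d_def)

lemma T_zero: "T \<tau> (\<lambda>_. 0) = (\<lambda>_. 0)"
  using integral_slab_less[of 0] B_nonneg by (simp add: tc_def fun_eq_iff)

lemma T_shift: "T \<tau> (\<lambda>x. u (x + y)) = (\<lambda>x. T \<tau> u (x + y))"
  by (simp add: tc_def fun_eq_iff algebra_simps)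

text \<open>A displacement of length at most \<open>\<tau> * S\<close> changes \<open>w\<close> by
  at most \<open>r = L * (\<tau> * S)\<close>. The indicators of
  \<open>v < w (x - \<tau> *\<^sub>R a v)\<close> and \<open>v < w x\<close> therefore differ only
  for \<open>v\<close> within \<open>r\<close> of \<open>w x\<close>, an interval of length
  \<open>2 * r\<close>, and beyond radius \<open>R + S\<close> they agree. This gives
  \<open>C = 2 * L * S * m\<close> with \<open>m\<close> the volume of that ball.\<close>

lemma T_lipschitz:
  assumes w: "\<And>x y. \<bar>w x - w y\<bar> \<le> L * dist x y" "0 \<le> L" "\<And>x. R < norm x \<Longrightarrow> w x = 0"
    and wB: "\<And>x. \<bar>w x\<bar> \<le> B"
  obtains C where "C \<ge> 0" "\<And>\<tau>. 0 \<le> \<tau> \<Longrightarrow> \<tau> \<le> 1 \<Longrightarrow> L1d (T \<tau> w) w \<le> ennreal (\<tau> * C)"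
proof -
  have [measurable]: "w \<in> borel_measurable borel" using lipschitz_borel[of L w] w by auto
  define m where "m = measure lborel (cball (0::'a) (R + S))"
  have "emeasure lborel (cball (0::'a) (R + S)) < \<infinity>"
    by (rule emeasure_bounded_finite) (rule bounded_cball)
  then have m: "emeasure lborel (cball (0::'a) (R + S)) = ennreal m"
    unfolding m_def by (metis emeasure_eq_ennreal_measure infinity_ennreal_def less_irrefl)
  have m0: "0 \<le> m" by (simp add: m_def)
  have "L1d (T \<tau> w) w \<le> ennreal (\<tau> * (2 * L * S * m))" if \<tau>: "0 \<le> \<tau>" "\<tau> \<le> 1" for \<tau>
  proof -
    define r where "r = L * (\<tau> * S)"
    have r0: "0 \<le> r" using w S_nonneg \<tau> by (simp add: r_def)
    have step: "norm (\<tau> *\<^sub>R a v) \<le> \<tau> * S" if "\<bar>v\<bar> \<le> B" for v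
      using a_bound[OF that] \<tau> by (simp add: mult_left_mono)
    have tS: "\<tau> * S \<le> S" using \<tau> S_nonneg by (simp add: mult_left_le_one_le)
    have pt: "ennreal \<bar>T \<tau> w x - w x\<bar> \<le> ennreal (2 * r) * indicator (cball 0 (R + S)) x" for x
    proof -
      let ?g = "\<lambda>v. indicator {-B..B} v * (if v < w (x - \<tau> *\<^sub>R a v) then 1 else 0 :: real)"
      let ?k = "\<lambda>v. indicator {-B..B} v * (if v < w x then 1 else 0 :: real)"
      have i: "integrable lborel ?g" "integrable lborel ?k"
        by (rule integrable_slab[where C=1]; auto)+
      have eq: "T \<tau> w x - w x = (\<integral>v. ?g v - ?k v \<partial>lborel)"
        using i integral_slab_less[OF wB, of x] by (simp add: tc_def)
      have close: "\<bar>w (x - \<tau> *\<^sub>R a v) - w x\<bar> \<le> r" if "\<bar>v\<bar> \<le> B" for v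
      proof -
        have "\<bar>w (x - \<tau> *\<^sub>R a v) - w x\<bar> \<le> L * dist (x - \<tau> *\<^sub>R a v) x" by (rule w)
        also have "\<dots> \<le> r" unfolding r_def using step[OF that] w(2) by (intro mult_left_mono) (auto simp: dist_norm)
        finally show ?thesis .
      qed
      show ?thesis
      proof (cases "norm x \<le> R + S")
        case True
        have "ennreal \<bar>T \<tau> w x - w x\<bar> \<le> (\<integral>\<^sup>+v. ennreal (norm (?g v - ?k v)) \<partial>lborel)"
          unfolding eq using integral_norm_bound_ennreal[OF Bochner_Integration.integrable_diff[OF i]] by simp
        also have "\<dots> \<le> (\<integral>\<^sup>+v. indicator {w x - r..w x + r} v \<partial>lborel)"
        proof (intro nn_integral_mono)
          fix v
          have "?g v - ?k v = 0" if "v \<notin> {w x - r..w x + r}"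
          proof (cases "v \<in> {-B..B}")
            case True
            then have "\<bar>v\<bar> \<le> B" by auto
            then show ?thesis using close[of v] that r0 by auto
          qed auto
          moreover have "norm (?g v - ?k v) \<le> 1" by (auto split: split_indicator)
          ultimately show "ennreal (norm (?g v - ?k v)) \<le> indicator {w x - r..w x + r} v"
            by (cases "v \<in> {w x - r..w x + r}") (simp_all add: ennreal_leI flip: ennreal_1)
        qed
        also have "\<dots> = ennreal (2 * r)" using r0 by (simp add: emeasure_lborel_Icc_eq)
        finally show ?thesis using True by simp
      next
        case False
        have "w (x - \<tau> *\<^sub>R a v) = w x" if "\<bar>v\<bar> \<le> B" for v
        proof -
          have "norm x \<le> norm (x - \<tau> *\<^sub>R a v) + norm (\<tau> *\<^sub>R a v)" using norm_triangle_sub[of x "\<tau> *\<^sub>R a v"] by simp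
          then have "R < norm (x - \<tau> *\<^sub>R a v)" using step[OF that] False tS by simp
          moreover have "R < norm x" using False S_nonneg by simp
          ultimately show ?thesis using w(3) by simp
        qed
        then have "?g v - ?k v = 0" for v
          by (cases "v \<in> {-B..B}") auto
        then have "(\<lambda>v. ?g v - ?k v) = (\<lambda>_. 0)" by (rule ext)
        then show ?thesis unfolding eq by simp
      qed
    qed
    have "L1d (T \<tau> w) w \<le> (\<integral>\<^sup>+x. ennreal (2 * r) * indicator (cball (0::'a) (R + S)) x \<partial>lborel)"
      unfolding L1d_def by (intro nn_integral_mono pt)
    also have "\<dots> = ennreal (2 * r * m)"
      using r0 m0 by (subst nn_integral_cmult_indicator) (auto simp: m ennreal_mult)
    finally show ?thesis by (simp add: r_def mult_ac)
  qed
  moreover have "0 \<le> 2 * L * S * m" using w S_nonneg m0 by simp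
  ultimately show ?thesis using that by blast
qed

definition iter :: "real \<Rightarrow> nat \<Rightarrow> ('a \<Rightarrow> real) \<Rightarrow> 'a \<Rightarrow> real" where
  "iter \<tau> n u = (T \<tau> ^^ n) u"

lemma iter_simps [simp]: "iter \<tau> 0 u = u" "iter \<tau> (Suc n) u = T \<tau> (iter \<tau> n u)"
  by (simp_all add: iter_def)

lemma iter_add: "iter \<tau> (m + n) u = iter \<tau> m (iter \<tau> n u)"
  by (simp add: iter_def funpow_add)

lemma iter_borel [measurable]:
  "u \<in> borel_measurable borel \<Longrightarrow> iter \<tau> n u \<in> borel_measurable borel"
  by (induction n) auto

lemma iter_range:
  "u \<in> borel_measurable borel \<Longrightarrow> (\<And>x. \<bar>u x\<bar> \<le> B) \<Longrightarrow> \<bar>iter \<tau> n u x\<bar> \<le> B"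
  by (cases n) (auto intro: T_range)

lemma iter_contraction:
  assumes [measurable]: "u \<in> borel_measurable borel" "w \<in> borel_measurable borel"
  shows "L1d (iter \<tau> n u) (iter \<tau> n w) \<le> L1d u w"
  by (induction n) (auto intro: order_trans[OF T_contraction])

lemma iter_zero: "iter \<tau> n (\<lambda>_. 0) = (\<lambda>_. 0)"
  by (induction n) (auto simp: T_zero)

lemma iter_shift: "iter \<tau> n (\<lambda>x. u (x + y)) = (\<lambda>x. iter \<tau> n u (x + y))"
  by (induction n) (auto simp: T_shift)

text \<open>Finite speed of propagation: one step carries mass at most \<open>\<tau> * S\<close>
  outwards. Technically this is the weighted contraction against the fixed point 0, with the
  indicators of two exteriors as weights.\<close>

lemma iter_tail:
  assumes [measurable]: "u \<in> borel_measurable borel" and "0 \<le> \<tau>"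
  shows "(\<integral>\<^sup>+x. indicator {x. R + real n * \<tau> * S < norm x} x * ennreal \<bar>iter \<tau> n u x\<bar> \<partial>lborel)
     \<le> (\<integral>\<^sup>+x. indicator {x. R < norm x} x * ennreal \<bar>u x\<bar> \<partial>lborel)"
proof (induction n)
  case (Suc n)
  have "(\<integral>\<^sup>+x. indicator {x. R + real (Suc n) * \<tau> * S < norm x} x * ennreal \<bar>T \<tau> (iter \<tau> n u) x - T \<tau> (\<lambda>_. 0) x\<bar> \<partial>lborel)
     \<le> (\<integral>\<^sup>+x. indicator {x. R + real n * \<tau> * S < norm x} x * ennreal \<bar>iter \<tau> n u x - 0\<bar> \<partial>lborel)"
  proof (rule T_weighted_contraction)
    fix x v assume v: "\<bar>v\<bar> \<le> B"
    have "norm (\<tau> *\<^sub>R a v) \<le> \<tau> * S" using a_bound[OF v] assms(2) by (simp add: mult_left_mono)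
    then have "norm (x + \<tau> *\<^sub>R a v) \<le> norm x + \<tau> * S" using norm_triangle_ineq[of x "\<tau> *\<^sub>R a v"] by simp
    then show "indicator {x. R + real (Suc n) * \<tau> * S < norm x} (x + \<tau> *\<^sub>R a v)
       \<le> (indicator {x. R + real n * \<tau> * S < norm x} x :: ennreal)"
      by (auto split: split_indicator simp: algebra_simps)
  qed auto
  then show ?case using Suc by (simp add: T_zero)
qed simp

text \<open>For a Lipschitz datum each step costs at most \<open>\<tau> * C\<close>, and by
  contraction these costs simply add up. Passing from \<open>u\<close> to the Lipschitz datum and
  back costs \<open>e/2\<close> each, independently of the number of steps.\<close>

lemma iter_dist_initial:
  assumes u: "integrable lborel u" and uB: "\<And>x. \<bar>u x\<bar> \<le> B" and e: "e > 0"
  obtains C where "C \<ge> 0" "\<And>\<tau> n. 0 \<le> \<tau> \<Longrightarrow> \<tau> \<le> 1 \<Longrightarrow> L1d (iter \<tau> n u) u \<le> ennreal (e + real n * \<tau> * C)"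
proof -
  have [measurable]: "u \<in> borel_measurable borel" using u by auto
  obtain g L R where g: "0 \<le> L" "0 \<le> R" "\<And>x y. \<bar>g x - g y\<bar> \<le> L * dist x y"
    "\<And>x. R < norm x \<Longrightarrow> g x = 0" "L1d u g < ennreal (e/2)" and [measurable]: "g \<in> borel_measurable borel"
    by (rule lip_approxE[OF lip_approx_integrable[OF u], of "e/2"]) (use e in auto)
  \<comment> \<open>The one-step estimate needs values in \<open>[-B, B]\<close>. Clipping preserves
    the Lipschitz bound and, as \<open>u\<close> already has this range, does not increase the
    distance to \<open>u\<close>.\<close>
  define w where "w x = max (-B) (min B (g x))" for x
  have [measurable]: "w \<in> borel_measurable borel" unfolding w_def[abs_def] by measurable
  have w1: "\<bar>w x - w y\<bar> \<le> L * dist x y" for x y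
    using g(3)[of x y] unfolding w_def by (simp add: max_def min_def abs_if split: if_splits)
  have w2: "w x = 0" if "R < norm x" for x using g(4)[OF that] B_nonneg by (simp add: w_def)
  have w3: "\<bar>w x\<bar> \<le> B" for x using B_nonneg by (auto simp: w_def)
  have "L1d u w \<le> L1d u g"
    unfolding L1d_def
  proof (intro nn_integral_mono ennreal_leI)
    fix x show "\<bar>u x - w x\<bar> \<le> \<bar>u x - g x\<bar>"
      using uB[of x] unfolding w_def by (simp add: max_def min_def abs_if split: if_splits)
  qed
  then have uw: "L1d u w \<le> ennreal (e/2)" using g(5) by simp
  obtain C where C: "C \<ge> 0" "\<And>\<tau>. 0 \<le> \<tau> \<Longrightarrow> \<tau> \<le> 1 \<Longrightarrow> L1d (T \<tau> w) w \<le> ennreal (\<tau> * C)"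
    using T_lipschitz[OF w1 g(1) w2 w3] by blast
  have it: "L1d (iter \<tau> n w) w \<le> ennreal (real n * \<tau> * C)" if \<tau>: "0 \<le> \<tau>" "\<tau> \<le> 1" for \<tau> n
  proof (induction n)
    case (Suc n)
    have "L1d (T \<tau> (iter \<tau> n w)) w \<le> L1d (T \<tau> (iter \<tau> n w)) (T \<tau> w) + L1d (T \<tau> w) w"
      by (rule L1d_triangle) auto
    also have "\<dots> \<le> ennreal (real n * \<tau> * C) + ennreal (\<tau> * C)"
      using T_contraction[of "iter \<tau> n w" w \<tau>] Suc C(2)[OF \<tau>] by (intro add_mono) (auto intro: order_trans)
    also have "\<dots> = ennreal (real (Suc n) * \<tau> * C)"
      using \<tau> C(1) by (subst ennreal_plus[symmetric]) (auto simp: algebra_simps)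
    finally show ?case by simp
  qed (simp add: L1d_def)
  have "L1d (iter \<tau> n u) u \<le> ennreal (e + real n * \<tau> * C)" if \<tau>: "0 \<le> \<tau>" "\<tau> \<le> 1" for \<tau> n
  proof -
    have "L1d (iter \<tau> n u) u \<le> L1d (iter \<tau> n u) (iter \<tau> n w) + L1d (iter \<tau> n w) u"
      by (rule L1d_triangle) auto
    also have "L1d (iter \<tau> n w) u \<le> L1d (iter \<tau> n w) w + L1d w u"
      by (rule L1d_triangle) auto
    finally have "L1d (iter \<tau> n u) u \<le> L1d (iter \<tau> n u) (iter \<tau> n w) + (L1d (iter \<tau> n w) w + L1d w u)"
      by (simp add: add_left_mono)
    also have "\<dots> \<le> ennreal (e/2) + (ennreal (real n * \<tau> * C) + ennreal (e/2))"
      using uw it[OF \<tau>, of n] iter_contraction[of u w \<tau> n]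
      by (intro add_mono) (auto intro: order_trans simp: L1d_commute[of w u])
    also have "\<dots> = ennreal (e + real n * \<tau> * C)"
      using e \<tau> C(1) by (simp flip: ennreal_plus add: algebra_simps)
    finally show ?thesis .
  qed
  with C(1) show ?thesis using that by blast
qed

end

section \<open>Compactness\<close>

lemma diagonal_convergent:
  fixes c :: "nat \<Rightarrow> nat \<Rightarrow> real"
  assumes bnd: "\<And>n i. \<bar>c n i\<bar> \<le> B"
  obtains r :: "nat \<Rightarrow> nat" where "strict_mono r" "\<And>i. convergent (\<lambda>n. c (r n) i)"
proof -
  interpret subseqs "\<lambda>i s. convergent (\<lambda>n. c (s n) i)"
  proof
    fix i and s :: "nat \<Rightarrow> nat"
    have "\<forall>n. c (s n) i \<in> {-B..B}" using bnd by (simp add: abs_le_iff minus_le_iff)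
    then obtain l r where "strict_mono (r :: nat \<Rightarrow> nat)" "((\<lambda>n. c (s n) i) \<circ> r) \<longlonglongrightarrow> l"
      using compact_Icc[of "-B" B, unfolded compact_def, rule_format, of "\<lambda>n. c (s n) i"] by blast
    then show "\<exists>r'. strict_mono r' \<and> convergent (\<lambda>n. c ((s \<circ> r') n) i)"
      by (auto simp: convergent_def o_def)
  qed
  have "convergent (\<lambda>n. c (diagseq n) i)" for i
  proof -
    \<comment> \<open>From index \<open>Suc i\<close> on the diagonal is a subsequence of the one
      chosen for coordinate \<open>i\<close>; the finitely many earlier terms do not affect
      convergence.\<close>
    have "convergent (\<lambda>n. c ((diagseq \<circ> (+) (Suc i)) n) i)"
    proof (rule diagseq_holds)
      fix r s :: "nat \<Rightarrow> nat" and n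
      assume "strict_mono r" "convergent (\<lambda>m. c (s m) n)"
      then show "convergent (\<lambda>m. c ((s \<circ> r) m) n)"
        using convergent_subseq_convergent[of "\<lambda>m. c (s m) n" r] by (simp add: o_def)
    qed
    then have "convergent (\<lambda>n. c (diagseq (n + Suc i)) i)" by (simp add: add.commute)
    then show ?thesis by (subst (asm) convergent_ignore_initial_segment[of "\<lambda>n. c (diagseq n) i"])
  qed
  then show ?thesis using that[OF subseq_diagseq] by blast
qed

lemma avg_bound:
  fixes k u :: "'a::euclidean_space \<Rightarrow> real"
  assumes k: "integrable lborel k" "integral\<^sup>L lborel k = 1" "\<And>y. 0 \<le> k y"
    and [measurable]: "u \<in> borel_measurable borel" and u: "\<And>x. \<bar>u x\<bar> \<le> B"
  shows "\<bar>avg k u x\<bar> \<le> B"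
proof -
  have [measurable]: "k \<in> borel_measurable borel" using k by auto
  have b: "\<bar>k y * u (x + y)\<bar> \<le> B * k y" for y
    using mult_left_mono[OF u[of "x + y"] k(3)[of y]] k(3)[of y] by (simp add: abs_mult mult.commute)
  have "integrable lborel (\<lambda>y. k y * u (x + y))"
    by (rule Bochner_Integration.integrable_bound[where f="\<lambda>y. B * k y"])
       (use k b in \<open>auto intro: order_trans[OF _ abs_ge_self]\<close>)
  then have "\<bar>avg k u x\<bar> \<le> (\<integral>y. B * k y \<partial>lborel)"
    unfolding avg_def using k b by (intro order_trans[OF integral_abs_bound integral_mono]) auto
  then show ?thesis using k by simp
qed

text \<open>A bounded kernel converts the L1 modulus of translation of \<open>u\<close> into a
  pointwise modulus of continuity of its average: equicontinuity for a family with a common L1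
  modulus.\<close>

lemma avg_diff:
  fixes k u :: "'a::euclidean_space \<Rightarrow> real"
  assumes [measurable]: "k \<in> borel_measurable borel" and k: "\<And>y. 0 \<le> k y" "\<And>y. k y \<le> C"
    and u: "integrable lborel u"
  shows "ennreal \<bar>avg k u x - avg k u x'\<bar> \<le> ennreal C * L1d (\<lambda>z. u (z + (x - x'))) u"
proof -
  have [measurable]: "u \<in> borel_measurable borel" using u by auto
  have i: "integrable lborel (\<lambda>y. k y * u (z + y))" for z
    using k by (intro integrable_bounded_mult[where C=C] integrable_lborel_shift u) auto
  have C: "0 \<le> C" using order_trans[OF k(1) k(2)] .
  have eq: "avg k u x - avg k u x' = (\<integral>y. k y * u (x + y) - k y * u (x' + y) \<partial>lborel)"
    unfolding avg_def using i by simp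
  have "ennreal \<bar>avg k u x - avg k u x'\<bar> \<le> (\<integral>\<^sup>+y. ennreal (norm (k y * u (x + y) - k y * u (x' + y))) \<partial>lborel)"
    unfolding eq using integral_norm_bound_ennreal[OF Bochner_Integration.integrable_diff[OF i i]] by simp
  also have "\<dots> \<le> (\<integral>\<^sup>+y. ennreal C * ennreal \<bar>u (y + x' + (x - x')) - u (y + x')\<bar> \<partial>lborel)"
  proof (intro nn_integral_mono)
    fix y
    have "norm (k y * u (x + y) - k y * u (x' + y)) = k y * \<bar>u (x + y) - u (x' + y)\<bar>"
      using k(1)[of y] by (simp add: abs_mult flip: right_diff_distrib)
    also have "\<dots> \<le> C * \<bar>u (x + y) - u (x' + y)\<bar>" using k by (intro mult_right_mono) auto
    finally show "ennreal (norm (k y * u (x + y) - k y * u (x' + y))) \<le> ennreal C * ennreal \<bar>u (y + x' + (x - x')) - u (y + x')\<bar>"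
      using C by (simp flip: ennreal_mult add: ennreal_leI add_ac)
  qed
  also have "\<dots> = ennreal C * L1d (\<lambda>z. u ((z + x') + (x - x'))) (\<lambda>z. u (z + x'))"
    unfolding L1d_def by (intro nn_integral_cmult) measurable
  also have "\<dots> = ennreal C * L1d (\<lambda>z. u (z + (x - x'))) u"
    by (subst L1d_shift[of "\<lambda>z. u (z + (x - x'))" u x']) auto
  finally show ?thesis .
qed

text \<open>Outside the ball only the two tails count; inside it the comparison goes through the
  auxiliary functions \<open>f'\<close> and \<open>g'\<close>, in the application the mollifications
  of \<open>f\<close> and \<open>g\<close>.\<close>

lemma L1d_split_ball:
  assumes [measurable]: "f \<in> borel_measurable borel" "g \<in> borel_measurable borel"
    "f' \<in> borel_measurable borel" "g' \<in> borel_measurable borel"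
  shows "L1d f g \<le> (\<integral>\<^sup>+x. indicator {x. R < norm x} x * ennreal \<bar>f x\<bar> \<partial>lborel)
     + (\<integral>\<^sup>+x. indicator {x. R < norm x} x * ennreal \<bar>g x\<bar> \<partial>lborel)
     + (L1d f' f + L1d (\<lambda>x. indicator (cball 0 R) x * f' x) (\<lambda>x. indicator (cball 0 R) x * g' x) + L1d g' g)"
proof -
  have add5: "(\<integral>\<^sup>+x. (h1 x + h2 x) + (h3 x + h4 x + h5 x) \<partial>lborel) = (\<integral>\<^sup>+x. h1 x \<partial>lborel) + (\<integral>\<^sup>+x. h2 x \<partial>lborel)
     + ((\<integral>\<^sup>+x. h3 x \<partial>lborel) + (\<integral>\<^sup>+x. h4 x \<partial>lborel) + (\<integral>\<^sup>+x. h5 x \<partial>lborel))"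
    if [measurable]: "h1 \<in> borel_measurable borel" "h2 \<in> borel_measurable borel" "h3 \<in> borel_measurable borel"
      "h4 \<in> borel_measurable borel" "h5 \<in> borel_measurable borel" for h1 h2 h3 h4 h5 :: "'a \<Rightarrow> ennreal"
    by (simp add: nn_integral_add)
  have "L1d f g \<le> (\<integral>\<^sup>+x. (indicator {x. R < norm x} x * ennreal \<bar>f x\<bar> + indicator {x. R < norm x} x * ennreal \<bar>g x\<bar>)
     + (ennreal \<bar>f' x - f x\<bar> + ennreal \<bar>indicator (cball 0 R) x * f' x - indicator (cball 0 R) x * g' x\<bar>
        + ennreal \<bar>g' x - g x\<bar>) \<partial>lborel)"
    unfolding L1d_def
  proof (intro nn_integral_mono)
    fix x
    show "ennreal \<bar>f x - g x\<bar> \<le> (indicator {x. R < norm x} x * ennreal \<bar>f x\<bar> + indicator {x. R < norm x} x * ennreal \<bar>g x\<bar>)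
     + (ennreal \<bar>f' x - f x\<bar> + ennreal \<bar>indicator (cball 0 R) x * f' x - indicator (cball 0 R) x * g' x\<bar>
        + ennreal \<bar>g' x - g x\<bar>)"
      by (cases "R < norm x") (auto simp flip: ennreal_plus intro!: ennreal_leI)
  qed
  also have "\<dots> = (\<integral>\<^sup>+x. indicator {x. R < norm x} x * ennreal \<bar>f x\<bar> \<partial>lborel)
     + (\<integral>\<^sup>+x. indicator {x. R < norm x} x * ennreal \<bar>g x\<bar> \<partial>lborel)
     + (L1d f' f + L1d (\<lambda>x. indicator (cball 0 R) x * f' x) (\<lambda>x. indicator (cball 0 R) x * g' x) + L1d g' g)"
    unfolding L1d_def
  proof (rule add5)
    have [measurable]: "{x::'a. R < norm x} \<in> sets borel" "cball (0::'a) R \<in> sets borel" by simp_all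
    show "(\<lambda>x. indicator {x. R < norm x} x * ennreal \<bar>f x\<bar>) \<in> borel_measurable borel"
      "(\<lambda>x. indicator {x. R < norm x} x * ennreal \<bar>g x\<bar>) \<in> borel_measurable borel" by simp_all
    show "(\<lambda>x. ennreal \<bar>f' x - f x\<bar>) \<in> borel_measurable borel" "(\<lambda>x. ennreal \<bar>g' x - g x\<bar>) \<in> borel_measurable borel"
      by simp_all
    show "(\<lambda>x. ennreal \<bar>indicator (cball 0 R) x * f' x - indicator (cball 0 R) x * g' x\<bar>) \<in> borel_measurable borel"
      by simp
  qed
  finally show ?thesis .
qed

text \<open>Kolmogorov-Riesz in space and Ascoli in time, with a uniform Cauchy property as
  conclusion. Mollified functions are uniformly bounded and equicontinuous in space, so a diagonal
  argument at countably many points and times suffices. The modulus in time is demanded only from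
  some index on, because functions that are constant on time steps jump at the grid.\<close>

lemma L1_compactness:
  fixes V :: "nat \<Rightarrow> real \<Rightarrow> 'a::euclidean_space \<Rightarrow> real"
  assumes int: "\<And>n t. integrable lborel (V n t)"
    and bnd: "\<And>n t x. \<bar>V n t x\<bar> \<le> B"
    and T: "0 < T"
    and trans: "\<And>e. e > 0 \<Longrightarrow> \<exists>d>0. \<forall>n t y. norm y < d \<longrightarrow> L1d (\<lambda>x. V n t (x + y)) (V n t) \<le> ennreal e"
    and tail: "\<And>e. e > 0 \<Longrightarrow> \<exists>R. \<forall>n. \<forall>t\<in>{0..T}. (\<integral>\<^sup>+x. indicator {x. R < norm x} x * ennreal \<bar>V n t x\<bar> \<partial>lborel) \<le> ennreal e"
    and time: "\<And>e. e > 0 \<Longrightarrow> \<exists>d>0. \<exists>N. \<forall>n\<ge>N. \<forall>s\<in>{0..T}. \<forall>t\<in>{0..T}. \<bar>s - t\<bar> < d \<longrightarrow> L1d (V n s) (V n t) \<le> ennreal e"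
  obtains r :: "nat \<Rightarrow> nat" where "strict_mono r"
    "\<And>e. e > 0 \<Longrightarrow> \<exists>N. \<forall>m\<ge>N. \<forall>n\<ge>N. \<forall>t\<in>{0..T}. L1d (V (r m) t) (V (r n) t) \<le> ennreal e"
proof -
  have meas [measurable]: "V n t \<in> borel_measurable borel" for n t
    using int[of n t] by auto
  have "\<forall>j. \<exists>(k :: 'a \<Rightarrow> real) C. k \<in> borel_measurable borel \<and> (\<forall>y. 0 \<le> k y) \<and> (\<forall>y. k y \<le> C) \<and> (\<integral>\<^sup>+y. ennreal (k y) \<partial>lborel) = 1 \<and>
      (\<forall>y. inverse (real (Suc j)) \<le> norm y \<longrightarrow> k y = 0)"
  proof
    fix j
    show "\<exists>(k :: 'a \<Rightarrow> real) C. k \<in> borel_measurable borel \<and> (\<forall>y. 0 \<le> k y) \<and> (\<forall>y. k y \<le> C) \<and> (\<integral>\<^sup>+y. ennreal (k y) \<partial>lborel) = 1 \<and>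
      (\<forall>y. inverse (real (Suc j)) \<le> norm y \<longrightarrow> k y = 0)"
      by (rule ex_C1_kernel[of "inverse (real (Suc j))", where ?'a='a]) (simp, blast)
  qed
  then obtain k :: "nat \<Rightarrow> 'a \<Rightarrow> real" and C where
    kb [measurable]: "\<And>j. k j \<in> borel_measurable borel" and k: "\<And>j y. 0 \<le> k j y" "\<And>j y. k j y \<le> C j"
      "\<And>j. (\<integral>\<^sup>+y. ennreal (k j y) \<partial>lborel) = 1" "\<And>j y. inverse (real (Suc j)) \<le> norm y \<Longrightarrow> k j y = 0"
    by metis
  have ki: "integrable lborel (k j)" "integral\<^sup>L lborel (k j) = 1" for j
  proof -
    show "integrable lborel (k j)" using k by (intro integrableI_nonneg) auto
    then show "integral\<^sup>L lborel (k j) = 1" using k by (subst integral_eq_nn_integral) auto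
  qed
  obtain D :: "'a set" where D: "countable D" "\<And>X. open X \<Longrightarrow> X \<noteq> {} \<Longrightarrow> \<exists>d\<in>D. d \<in> X"
    by (rule countable_dense_setE) blast
  have Dne: "D \<noteq> {}" using D(2)[of UNIV] by auto
  \<comment> \<open>Every rational multiple of \<open>T\<close> is enumerated, also those outside
    \<open>[0, T]\<close>: the bound on the averages holds at all times, and membership in the
    interval is required only where tails are estimated.\<close>
  define time where "time = (\<lambda>a. T * real_of_rat (from_nat a))"
  \<comment> \<open>Kernel, time and point are packed into one natural number, so that a single
    diagonal extraction handles all three.\<close>
  define c where "c n i = (case prod_decode i of (j, i') \<Rightarrow> case prod_decode i' of (a, b) \<Rightarrow>
      avg (k j) (V n (time a)) (from_nat_into D b))" for n i
  have "\<bar>c n i\<bar> \<le> B" for n i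
    unfolding c_def by (auto split: prod.splits intro!: avg_bound ki k bnd)
  then obtain r :: "nat \<Rightarrow> nat" where r: "strict_mono r" "\<And>i. convergent (\<lambda>n. c (r n) i)"
    using diagonal_convergent[of c B] by blast
  have cD: "convergent (\<lambda>n. avg (k j) (V (r n) (time a)) x)" if "x \<in> D" for j a x
  proof -
    obtain b where b: "from_nat_into D b = x" using from_nat_into_surj[OF D(1) \<open>x \<in> D\<close>] by blast
    show ?thesis using r(2)[of "prod_encode (j, prod_encode (a, b))"] by (simp add: c_def b)
  qed
  \<comment> \<open>A point off \<open>D\<close> has a neighbour in \<open>D\<close> at which the
    averages differ by at most \<open>e/4\<close>, uniformly in \<open>n\<close>; hence the Cauchy
    property spreads from \<open>D\<close> to the whole space.\<close>
  have conv: "convergent (\<lambda>n. avg (k j) (V (r n) (time a)) x)" for j a x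
  proof (rule Cauchy_convergent, rule metric_CauchyI)
    fix e :: real assume e: "0 < e"
    have C: "0 \<le> C j" using order_trans[OF k(1) k(2)] .
    obtain d where d: "d > 0" "\<And>n t y. norm y < d \<Longrightarrow> L1d (\<lambda>x. V n t (x + y)) (V n t) \<le> ennreal (e / (4 * (C j + 1)))"
      using trans[of "e / (4 * (C j + 1))"] e C by auto
    obtain x' where x': "x' \<in> D" "dist x x' < d"
      using D(2)[of "ball x d"] d(1) by auto
    have near: "\<bar>avg (k j) (V n t) x - avg (k j) (V n t) x'\<bar> \<le> e / 4" for n t
    proof -
      have "ennreal \<bar>avg (k j) (V n t) x - avg (k j) (V n t) x'\<bar> \<le> ennreal (C j) * L1d (\<lambda>z. V n t (z + (x - x'))) (V n t)"
        using k int by (intro avg_diff) auto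
      also have "\<dots> \<le> ennreal (C j) * ennreal (e / (4 * (C j + 1)))"
        using d(2)[of "x - x'"] x' by (intro mult_left_mono) (auto simp: dist_norm)
      also have "\<dots> \<le> ennreal (e / 4)"
        using C e by (simp flip: ennreal_mult add: field_simps ennreal_leI)
      finally show ?thesis using e by simp
    qed
    have "Cauchy (\<lambda>n. avg (k j) (V (r n) (time a)) x')"
      using cD[OF x'(1)] by (rule convergent_Cauchy)
    then obtain N where N: "\<And>m n. m \<ge> N \<Longrightarrow> n \<ge> N \<Longrightarrow>
       dist (avg (k j) (V (r m) (time a)) x') (avg (k j) (V (r n) (time a)) x') < e / 4"
      using metric_CauchyD[of _ "e/4"] e by (metis divide_pos_pos zero_less_numeral)
    show "\<exists>N. \<forall>m\<ge>N. \<forall>n\<ge>N. dist (avg (k j) (V (r m) (time a)) x) (avg (k j) (V (r n) (time a)) x) < e"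
    proof (intro exI[of _ N] allI impI)
      fix m n assume "N \<le> m" "N \<le> n"
      from N[OF this] near[of "r m" "time a"] near[of "r n" "time a"] e
      show "dist (avg (k j) (V (r m) (time a)) x) (avg (k j) (V (r n) (time a)) x) < e"
        unfolding dist_real_def by linarith
    qed
  qed
  \<comment> \<open>The budget is five terms of size \<open>e/6\<close>: two tails, two
    mollification errors and the distance of the mollified functions inside the ball. Only the last
    needs large indices; the others are uniform.\<close>
  have timeC: "\<exists>N. \<forall>m\<ge>N. \<forall>n\<ge>N. L1d (V (r m) (time a)) (V (r n) (time a)) \<le> ennreal e"
    if e: "e > 0" and ta: "time a \<in> {0..T}" for e a
  proof -
    have e6: "e / 6 > 0" using e by simp
    obtain d where d: "d > 0" "\<And>n t y. norm y < d \<Longrightarrow> L1d (\<lambda>x. V n t (x + y)) (V n t) \<le> ennreal (e/6)"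
      using trans[OF e6] by auto
    obtain j where j: "inverse (real (Suc j)) < d" using reals_Archimedean[OF d(1)] by blast
    have [measurable]: "cball (0::'a) R \<in> sets borel" for R by simp
    obtain R where R: "\<And>n t. t \<in> {0..T} \<Longrightarrow> (\<integral>\<^sup>+x. indicator {x. R < norm x} x * ennreal \<bar>V n t x\<bar> \<partial>lborel) \<le> ennreal (e/6)"
      using tail[OF e6] by blast
    define Mn where "Mn n = avg (k j) (V (r n) (time a))" for n
    have [measurable]: "Mn n \<in> borel_measurable borel" for n unfolding Mn_def by measurable
    have close: "L1d (Mn n) (V (r n) (time a)) \<le> ennreal (e/6)" for n
      unfolding Mn_def by (rule L1d_avg[of _ "C j" "inverse (real (Suc j))"]) (use k int d j in auto)
    define l where "l x = lim (\<lambda>n. Mn n x)" for x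
    have lim: "(\<lambda>n. Mn n x) \<longlonglongrightarrow> l x" for x
      using conv[of j a x] by (simp add: l_def Mn_def convergent_LIMSEQ_iff)
    have [measurable]: "l \<in> borel_measurable borel"
      by (rule borel_measurable_LIMSEQ_real[of _ Mn]) (use lim in auto)
    have Mb: "\<bar>Mn n x\<bar> \<le> B" for n x unfolding Mn_def by (intro avg_bound ki k bnd) auto
    \<comment> \<open>On a ball the common bound \<open>B\<close> is integrable, so pointwise
      convergence of the averages becomes L1 convergence there.\<close>
    have "(\<lambda>n. L1d (\<lambda>x. indicator (cball 0 R) x * l x) (\<lambda>x. indicator (cball 0 R) x * Mn n x)) \<longlonglongrightarrow> 0"
    proof (rule L1d_dominated[where w="\<lambda>x. indicator (cball 0 R) x * B"])
      have "emeasure lborel (cball (0::'a) R) < \<infinity>"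
        by (rule emeasure_bounded_finite) (rule bounded_cball)
      then show "integrable lborel (\<lambda>x. indicator (cball (0::'a) R) x * B)"
        by (intro integrable_mult_left integrable_real_indicator) auto
      show "\<bar>indicator (cball 0 R) x * Mn i x\<bar> \<le> indicator (cball 0 R) x * B" for i x
        using Mb[of i x] by (auto split: split_indicator)
    qed (auto intro!: tendsto_intros lim)
    from order_tendstoD(2)[OF this, of "ennreal (e/12)"] e
    obtain N where N: "\<And>n. n \<ge> N \<Longrightarrow> L1d (\<lambda>x. indicator (cball 0 R) x * l x) (\<lambda>x. indicator (cball 0 R) x * Mn n x) < ennreal (e/12)"
      by (auto simp: eventually_sequentially)
    show ?thesis
    proof (intro exI[of _ N] allI impI)
      fix m n assume mn: "m \<ge> N" "n \<ge> N"
      have "L1d (\<lambda>x. indicator (cball 0 R) x * Mn m x) (\<lambda>x. indicator (cball 0 R) x * Mn n x)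
        \<le> L1d (\<lambda>x. indicator (cball 0 R) x * Mn m x) (\<lambda>x. indicator (cball 0 R) x * l x)
         + L1d (\<lambda>x. indicator (cball 0 R) x * l x) (\<lambda>x. indicator (cball 0 R) x * Mn n x)"
        by (rule L1d_triangle) auto
      also have "\<dots> \<le> ennreal (e/12) + ennreal (e/12)"
        using N[OF mn(1)] N[OF mn(2)] by (intro add_mono) (auto simp: L1d_commute)
      also have "\<dots> = ennreal (e/6)" using e by (simp flip: ennreal_plus)
      finally have mid: "L1d (\<lambda>x. indicator (cball 0 R) x * Mn m x) (\<lambda>x. indicator (cball 0 R) x * Mn n x) \<le> ennreal (e/6)" .
      have "L1d (V (r m) (time a)) (V (r n) (time a)) \<le>
         (\<integral>\<^sup>+x. indicator {x. R < norm x} x * ennreal \<bar>V (r m) (time a) x\<bar> \<partial>lborel)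
     + (\<integral>\<^sup>+x. indicator {x. R < norm x} x * ennreal \<bar>V (r n) (time a) x\<bar> \<partial>lborel)
     + (L1d (Mn m) (V (r m) (time a)) + L1d (\<lambda>x. indicator (cball 0 R) x * Mn m x) (\<lambda>x. indicator (cball 0 R) x * Mn n x)
        + L1d (Mn n) (V (r n) (time a)))"
        by (rule L1d_split_ball) auto
      also have "\<dots> \<le> ennreal (e/6) + ennreal (e/6) + (ennreal (e/6) + ennreal (e/6) + ennreal (e/6))"
        by (intro add_mono R ta close mid)
      also have "\<dots> = ennreal (5 * e / 6)" using e by (simp flip: ennreal_plus)
      also have "\<dots> \<le> ennreal e" using e by (intro ennreal_leI) simp
      finally show "L1d (V (r m) (time a)) (V (r n) (time a)) \<le> ennreal e" .
    qed
  qed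
  have "\<exists>N. \<forall>m\<ge>N. \<forall>n\<ge>N. \<forall>t\<in>{0..T}. L1d (V (r m) t) (V (r n) t) \<le> ennreal e" if e: "e > 0" for e
  proof -
    have e3: "e / 3 > 0" using e by simp
    obtain d N0 where d: "d > 0" "\<And>n s t. n \<ge> N0 \<Longrightarrow> s \<in> {0..T} \<Longrightarrow> t \<in> {0..T} \<Longrightarrow> \<bar>s - t\<bar> < d \<Longrightarrow> L1d (V n s) (V n t) \<le> ennreal (e/3)"
      using time[OF e3] by blast
    obtain n0 :: nat where n0: "T / d < real n0" using reals_Archimedean2 by blast
    have n0p: "0 < n0" using n0 T d(1) by (metis divide_pos_pos gr0I less_asym of_nat_0)
    \<comment> \<open>The grid point \<open>T * i / n0\<close> is a rational multiple of
      \<open>T\<close>, hence one of the enumerated times; its index is the code of the rational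
      \<open>i / n0\<close>. The choice of \<open>n0\<close> makes the mesh smaller than
      \<open>d\<close>.\<close>
    define grid where "grid i = to_nat (of_nat i / of_nat n0 :: rat)" for i
    have grid: "time (grid i) = T * (real i / real n0)" for i
      by (simp add: time_def grid_def of_rat_divide)
    have grid_in: "time (grid i) \<in> {0..T}" if "i \<le> n0" for i
      using that T n0p by (simp add: grid field_simps)
    have "\<forall>i. \<exists>N. i \<le> n0 \<longrightarrow> (\<forall>m\<ge>N. \<forall>n\<ge>N. L1d (V (r m) (time (grid i))) (V (r n) (time (grid i))) \<le> ennreal (e/3))"
      using timeC[OF e3 grid_in] by blast
    then obtain N where N: "\<And>i m n. i \<le> n0 \<Longrightarrow> m \<ge> N i \<Longrightarrow> n \<ge> N i \<Longrightarrow>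
        L1d (V (r m) (time (grid i))) (V (r n) (time (grid i))) \<le> ennreal (e/3)" by metis
    define NN where "NN = max N0 (Max (N ` {..n0}))"
    have NN: "N i \<le> NN" if "i \<le> n0" for i
      unfolding NN_def using that by (intro max.coboundedI2 Max_ge) auto
    show ?thesis
    proof (intro exI[of _ NN] allI impI ballI)
      fix m n t assume mn: "NN \<le> m" "NN \<le> n" and t: "t \<in> {0..T}"
      define i where "i = nat \<lfloor>t * real n0 / T\<rfloor>"
      have x0: "0 \<le> t * real n0 / T" using t T by simp
      have i1: "real i \<le> t * real n0 / T" "t * real n0 / T < real i + 1"
        unfolding i_def using x0 by (simp_all add: of_nat_nat)
      have in0: "i \<le> n0"
      proof -
        have "t * real n0 / T \<le> real n0" using mult_right_mono[of t T "real n0"] t T by (simp add: pos_divide_le_eq mult.commute)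
        then show ?thesis using i1(1) by linarith
      qed
      have tg: "\<bar>t - time (grid i)\<bar> < d"
      proof -
        have "time (grid i) \<le> t" using i1(1) T n0p by (simp add: grid field_simps)
        moreover have "t < time (grid i) + T / real n0" using i1(2) T n0p by (simp add: grid field_simps)
        moreover have "T / real n0 < d" using n0 d(1) n0p by (simp add: field_simps)
        ultimately show ?thesis by linarith
      qed
      have rge: "r m \<ge> N0" "r n \<ge> N0"
        using mn seq_suble[OF r(1), of m] seq_suble[OF r(1), of n] by (auto simp: NN_def)
      have "L1d (V (r m) t) (V (r n) t) \<le> L1d (V (r m) t) (V (r m) (time (grid i))) + L1d (V (r m) (time (grid i))) (V (r n) t)"
        by (rule L1d_triangle) auto
      also have "L1d (V (r m) (time (grid i))) (V (r n) t) \<le> L1d (V (r m) (time (grid i))) (V (r n) (time (grid i))) + L1d (V (r n) (time (grid i))) (V (r n) t)"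
        by (rule L1d_triangle) auto
      finally have "L1d (V (r m) t) (V (r n) t) \<le> L1d (V (r m) t) (V (r m) (time (grid i))) +
        (L1d (V (r m) (time (grid i))) (V (r n) (time (grid i))) + L1d (V (r n) (time (grid i))) (V (r n) t))"
        by (simp add: add_left_mono)
      also have "\<dots> \<le> ennreal (e/3) + (ennreal (e/3) + ennreal (e/3))"
      proof (intro add_mono)
        show "L1d (V (r m) t) (V (r m) (time (grid i))) \<le> ennreal (e/3)"
          by (rule d(2)[OF rge(1) t grid_in[OF in0] tg])
        show "L1d (V (r n) (time (grid i))) (V (r n) t) \<le> ennreal (e/3)"
          using d(2)[OF rge(2) t grid_in[OF in0] tg] by (simp add: L1d_commute)
        show "L1d (V (r m) (time (grid i))) (V (r n) (time (grid i))) \<le> ennreal (e/3)"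
          using mn NN[OF in0] by (intro N in0) auto
      qed
      also have "\<dots> = ennreal e" using e by (simp flip: ennreal_plus)
      finally show "L1d (V (r m) t) (V (r n) t) \<le> ennreal e" .
    qed
  qed
  with r(1) show ?thesis using that by blast
qed

text \<open>Completeness with a limit that is Borel jointly in time and space. Taking L1 limits
  separately for each \<open>t\<close> would not give this; instead one subsequence, independent of
  \<open>t\<close>, has summable increments and therefore converges almost everywhere for every
  \<open>t\<close>. The sets \<open>A k\<close> allow convergence that is merely local.\<close>

lemma uniform_L1_limit:
  fixes V :: "nat \<Rightarrow> real \<Rightarrow> 'a::euclidean_space \<Rightarrow> real" and A :: "nat \<Rightarrow> 'a set"
  assumes [measurable]: "\<And>n. (\<lambda>p. V n (fst p) (snd p)) \<in> borel_measurable borel"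
    and [measurable]: "\<And>k. A k \<in> sets borel" and cover: "(\<Union>k. A k) = UNIV"
    and bnd: "\<And>n t x. \<bar>V n t x\<bar> \<le> B"
    and cauchy: "\<And>k e. e > 0 \<Longrightarrow> \<exists>N. \<forall>m\<ge>N. \<forall>n\<ge>N. \<forall>t\<in>I.
      (\<integral>\<^sup>+x. indicator (A k) x * ennreal \<bar>V m t x - V n t x\<bar> \<partial>lborel) \<le> ennreal e"
  obtains W where "(\<lambda>p. W (fst p) (snd p)) \<in> borel_measurable borel" "\<And>t x. \<bar>W t x\<bar> \<le> B"
    "\<And>k e. e > 0 \<Longrightarrow> \<exists>N. \<forall>n\<ge>N. \<forall>t\<in>I.
      (\<integral>\<^sup>+x. indicator (A k) x * ennreal \<bar>V n t x - W t x\<bar> \<partial>lborel) \<le> ennreal e"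
proof -
  have B: "0 \<le> B" using order_trans[OF abs_ge_zero bnd] .
  have [measurable]: "(\<lambda>x. V n t x) \<in> borel_measurable borel" for n t
  proof -
    have "(\<lambda>x. (\<lambda>p. V n (fst p) (snd p)) (t, x)) \<in> borel_measurable borel"
      by (rule measurable_compose[OF _ assms(1)]) (auto intro!: borel_measurable_continuous_onI continuous_intros)
    then show ?thesis by simp
  qed
  have "\<forall>j. \<exists>N. \<forall>i\<le>j. \<forall>m\<ge>N. \<forall>n\<ge>N. \<forall>t\<in>I.
     (\<integral>\<^sup>+x. indicator (A i) x * ennreal \<bar>V m t x - V n t x\<bar> \<partial>lborel) \<le> ennreal ((1/2)^j)"
  proof
    fix j :: nat
    have "\<forall>i. \<exists>N. \<forall>m\<ge>N. \<forall>n\<ge>N. \<forall>t\<in>I.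
      (\<integral>\<^sup>+x. indicator (A i) x * ennreal \<bar>V m t x - V n t x\<bar> \<partial>lborel) \<le> ennreal ((1/2)^j)"
      by (intro allI cauchy) simp
    then obtain N where N: "\<And>i m n t. m \<ge> N i \<Longrightarrow> n \<ge> N i \<Longrightarrow> t \<in> I \<Longrightarrow>
      (\<integral>\<^sup>+x. indicator (A i) x * ennreal \<bar>V m t x - V n t x\<bar> \<partial>lborel) \<le> ennreal ((1/2)^j)"
      by metis
    have "N i \<le> Max (N ` {..j})" if "i \<le> j" for i using that by (intro Max_ge) auto
    then show "\<exists>N. \<forall>i\<le>j. \<forall>m\<ge>N. \<forall>n\<ge>N. \<forall>t\<in>I.
     (\<integral>\<^sup>+x. indicator (A i) x * ennreal \<bar>V m t x - V n t x\<bar> \<partial>lborel) \<le> ennreal ((1/2)^j)"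
      by (intro exI[of _ "Max (N ` {..j})"] allI impI ballI N) (meson order_trans)+
  qed
  then obtain N where N: "\<And>i j m n t. i \<le> j \<Longrightarrow> m \<ge> N j \<Longrightarrow> n \<ge> N j \<Longrightarrow> t \<in> I \<Longrightarrow>
     (\<integral>\<^sup>+x. indicator (A i) x * ennreal \<bar>V m t x - V n t x\<bar> \<partial>lborel) \<le> ennreal ((1/2)^j)"
    by metis
  \<comment> \<open>A partial sum of natural numbers is monotone and dominates each of its terms, so
    all later indices stay admissible for every earlier threshold.\<close>
  define nn where "nn j = (\<Sum>i\<le>j. N i)" for j
  have nn_ge: "N j \<le> nn j'" if "j \<le> j'" for j j'
    unfolding nn_def using that by (intro member_le_sum) auto
  \<comment> \<open>Clipping guarantees the bound also at points where the sequence diverges and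
    \<open>lim\<close> has no meaning; where it converges the limit already lies in
    \<open>[-B, B]\<close> and clipping does nothing.\<close>
  define W where "W t x = max (-B) (min B (lim (\<lambda>j. V (nn j) t x)))" for t x
  have W1: "(\<lambda>p. W (fst p) (snd p)) \<in> borel_measurable borel"
    unfolding W_def by measurable
  have W2: "\<bar>W t x\<bar> \<le> B" for t x using B by (auto simp: W_def)
  have ae: "AE x in lborel. (\<lambda>j. V (nn j) t x) \<longlonglongrightarrow> W t x" if t: "t \<in> I" for t
  proof -
    have "AE x in lborel. x \<in> A i \<longrightarrow> (\<lambda>j. V (nn j) t x) \<longlonglongrightarrow> W t x" for i
    proof -
      \<comment> \<open>The bounds on \<open>A i\<close> are available only from stage
        \<open>i\<close> on, so the telescoping series of increments starts there.\<close>
      define g where "g j x = V (nn (Suc (i + j))) t x - V (nn (i + j)) t x" for j x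
      have [measurable]: "g j \<in> borel_measurable borel" for j unfolding g_def by measurable
      have "(\<integral>\<^sup>+x. (\<Sum>j. indicator (A i) x * ennreal \<bar>g j x\<bar>) \<partial>lborel)
        = (\<Sum>j. \<integral>\<^sup>+x. indicator (A i) x * ennreal \<bar>g j x\<bar> \<partial>lborel)"
        by (rule nn_integral_suminf) measurable
      also have "\<dots> \<le> (\<Sum>j. ennreal ((1/2)^j))"
      proof (intro suminf_le)
        fix j
        have "(\<integral>\<^sup>+x. indicator (A i) x * ennreal \<bar>g j x\<bar> \<partial>lborel) \<le> ennreal ((1/2)^(i + j))"
          unfolding g_def by (rule N) (auto intro!: nn_ge t)
        also have "\<dots> \<le> ennreal ((1/2)^j)" by (intro ennreal_leI power_decreasing) auto
        finally show "(\<integral>\<^sup>+x. indicator (A i) x * ennreal \<bar>g j x\<bar> \<partial>lborel) \<le> ennreal ((1/2)^j)" .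
      qed auto
      also have "\<dots> = ennreal (\<Sum>j. (1/2)^j)" by (intro suminf_ennreal2) auto
      also have "\<dots> < \<infinity>" by simp
      finally have "(\<integral>\<^sup>+x. (\<Sum>j. indicator (A i) x * ennreal \<bar>g j x\<bar>) \<partial>lborel) < \<infinity>" .
      then have "AE x in lborel. (\<Sum>j. indicator (A i) x * ennreal \<bar>g j x\<bar>) \<noteq> \<infinity>"
        by (intro nn_integral_PInf_AE) auto
      then show ?thesis
      proof (rule AE_mp, intro AE_I2 impI)
        fix x assume fin: "(\<Sum>j. indicator (A i) x * ennreal \<bar>g j x\<bar>) \<noteq> \<infinity>" and x: "x \<in> A i"
        then have "(\<Sum>j. ennreal \<bar>g j x\<bar>) \<noteq> top" by simp
        then have "summable (\<lambda>j. \<bar>g j x\<bar>)" by (intro summable_suminf_not_top) auto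
        then have "summable (\<lambda>j. g j x)" by (rule summable_rabs_cancel)
        then have "convergent (\<lambda>n. \<Sum>j<n. g j x)" by (simp add: summable_iff_convergent)
        moreover have "(\<Sum>j<n. g j x) = V (nn (i + n)) t x - V (nn i) t x" for n
          using sum_lessThan_telescope[of "\<lambda>j. V (nn (i + j)) t x" n] by (simp add: g_def)
        ultimately have "convergent (\<lambda>n. V (nn (i + n)) t x - V (nn i) t x)" by simp
        then have "convergent (\<lambda>n. (V (nn (i + n)) t x - V (nn i) t x) + V (nn i) t x)"
          by (intro convergent_add convergent_const)
        then have "convergent (\<lambda>n. V (nn (n + i)) t x)" by (simp add: add.commute)
        then have "convergent (\<lambda>n. V (nn n) t x)"
          by (subst (asm) convergent_ignore_initial_segment[of "\<lambda>n. V (nn n) t x"])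
        then have lim: "(\<lambda>j. V (nn j) t x) \<longlonglongrightarrow> lim (\<lambda>j. V (nn j) t x)"
          by (simp add: convergent_LIMSEQ_iff)
        have "\<bar>lim (\<lambda>j. V (nn j) t x)\<bar> \<le> B"
          by (rule LIMSEQ_le_const2[OF tendsto_rabs[OF lim]]) (auto intro: bnd)
        then have "W t x = lim (\<lambda>j. V (nn j) t x)" by (simp add: W_def)
        then show "(\<lambda>j. V (nn j) t x) \<longlonglongrightarrow> W t x" using lim by simp
      qed
    qed
    then have "AE x in lborel. \<forall>i. x \<in> A i \<longrightarrow> (\<lambda>j. V (nn j) t x) \<longlonglongrightarrow> W t x"
      unfolding AE_all_countable by blast
    then show ?thesis
    proof (rule AE_mp, intro AE_I2 impI)
      fix x assume "\<forall>i. x \<in> A i \<longrightarrow> (\<lambda>j. V (nn j) t x) \<longlonglongrightarrow> W t x"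
      moreover obtain i where "x \<in> A i" using cover by blast
      ultimately show "(\<lambda>j. V (nn j) t x) \<longlonglongrightarrow> W t x" by blast
    qed
  qed
  have W3: "\<exists>N. \<forall>n\<ge>N. \<forall>t\<in>I. (\<integral>\<^sup>+x. indicator (A k) x * ennreal \<bar>V n t x - W t x\<bar> \<partial>lborel) \<le> ennreal e"
    if e: "e > 0" for k e
  proof -
    obtain j1 where j1: "(1/2::real)^j1 < e" using real_arch_pow_inv[OF e, of "1/2"] by auto
    \<comment> \<open>At least \<open>k\<close>, since the Cauchy bound on \<open>A k\<close> is
      available only from stage \<open>k\<close> on.\<close>
    define j0 where "j0 = max j1 k"
    have j0: "(1/2::real)^j0 \<le> e"
    proof -
      have "(1/2::real)^j0 \<le> (1/2)^j1" by (rule power_decreasing) (simp_all add: j0_def)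
      then show ?thesis using j1 by linarith
    qed
    show ?thesis
    proof (intro exI[of _ "N j0"] allI impI ballI)
      fix n t assume n: "N j0 \<le> n" and t: "t \<in> I"
      have "(\<integral>\<^sup>+x. indicator (A k) x * ennreal \<bar>V n t x - W t x\<bar> \<partial>lborel)
        = (\<integral>\<^sup>+x. liminf (\<lambda>j. indicator (A k) x * ennreal \<bar>V n t x - V (nn j) t x\<bar>) \<partial>lborel)"
      proof (rule nn_integral_cong_AE, rule AE_mp[OF ae[OF t]], intro AE_I2 impI)
        fix x assume "(\<lambda>j. V (nn j) t x) \<longlonglongrightarrow> W t x"
        then have "(\<lambda>j. ennreal (indicator (A k) x * \<bar>V n t x - V (nn j) t x\<bar>)) \<longlonglongrightarrow> ennreal (indicator (A k) x * \<bar>V n t x - W t x\<bar>)"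
          by (intro tendsto_ennrealI tendsto_intros)
        then have "(\<lambda>j. indicator (A k) x * ennreal \<bar>V n t x - V (nn j) t x\<bar>) \<longlonglongrightarrow> indicator (A k) x * ennreal \<bar>V n t x - W t x\<bar>"
          by (simp add: ennreal_mult ennreal_indicator)
        then show "indicator (A k) x * ennreal \<bar>V n t x - W t x\<bar> = liminf (\<lambda>j. indicator (A k) x * ennreal \<bar>V n t x - V (nn j) t x\<bar>)"
          by (intro lim_imp_Liminf[symmetric]) auto
      qed
      \<comment> \<open>Fatou along the fixed subsequence turns the Cauchy bound into a bound
        against the limit, and the threshold remains independent of \<open>t\<close>.\<close>
      also have "\<dots> \<le> liminf (\<lambda>j. \<integral>\<^sup>+x. indicator (A k) x * ennreal \<bar>V n t x - V (nn j) t x\<bar> \<partial>lborel)"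
        by (rule nn_integral_liminf) measurable
      also have "\<dots> \<le> ennreal ((1/2)^j0)"
      proof (rule Liminf_le)
        show "\<forall>\<^sub>F j in sequentially. (\<integral>\<^sup>+x. indicator (A k) x * ennreal \<bar>V n t x - V (nn j) t x\<bar> \<partial>lborel) \<le> ennreal ((1/2)^j0)"
          using eventually_ge_at_top[of j0]
        proof eventually_elim
          case (elim j)
          have "k \<le> j0" by (simp add: j0_def)
          then show ?case by (rule N[OF _ n nn_ge[OF elim] t])
        qed
      qed simp
      also have "\<dots> \<le> ennreal e" using j0 by (rule ennreal_leI)
      finally show "(\<integral>\<^sup>+x. indicator (A k) x * ennreal \<bar>V n t x - W t x\<bar> \<partial>lborel) \<le> ennreal e" .
    qed
  qed
  show ?thesis by (rule that[OF W1 W2 W3])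
qed

section \<open>The entropy inequality in the limit\<close>

lemma integrable_bounded_support:
  fixes f :: "'b::euclidean_space \<Rightarrow> real"
  assumes [measurable]: "f \<in> borel_measurable borel" and b: "\<And>x. \<bar>f x\<bar> \<le> C" and s: "\<And>x. R < norm x \<Longrightarrow> f x = 0"
  shows "integrable lborel f"
proof -
  have "integrable lborel (\<lambda>x. indicator (cball 0 R) x *\<^sub>R f x)"
  proof (rule integrableI_bounded_set_indicator[where B=C])
    show "emeasure lborel (cball (0::'b) R) < \<infinity>"
      by (rule emeasure_bounded_finite) (rule bounded_cball)
  qed (use b in auto)
  moreover have "(\<lambda>x. indicator (cball 0 R) x *\<^sub>R f x) = f"
    using s by (auto simp: fun_eq_iff split: split_indicator)
  ultimately show ?thesis by simp
qed

lemma integral_bounded_support: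
  fixes f :: "'b::euclidean_space \<Rightarrow> real"
  assumes [measurable]: "f \<in> borel_measurable borel" and b: "\<And>x. \<bar>f x\<bar> \<le> C" and s: "\<And>x. R < norm x \<Longrightarrow> f x = 0"
  shows "\<bar>\<integral>x. f x \<partial>lborel\<bar> \<le> C * measure lborel (cball (0::'b) R)"
proof -
  have i: "integrable lborel f" by (rule integrable_bounded_support[OF assms])
  have C: "0 \<le> C" using order_trans[OF abs_ge_zero b] .
  have e: "emeasure lborel (cball (0::'b) R) < \<infinity>"
    by (rule emeasure_bounded_finite) (rule bounded_cball)
  have "\<bar>\<integral>x. f x \<partial>lborel\<bar> \<le> (\<integral>x. \<bar>f x\<bar> \<partial>lborel)" by (rule integral_abs_bound)
  also have "\<dots> \<le> (\<integral>x. C * indicator (cball (0::'b) R) x \<partial>lborel)"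
  proof (rule integral_mono)
    show "integrable lborel (\<lambda>x. C * indicator (cball (0::'b) R) x)"
      using e by (intro integrable_mult_right integrable_real_indicator) auto
    show "\<bar>f x\<bar> \<le> C * indicator (cball 0 R) x" for x
      using b[of x] s[of x] by (auto split: split_indicator)
  qed (use i in auto)
  also have "\<dots> = C * measure lborel (cball (0::'b) R)" by simp
  finally show ?thesis .
qed

lemma lborel_Fubini:
  fixes f :: "'a::euclidean_space \<times> 'b::euclidean_space \<Rightarrow> real"
  assumes f: "integrable lborel f"
  shows "(\<integral>x. \<integral>y. f (x, y) \<partial>lborel \<partial>lborel) = (\<integral>p. f p \<partial>lborel)"
    and "(\<integral>y. \<integral>x. f (x, y) \<partial>lborel \<partial>lborel) = (\<integral>p. f p \<partial>lborel)"
    and "integrable lborel (\<lambda>x. \<integral>y. f (x, y) \<partial>lborel)"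
    and "integrable lborel (\<lambda>y. \<integral>x. f (x, y) \<partial>lborel)"
proof -
  have f': "integrable (lborel \<Otimes>\<^sub>M lborel) (\<lambda>(x, y). f (x, y))" using f by (simp add: lborel_prod)
  show "(\<integral>x. \<integral>y. f (x, y) \<partial>lborel \<partial>lborel) = (\<integral>p. f p \<partial>lborel)"
    using lborel_pair.integral_fst[OF f'] by (simp add: lborel_prod)
  show "(\<integral>y. \<integral>x. f (x, y) \<partial>lborel \<partial>lborel) = (\<integral>p. f p \<partial>lborel)"
    using lborel_pair.integral_snd[OF f'] by (simp add: lborel_prod)
  show "integrable lborel (\<lambda>x. \<integral>y. f (x, y) \<partial>lborel)" by (rule lborel_pair.integrable_fst[OF f'])
  show "integrable lborel (\<lambda>y. \<integral>x. f (x, y) \<partial>lborel)" by (rule lborel_pair.integrable_snd[OF f'])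
qed

context collapse
begin

abbreviation slab :: "real \<Rightarrow> real" where "slab \<equiv> indicator {-B..B}"

text \<open>The fundamental theorem for the gauge integral accepts every derivative that exists
  everywhere, continuous or not; boundedness and measurability of \<open>g\<close> then identify the
  gauge integral with the Lebesgue integral. The endpoint \<open>v = s\<close> is a null
  set.\<close>

lemma FTC_slab:
  fixes G g :: "real \<Rightarrow> 'b::euclidean_space"
  assumes G: "\<And>v. (G has_vector_derivative g v) (at v)" and [measurable]: "g \<in> borel_measurable borel"
    and bnd: "\<And>v. \<bar>v\<bar> \<le> B \<Longrightarrow> norm (g v) \<le> C" and s: "\<bar>s\<bar> \<le> B"
  shows "integrable lborel (\<lambda>v. (slab v * (if v < s then 1 else 0)) *\<^sub>R g v)"
    and "(\<integral>v. (slab v * (if v < s then 1 else 0)) *\<^sub>R g v \<partial>lborel) = G s - G (-B)"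
proof -
  have i1: "integrable lborel (\<lambda>v. indicator {-B..s} v *\<^sub>R g v)"
    by (rule integrableI_bounded_set_indicator[where B=C])
       (use bnd s in \<open>auto simp: emeasure_lborel_Icc_eq\<close>)
  have ae: "AE v in lborel. indicator {-B..s} v *\<^sub>R g v = (slab v * (if v < s then 1 else 0)) *\<^sub>R g v"
    using AE_lborel_singleton[of s] by eventually_elim (use s in \<open>auto split: split_indicator\<close>)
  show "integrable lborel (\<lambda>v. (slab v * (if v < s then 1 else 0)) *\<^sub>R g v)"
    using i1 by (rule integrable_cong_AE_imp) (use ae in \<open>auto elim: AE_mp\<close>)
  have "(g has_integral (G s - G (-B))) {-B..s}"
    using s by (intro fundamental_theorem_of_calculus) (auto intro: has_vector_derivative_at_within G)
  then have "((\<lambda>v. if v \<in> {-B..s} then g v else 0) has_integral (G s - G (-B))) UNIV"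
    by (simp only: has_integral_restrict_UNIV)
  moreover have "((\<lambda>v. indicator {-B..s} v *\<^sub>R g v) has_integral (\<integral>v. indicator {-B..s} v *\<^sub>R g v \<partial>lborel)) UNIV"
    by (rule has_integral_integral_lborel[OF i1])
  moreover have "(\<lambda>v. indicator {-B..s} v *\<^sub>R g v) = (\<lambda>v. if v \<in> {-B..s} then g v else 0)"
    by (auto simp: fun_eq_iff)
  ultimately have "(\<integral>v. indicator {-B..s} v *\<^sub>R g v \<partial>lborel) = G s - G (-B)"
    by (metis has_integral_unique)
  moreover have "(\<integral>v. indicator {-B..s} v *\<^sub>R g v \<partial>lborel) = (\<integral>v. (slab v * (if v < s then 1 else 0)) *\<^sub>R g v \<partial>lborel)"
    by (rule integral_cong_AE) (use ae in auto)
  ultimately show "(\<integral>v. (slab v * (if v < s then 1 else 0)) *\<^sub>R g v \<partial>lborel) = G s - G (-B)" by simp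
qed

end

text \<open>The derivative \<open>e'\<close> is a separate parameter so that two cases share one
  proof: a convex entropy with its derivative, and the linear entropy with \<open>e' = 1\<close> and
  \<open>Q\<close> the flux itself, which yields the weak formulation. Convexity enters as
  monotonicity of \<open>e'\<close>.\<close>

locale collapse_entropy = collapse +
  fixes \<eta> e' :: "real \<Rightarrow> real" and Q :: "real \<Rightarrow> 'a"
  assumes eta: "\<And>v. (\<eta> has_vector_derivative e' v) (at v)"
    and e'_mono: "mono e'"
    and Q: "\<And>v. (Q has_vector_derivative (e' v *\<^sub>R a v)) (at v)"
begin

definition M where "M = max \<bar>e' (-B)\<bar> \<bar>e' B\<bar>"

lemma e'_borel [measurable]: "e' \<in> borel_measurable borel"
  by (rule borel_measurable_mono[OF e'_mono])

lemma M_nonneg: "0 \<le> M" by (simp add: M_def)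

lemma e'_bound: "\<bar>v\<bar> \<le> B \<Longrightarrow> \<bar>e' v\<bar> \<le> M"
  using monoD[OF e'_mono, of "-B" v] monoD[OF e'_mono, of v B] unfolding M_def by (auto simp: abs_le_iff)

lemma eta_integral:
  assumes "\<bar>s\<bar> \<le> B"
  shows "(\<integral>v. slab v * e' v * (if v < s then 1 else 0) \<partial>lborel) = \<eta> s - \<eta> (-B)"
  using FTC_slab(2)[OF eta _ _ assms, of M] e'_bound by (simp add: mult_ac)

lemma Q_integral:
  assumes "\<bar>s\<bar> \<le> B"
  shows "integrable lborel (\<lambda>v. (slab v * e' v * (if v < s then 1 else 0)) *\<^sub>R a v)"
    and "(\<integral>v. (slab v * e' v * (if v < s then 1 else 0)) *\<^sub>R a v \<partial>lborel) = Q s - Q (-B)"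
proof -
  have "norm (e' v *\<^sub>R a v) \<le> M * S" if "\<bar>v\<bar> \<le> B" for v
    using mult_mono[OF e'_bound[OF that] a_bound[OF that] M_nonneg] by simp
  then show "integrable lborel (\<lambda>v. (slab v * e' v * (if v < s then 1 else 0)) *\<^sub>R a v)"
     "(\<integral>v. (slab v * e' v * (if v < s then 1 else 0)) *\<^sub>R a v \<partial>lborel) = Q s - Q (-B)"
    using FTC_slab[OF Q _ _ assms, of "M * S"] by (simp_all add: mult_ac)
qed

lemma eta_lipschitz:
  assumes "\<bar>s\<bar> \<le> B" "\<bar>r\<bar> \<le> B"
  shows "\<bar>\<eta> s - \<eta> r\<bar> \<le> M * \<bar>s - r\<bar>"
proof -
  have "norm (\<eta> s - \<eta> r) \<le> M * norm (s - r)"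
  proof (rule differentiable_bound[of "{-B..B}"])
    show "(\<eta> has_derivative (\<lambda>h. h *\<^sub>R e' v)) (at v within {-B..B})" for v
      using eta[of v] unfolding has_vector_derivative_def by (rule has_derivative_at_withinI)
    show "onorm (\<lambda>h. h *\<^sub>R e' v) \<le> M" if "v \<in> {-B..B}" for v
      using e'_bound[of v] that
      by (intro onorm_le) (auto simp: abs_mult mult.commute[of M] intro!: mult_left_mono)
  qed (use assms in auto)
  then show ?thesis by simp
qed

lemma Q_lipschitz:
  assumes "\<bar>s\<bar> \<le> B" "\<bar>r\<bar> \<le> B"
  shows "norm (Q s - Q r) \<le> M * S * \<bar>s - r\<bar>"
proof -
  have "norm (Q s - Q r) \<le> M * S * norm (s - r)"
  proof (rule differentiable_bound[of "{-B..B}"])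
    show "(Q has_derivative (\<lambda>h. h *\<^sub>R (e' v *\<^sub>R a v))) (at v within {-B..B})" for v
      using Q[of v] unfolding has_vector_derivative_def by (rule has_derivative_at_withinI)
    show "onorm (\<lambda>h. h *\<^sub>R (e' v *\<^sub>R a v)) \<le> M * S" if "v \<in> {-B..B}" for v
    proof (rule onorm_le)
      fix h :: real
      have v: "\<bar>v\<bar> \<le> B" using that by auto
      have "\<bar>h\<bar> * (\<bar>e' v\<bar> * norm (a v)) \<le> \<bar>h\<bar> * (M * S)"
        using mult_mono[OF e'_bound[OF v] a_bound[OF v] M_nonneg] by (intro mult_left_mono) auto
      then show "norm (h *\<^sub>R e' v *\<^sub>R a v) \<le> M * S * norm h" by (simp add: mult_ac abs_mult)
    qed
  qed (use assms in auto)
  then show ?thesis by simp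
qed

lemma eta_borel [measurable]: "\<eta> \<in> borel_measurable borel"
  by (intro borel_measurable_continuous_onI continuous_at_imp_continuous_on ballI)
     (use eta has_vector_derivative_continuous in blast)

lemma Q_borel [measurable]: "Q \<in> borel_measurable borel"
  by (intro borel_measurable_continuous_onI continuous_at_imp_continuous_on ballI)
     (use Q has_vector_derivative_continuous in blast)

text \<open>Among all densities on the slab with values in \<open>[0,1]\<close> and given mass, the sublevel
  indicator minimises the integral against a nondecreasing weight.\<close>

lemma eta_collapse_le:
  assumes [measurable]: "u \<in> borel_measurable borel"
  shows "\<eta> (T \<tau> u x) - \<eta> (-B) \<le> (\<integral>v. slab v * e' v * (if v < u (x - \<tau> *\<^sub>R a v) then 1 else 0) \<partial>lborel)"
proof -
  define w where "w = T \<tau> u x"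
  have w: "\<bar>w\<bar> \<le> B" unfolding w_def by (rule T_range) auto
  let ?g = "\<lambda>v. if v < u (x - \<tau> *\<^sub>R a v) then 1 else 0 :: real"
  let ?h = "\<lambda>v. if v < w then 1 else 0 :: real"
  have int: "integrable lborel (\<lambda>v. slab v * ?g v)" "integrable lborel (\<lambda>v. slab v * ?h v)"
    by (rule integrable_slab[where C=1]; auto)+
  have int': "integrable lborel (\<lambda>v. slab v * (e' v * ?g v))" "integrable lborel (\<lambda>v. slab v * (e' v * ?h v))"
    by (rule integrable_slab[where C=M]; use e'_bound M_nonneg in auto)+
  have "(\<integral>v. slab v * ?g v \<partial>lborel) = w + B" by (simp add: w_def tc_def)
  also have "\<dots> = (\<integral>v. slab v * ?h v \<partial>lborel)" by (simp add: integral_slab_less[OF w])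
  finally have mass: "(\<integral>v. slab v * ?g v \<partial>lborel) = (\<integral>v. slab v * ?h v \<partial>lborel)" .
  \<comment> \<open>As the masses agree, \<open>e' w\<close> times their difference may be
    subtracted at no cost. The factors \<open>e' v - e' w\<close> and \<open>?g v - ?h v\<close>
    then have the same sign: below \<open>w\<close> both are at most 0, from \<open>w\<close> on
    both are at least 0.\<close>
  have "0 \<le> (\<integral>v. slab v * (e' v * ?g v) - slab v * (e' v * ?h v) - e' w * (slab v * ?g v - slab v * ?h v) \<partial>lborel)"
  proof (intro integral_nonneg_AE AE_I2)
    fix v
    have "slab v * (e' v * ?g v) - slab v * (e' v * ?h v) - e' w * (slab v * ?g v - slab v * ?h v)
       = slab v * ((e' v - e' w) * (?g v - ?h v))" by (simp add: algebra_simps)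
    also have "\<dots> \<ge> 0"
    proof (rule mult_nonneg_nonneg)
      show "0 \<le> (e' v - e' w) * (?g v - ?h v)"
      proof (cases "v < w")
        case True
        then show ?thesis using monoD[OF e'_mono, of v w] by (intro mult_nonpos_nonpos) auto
      next
        case False
        then show ?thesis using monoD[OF e'_mono, of w v] by (intro mult_nonneg_nonneg) auto
      qed
    qed simp
    finally show "0 \<le> slab v * (e' v * ?g v) - slab v * (e' v * ?h v) - e' w * (slab v * ?g v - slab v * ?h v)" .
  qed
  also have "\<dots> = (\<integral>v. slab v * (e' v * ?g v) \<partial>lborel) - (\<integral>v. slab v * (e' v * ?h v) \<partial>lborel)"
    using int int' mass by simp
  finally have "(\<integral>v. slab v * (e' v * ?h v) \<partial>lborel) \<le> (\<integral>v. slab v * (e' v * ?g v) \<partial>lborel)" by simp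
  then show ?thesis using eta_integral[OF w] by (simp add: w_def mult.assoc)
qed

text \<open>After exchanging integrals, translating \<open>x\<close> for fixed \<open>v\<close>
  moves the displacement from the possibly rough \<open>u\<close> to the test function, where a
  Taylor expansion is possible.\<close>

lemma collapse_transfer:
  fixes \<psi> :: "'a \<Rightarrow> real"
  assumes [measurable]: "u \<in> borel_measurable borel" "\<psi> \<in> borel_measurable borel"
    and b: "\<And>x. \<bar>\<psi> x\<bar> \<le> C" and s: "\<And>x. R < norm x \<Longrightarrow> \<psi> x = 0" and \<tau>: "0 \<le> \<tau>" "\<tau> \<le> 1"
  shows "(\<integral>x. \<psi> x * (\<integral>v. slab v * e' v * (if v < u (x - \<tau> *\<^sub>R a v) then 1 else 0) \<partial>lborel) \<partial>lborel)
     = (\<integral>p. slab (snd p) * e' (snd p) * (if snd p < u (fst p) then 1 else 0) * \<psi> (fst p + \<tau> *\<^sub>R a (snd p)) \<partial>lborel)"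
    and "integrable lborel (\<lambda>x. \<psi> x * (\<integral>v. slab v * e' v * (if v < u (x - \<tau> *\<^sub>R a v) then 1 else 0) \<partial>lborel))"
    and "integrable lborel (\<lambda>p. slab (snd p) * e' (snd p) * (if snd p < u (fst p) then 1 else 0) * \<psi> (fst p + \<tau> *\<^sub>R a (snd p)))"
proof -
  have C: "0 \<le> C" using order_trans[OF abs_ge_zero b] .
  have se: "\<bar>slab v * e' v\<bar> \<le> M" for v using e'_bound[of v] M_nonneg by (auto split: split_indicator)
  have bd: "\<bar>slab v * e' v * (if P then 1 else 0) * \<psi> y\<bar> \<le> M * C" for v P y
    using mult_mono[OF se[of v] b[of y]] M_nonneg C by (auto simp: abs_mult)
  define E1 where "E1 p = slab (snd p) * e' (snd p) * (if snd p < u (fst p - \<tau> *\<^sub>R a (snd p)) then 1 else 0) * \<psi> (fst p)" for p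
  define E2 where "E2 p = slab (snd p) * e' (snd p) * (if snd p < u (fst p) then 1 else 0) * \<psi> (fst p + \<tau> *\<^sub>R a (snd p))" for p
  have i1: "integrable lborel E1"
  proof (rule integrable_bounded_support[where C="M * C" and R="R + B"])
    show "E1 \<in> borel_measurable borel" unfolding E1_def[abs_def] borel_prod[symmetric] by measurable
    show "\<bar>E1 p\<bar> \<le> M * C" for p unfolding E1_def by (rule bd)
    fix p :: "'a \<times> real" assume p: "R + B < norm p"
    have "norm p \<le> norm (fst p) + \<bar>snd p\<bar>" using norm_Pair_le[of "fst p" "snd p"] by simp
    then have "R < norm (fst p) \<or> B < \<bar>snd p\<bar>" using p by linarith
    then show "E1 p = 0" using s unfolding E1_def by (auto split: split_indicator)
  qed
  have i2: "integrable lborel E2"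
  proof (rule integrable_bounded_support[where C="M * C" and R="R + S + B"])
    show "E2 \<in> borel_measurable borel" unfolding E2_def[abs_def] borel_prod[symmetric] by measurable
    show "\<bar>E2 p\<bar> \<le> M * C" for p unfolding E2_def by (rule bd)
    fix p :: "'a \<times> real" assume p: "R + S + B < norm p"
    have "norm p \<le> norm (fst p) + \<bar>snd p\<bar>" using norm_Pair_le[of "fst p" "snd p"] by simp
    then have "R + S < norm (fst p) \<or> B < \<bar>snd p\<bar>" using p by linarith
    moreover have "R < norm (fst p + \<tau> *\<^sub>R a (snd p))" if "R + S < norm (fst p)" "\<bar>snd p\<bar> \<le> B"
    proof -
      have "norm (\<tau> *\<^sub>R a (snd p)) \<le> 1 * S"
        using a_bound[OF that(2)] \<tau> by (simp add: mult_mono order_trans[OF mult_left_le_one_le])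
      then show ?thesis using that(1) norm_triangle_ineq2[of "fst p" "- (\<tau> *\<^sub>R a (snd p))"] by simp
    qed
    ultimately show "E2 p = 0" using s unfolding E2_def
      by (cases "\<bar>snd p\<bar> \<le> B") (auto split: split_indicator)
  qed
  have eq1: "(\<lambda>x. \<integral>v. E1 (x, v) \<partial>lborel) = (\<lambda>x. \<psi> x * (\<integral>v. slab v * e' v * (if v < u (x - \<tau> *\<^sub>R a v) then 1 else 0) \<partial>lborel))"
    by (simp add: E1_def mult.commute[of "\<psi> _"] fun_eq_iff)
  show "integrable lborel (\<lambda>x. \<psi> x * (\<integral>v. slab v * e' v * (if v < u (x - \<tau> *\<^sub>R a v) then 1 else 0) \<partial>lborel))"
    using lborel_Fubini(3)[OF i1] unfolding eq1 .
  have "(\<integral>x. \<psi> x * (\<integral>v. slab v * e' v * (if v < u (x - \<tau> *\<^sub>R a v) then 1 else 0) \<partial>lborel) \<partial>lborel)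
     = (\<integral>v. \<integral>x. E1 (x, v) \<partial>lborel \<partial>lborel)"
    using lborel_Fubini(1,2)[OF i1] unfolding eq1 by simp
  also have "\<dots> = (\<integral>v. \<integral>x. E2 (x, v) \<partial>lborel \<partial>lborel)"
  proof (rule Bochner_Integration.integral_cong[OF refl])
    fix v
    have "(\<integral>x. E1 (x, v) \<partial>lborel) = (\<integral>x. E1 (\<tau> *\<^sub>R a v + x, v) \<partial>lborel)"
      by (rule integral_lborel_shift[symmetric]) (simp add: E1_def)
    then show "(\<integral>x. E1 (x, v) \<partial>lborel) = (\<integral>x. E2 (x, v) \<partial>lborel)" by (simp add: E1_def E2_def add.commute)
  qed
  also have "\<dots> = (\<integral>p. E2 p \<partial>lborel)" by (rule lborel_Fubini(2)[OF i2])
  finally show "(\<integral>x. \<psi> x * (\<integral>v. slab v * e' v * (if v < u (x - \<tau> *\<^sub>R a v) then 1 else 0) \<partial>lborel) \<partial>lborel)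
     = (\<integral>p. slab (snd p) * e' (snd p) * (if snd p < u (fst p) then 1 else 0) * \<psi> (fst p + \<tau> *\<^sub>R a (snd p)) \<partial>lborel)"
    unfolding E2_def .
  show "integrable lborel (\<lambda>p. slab (snd p) * e' (snd p) * (if snd p < u (fst p) then 1 else 0) * \<psi> (fst p + \<tau> *\<^sub>R a (snd p)))"
    using i2 unfolding E2_def .
qed

end

section \<open>Uniform bounds for test functions\<close>

locale c1_test =
  fixes \<phi> :: "real \<times> 'a::euclidean_space \<Rightarrow> real" and D :: "real \<times> 'a \<Rightarrow> (real \<times> 'a) \<Rightarrow>\<^sub>L real"
    and K :: "(real \<times> 'a) set" and h :: real
  assumes D_cont: "continuous_on UNIV D"
    and D: "\<And>p. (\<phi> has_derivative blinfun_apply (D p)) (at p)"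
    and K: "compact K" "K \<subseteq> {..<h} \<times> UNIV"
    and outside: "\<And>p. p \<notin> K \<Longrightarrow> \<phi> p = 0"
    and h_pos: "0 < h"
begin

lemma D_outside: "p \<notin> K \<Longrightarrow> D p = 0"
proof -
  assume p: "p \<notin> K"
  have "open (- K)" using compact_imp_closed[OF K(1)] by (simp add: open_Compl)
  then have "(\<phi> has_derivative (\<lambda>_. 0)) (at p)"
    by (rule has_derivative_transform_within_open[OF has_derivative_const[of 0]]) (use p outside in auto)
  then have "blinfun_apply (D p) = (\<lambda>_. 0)" using D has_derivative_unique by blast
  then show "D p = 0" by (intro blinfun_eqI) simp
qed

lemma late: "h \<le> fst p \<Longrightarrow> \<phi> p = 0" "h \<le> fst p \<Longrightarrow> D p = 0"
proof -
  have "p \<notin> K" if "h \<le> fst p" using K(2) that by (cases p) auto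
  then show "h \<le> fst p \<Longrightarrow> \<phi> p = 0" "h \<le> fst p \<Longrightarrow> D p = 0"
    using outside D_outside by blast+
qed

text \<open>One radius fixed for the whole locale, so that the constants built from it depend on the
  test function alone.\<close>

definition R where "R = (SOME R. 0 \<le> R \<and> K \<subseteq> cball 0 R)"

lemma R: "0 \<le> R" "K \<subseteq> cball 0 R"
proof -
  obtain R0 where "0 < R0" "\<And>x. x \<in> K \<Longrightarrow> norm x \<le> R0"
    using compact_imp_bounded[OF K(1)] unfolding bounded_pos by blast
  then have "\<exists>R. 0 \<le> R \<and> K \<subseteq> cball 0 R" by (intro exI[of _ R0]) auto
  from someI_ex[OF this] show "0 \<le> R" "K \<subseteq> cball 0 R" by (auto simp: R_def)
qed

lemma far: "R < norm p \<Longrightarrow> \<phi> p = 0" "R < norm p \<Longrightarrow> D p = 0"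
proof -
  have "p \<notin> K" if "R < norm p" using R(2) that by auto
  then show "R < norm p \<Longrightarrow> \<phi> p = 0" "R < norm p \<Longrightarrow> D p = 0"
    using outside D_outside by blast+
qed

lemma far_snd: "R < norm x \<Longrightarrow> \<phi> (t, x) = 0" "R < norm x \<Longrightarrow> D (t, x) = 0"
proof -
  have "R < norm (t, x)" if "R < norm x" using that norm_snd_le[of x t] by (rule less_le_trans)
  then show "R < norm x \<Longrightarrow> \<phi> (t, x) = 0" "R < norm x \<Longrightarrow> D (t, x) = 0"
    using far by blast+
qed

lemma phi_cont: "continuous_on UNIV \<phi>"
  by (intro continuous_at_imp_continuous_on ballI has_derivative_continuous[OF D])

lemma phi_borel [measurable]: "\<phi> \<in> borel_measurable borel"
  by (rule borel_measurable_continuous_onI[OF phi_cont])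

lemma D_apply_cont: "continuous_on UNIV (\<lambda>p. blinfun_apply (D p) k)"
  using D_cont by (intro continuous_intros) auto

lemma D_apply_borel [measurable]: "(\<lambda>p. blinfun_apply (D p) k) \<in> borel_measurable borel"
  by (rule borel_measurable_continuous_onI[OF D_apply_cont])

definition Md where "Md = (SOME C. 0 \<le> C \<and> (\<forall>p. norm (D p) \<le> C))"

lemma Md: "0 \<le> Md" "norm (D p) \<le> Md"
proof -
  have "compact ((\<lambda>p. norm (D p)) ` K)"
    by (intro compact_continuous_image continuous_on_norm continuous_on_subset[OF D_cont] K(1)) auto
  then obtain C where "\<forall>y\<in>(\<lambda>p. norm (D p)) ` K. norm y \<le> C"
    using compact_imp_bounded bounded_iff by metis
  then have C: "norm (D x) \<le> C" if "x \<in> K" for x using that by auto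
  have "norm (D p) \<le> max 0 C" for p
    using C[of p] D_outside[of p] by (cases "p \<in> K") auto
  then have "\<exists>C. 0 \<le> C \<and> (\<forall>p. norm (D p) \<le> C)" by (intro exI[of _ "max 0 C"]) auto
  from someI_ex[OF this] have "0 \<le> Md \<and> (\<forall>p. norm (D p) \<le> Md)" unfolding Md_def .
  then show "0 \<le> Md" "norm (D p) \<le> Md" by blast+
qed

lemma D_apply_bound: "\<bar>blinfun_apply (D p) k\<bar> \<le> Md * norm k"
  using norm_blinfun[of "D p" k] mult_right_mono[OF Md(2)[of p], of "norm k"] by simp

lemma phi_lipschitz: "\<bar>\<phi> p - \<phi> q\<bar> \<le> Md * norm (p - q)"
proof -
  have "norm (\<phi> p - \<phi> q) \<le> Md * norm (p - q)"
    by (rule differentiable_bound[of UNIV \<phi> "\<lambda>p. blinfun_apply (D p)"])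
       (use D Md(2) in \<open>auto simp: norm_blinfun.rep_eq[symmetric]\<close>)
  then show ?thesis by simp
qed

lemma phi_bounded: "\<exists>C. \<forall>p. \<bar>\<phi> p\<bar> \<le> C"
proof -
  have "compact (\<phi> ` K)"
    by (intro compact_continuous_image continuous_on_subset[OF phi_cont] K(1)) auto
  then obtain C where "\<forall>y\<in>\<phi> ` K. norm y \<le> C"
    using compact_imp_bounded bounded_iff by metis
  then have C: "\<bar>\<phi> x\<bar> \<le> C" if "x \<in> K" for x using that by auto
  have "\<bar>\<phi> p\<bar> \<le> max 0 C" for p
    using C[of p] outside[of p] by (cases "p \<in> K") auto
  then show ?thesis by blast
qed

text \<open>Two points at distance less than 1 either both lie in the compact ball of radius
  \<open>R + 1\<close>, where \<open>D\<close> is uniformly continuous, or both lie beyond radius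
  \<open>R\<close>, where \<open>D\<close> vanishes.\<close>

lemma D_unif:
  assumes "e > 0"
  obtains d where "d > 0" "\<And>p q. dist q p < d \<Longrightarrow> norm (D q - D p) \<le> e"
proof -
  have "uniformly_continuous_on (cball 0 (R + 1)) D"
    by (rule compact_uniformly_continuous[OF continuous_on_subset[OF D_cont]]) auto
  then obtain d where d: "d > 0"
    "\<And>p q. p \<in> cball 0 (R+1) \<Longrightarrow> q \<in> cball 0 (R+1) \<Longrightarrow> dist q p < d \<Longrightarrow> dist (D q) (D p) < e"
    using assms unfolding uniformly_continuous_on_def by metis
  have "norm (D q - D p) \<le> e" if pq: "dist q p < min d 1" for p q
  proof (cases "p \<in> cball 0 (R+1) \<and> q \<in> cball 0 (R+1)")
    case True
    then show ?thesis using d(2)[of p q] pq by (simp add: dist_norm)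
  next
    case False
    have "\<bar>norm p - norm q\<bar> < 1" using norm_triangle_ineq3[of q p] pq by (simp add: dist_norm abs_minus_commute)
    then have "R < norm p" "R < norm q" using False by auto
    then show ?thesis using far(2) assms by simp
  qed
  with d(1) show ?thesis using that[of "min d 1"] by auto
qed

text \<open>A Taylor expansion whose remainder is uniform in the base point and in all directions of
  length at most \<open>H\<close>. It is needed along the space-time velocities
  \<open>(1, a v)\<close>, whose length is at most \<open>1 + S\<close>.\<close>

lemma difference_quotient:
  assumes e: "e > 0" and H: "0 \<le> H"
  obtains \<tau>0 where "\<tau>0 > 0" "\<tau>0 \<le> 1"
    "\<And>\<tau> k p. 0 \<le> \<tau> \<Longrightarrow> \<tau> \<le> \<tau>0 \<Longrightarrow> norm k \<le> H \<Longrightarrow> \<bar>\<phi> (p + \<tau> *\<^sub>R k) - \<phi> p - \<tau> * blinfun_apply (D p) k\<bar> \<le> e * \<tau>"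
proof -
  obtain d where d: "d > 0" "\<And>p q. dist q p < d \<Longrightarrow> norm (D q - D p) \<le> e / (H + 1)"
    using D_unif[of "e / (H + 1)"] e H by (metis add_nonneg_pos divide_pos_pos zero_less_one)
  define \<tau>0 where "\<tau>0 = min 1 (d / (2 * (H + 1)))"
  have \<tau>0: "\<tau>0 > 0" "\<tau>0 \<le> 1" using d H by (auto simp: \<tau>0_def)
  have "\<bar>\<phi> (p + \<tau> *\<^sub>R k) - \<phi> p - \<tau> * blinfun_apply (D p) k\<bar> \<le> e * \<tau>"
    if \<tau>: "0 \<le> \<tau>" "\<tau> \<le> \<tau>0" and k: "norm k \<le> H" for \<tau> k p
  proof -
    have "\<tau> * norm k \<le> \<tau> * (H + 1)" using \<tau> k by (intro mult_left_mono) auto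
    also have "\<dots> \<le> d / (2 * (H + 1)) * (H + 1)" using \<tau> H by (intro mult_right_mono) (auto simp: \<tau>0_def)
    also have "\<dots> = d / 2"
    proof -
      have "d / (2 * c) * c = d / 2" if "c > 0" for c using that by simp
      from this[of "H + 1"] show ?thesis using H by linarith
    qed
    also have "\<dots> < d" using d by simp
    finally have tk: "\<tau> * norm k < d" .
    define X where "X = (\<lambda>s. p + s *\<^sub>R (\<tau> *\<^sub>R k)) ` {0..1}"
    have near: "norm (D x - D p) \<le> e / (H + 1)" if xX: "x \<in> X" for x
    proof (rule d(2))
      obtain s where s: "s \<in> {0..1}" "x = p + s *\<^sub>R (\<tau> *\<^sub>R k)" using xX unfolding X_def by blast
      have "dist x p = s * (\<tau> * norm k)" using s \<tau> by (simp add: dist_norm)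
      also have "\<dots> \<le> 1 * (\<tau> * norm k)" using s \<tau> by (intro mult_right_mono) auto
      finally show "dist x p < d" using tk by simp
    qed
    have "norm (\<phi> (p + \<tau> *\<^sub>R k) - \<phi> p - blinfun_apply (D p) (p + \<tau> *\<^sub>R k - p)) \<le> norm (p + \<tau> *\<^sub>R k - p) * (e / (H + 1))"
    proof (rule differentiable_bound_linearization[where S=X])
      show "p + t *\<^sub>R (p + \<tau> *\<^sub>R k - p) \<in> X" if "t \<in> {0..1}" for t using that by (auto simp: X_def)
      show "(\<phi> has_derivative blinfun_apply (D x)) (at x within X)" for x
        by (rule has_derivative_at_withinI[OF D])
      show "p \<in> X" unfolding X_def by (intro image_eqI[of _ _ 0]) auto
      show "onorm (blinfun_apply (D x) - blinfun_apply (D p)) \<le> e / (H + 1)" if "x \<in> X" for x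
        using near[OF that] by (simp add: norm_blinfun.rep_eq minus_blinfun.rep_eq fun_diff_def)
    qed
    also have "norm (p + \<tau> *\<^sub>R k - p) * (e / (H + 1)) = \<tau> * (norm k * (e / (H + 1)))" using \<tau> by simp
    also have "\<dots> \<le> \<tau> * e"
    proof (rule mult_left_mono)
      have "norm k * (e / (H + 1)) \<le> (H + 1) * (e / (H + 1))" using k e H by (intro mult_right_mono) auto
      then show "norm k * (e / (H + 1)) \<le> e" using H by simp
    qed (use \<tau> in auto)
    finally show ?thesis by (simp add: blinfun.scaleR_right mult.commute)
  qed
  with \<tau>0 show ?thesis using that by blast
qed

end

section \<open>The approximate entropy inequality of the scheme\<close>

locale collapse_test = collapse_entropy a B S \<eta> e' Q + c1_test \<phi> D K h
  for a :: "real \<Rightarrow> 'a::euclidean_space" and B S \<eta> e' Q and \<phi> :: "real \<times> 'a \<Rightarrow> real"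
    and D :: "real \<times> 'a \<Rightarrow> (real \<times> 'a) \<Rightarrow>\<^sub>L real" and K h +
  assumes sign: "(\<forall>p. 0 \<le> \<phi> p) \<or> (\<forall>v. e' v = 1)"
begin

text \<open>The entropy is normalised to vanish at \<open>-B\<close>. It then equals the integral of
  \<open>e'\<close> over the levels of the slab below \<open>w x\<close>, so that \<open>Phi\<close>
  becomes linear in the kinetic density; \<open>jint\<close> normalises the flux in the same
  way.\<close>

definition Phi where "Phi w t = (\<integral>x. (\<eta> (w x) - \<eta> (-B)) * \<phi> (t, x) \<partial>lborel)"

definition jint where "jint w t x = (\<eta> (w x) - \<eta> (-B)) * blinfun_apply (D (t, x)) (1, 0)
   + blinfun_apply (D (t, x)) (0, Q (w x) - Q (-B))"

definition J where "J w t = (\<integral>x. jint w t x \<partial>lborel)"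

text \<open>The kinetic density: \<open>e'\<close> on the part of the slab lying below the graph of
  \<open>u\<close>. Both \<open>Phi\<close> and \<open>J\<close> are integrals against it, of the
  test function and of its derivative along \<open>(1, a v)\<close>.\<close>

definition wgt :: "('a \<Rightarrow> real) \<Rightarrow> 'a \<times> real \<Rightarrow> real" where
  "wgt u p = slab (snd p) * e' (snd p) * (if snd p < u (fst p) then 1 else 0)"

lemma wgt_borel [measurable]:
  assumes [measurable]: "u \<in> borel_measurable borel"
  shows "wgt u \<in> borel_measurable borel"
  unfolding wgt_def[abs_def] borel_prod[symmetric] by measurable

lemma wgt_bound: "\<bar>wgt u p\<bar> \<le> M"
  using e'_bound[of "snd p"] M_nonneg by (auto simp: wgt_def split: split_indicator)

lemma wgt_zero: "B < \<bar>snd p\<bar> \<Longrightarrow> wgt u p = 0"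
  by (auto simp: wgt_def split: split_indicator)

lemma slice_borel [measurable]: "(\<lambda>x. \<phi> (t, x)) \<in> borel_measurable borel"
  by (rule measurable_compose[OF _ phi_borel, of "\<lambda>x. (t, x)"])
     (auto intro!: borel_measurable_continuous_onI continuous_intros)

lemma D_slice_borel [measurable]: "(\<lambda>x. blinfun_apply (D (t, x)) k) \<in> borel_measurable borel"
  by (rule measurable_compose[OF _ D_apply_borel, of "\<lambda>x. (t, x)"])
     (auto intro!: borel_measurable_continuous_onI continuous_intros)

text \<open>This is the case \<open>\<tau> = 0\<close> of \<open>collapse_transfer\<close>.\<close>

lemma Phi_eq:
  assumes [measurable]: "u \<in> borel_measurable borel" and u: "\<And>x. \<bar>u x\<bar> \<le> B"
  shows "Phi u t = (\<integral>p. wgt u p * \<phi> (t, fst p) \<partial>lborel)"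
    and "integrable lborel (\<lambda>p. wgt u p * \<phi> (t, fst p))"
    and "integrable lborel (\<lambda>x. (\<eta> (u x) - \<eta> (-B)) * \<phi> (t, x))"
proof -
  obtain C where C: "\<And>p. \<bar>\<phi> p\<bar> \<le> C" using phi_bounded by blast
  note ct = collapse_transfer[of u "\<lambda>x. \<phi> (t, x)" C R 0, OF _ _ C far_snd(1), simplified]
  show "integrable lborel (\<lambda>p. wgt u p * \<phi> (t, fst p))" using ct(3) by (simp add: wgt_def)
  show "integrable lborel (\<lambda>x. (\<eta> (u x) - \<eta> (-B)) * \<phi> (t, x))"
    using ct(2) by (simp add: eta_integral[OF u] mult.commute[of _ "\<phi> _"])
  show "Phi u t = (\<integral>p. wgt u p * \<phi> (t, fst p) \<partial>lborel)"
    using ct(1) by (simp add: eta_integral[OF u] mult.commute[of "\<phi> _"] wgt_def Phi_def)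
qed

text \<open>Collapsing lowers the normalised entropy at each point, which for
  \<open>\<phi> \<ge> 0\<close> may be multiplied by the test function. For \<open>e' = 1\<close>
  the collapse preserves mass exactly, so the pointwise relation is an equality and tolerates either
  sign of \<open>\<phi>\<close>.\<close>

lemma Phi_collapse_le:
  assumes [measurable]: "u \<in> borel_measurable borel" and \<tau>: "0 \<le> \<tau>" "\<tau> \<le> 1"
  shows "Phi (T \<tau> u) t \<le> (\<integral>p. wgt u p * \<phi> (t, fst p + \<tau> *\<^sub>R a (snd p)) \<partial>lborel)"
    and "integrable lborel (\<lambda>p. wgt u p * \<phi> (t, fst p + \<tau> *\<^sub>R a (snd p)))"
proof -
  obtain C where C: "\<And>p. \<bar>\<phi> p\<bar> \<le> C" using phi_bounded by blast
  note ct = collapse_transfer[of u "\<lambda>x. \<phi> (t, x)" C R \<tau>, OF _ _ C far_snd(1) \<tau>, simplified]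
  show "integrable lborel (\<lambda>p. wgt u p * \<phi> (t, fst p + \<tau> *\<^sub>R a (snd p)))" using ct(3) by (simp add: wgt_def)
  have "Phi (T \<tau> u) t \<le> (\<integral>x. \<phi> (t, x) * (\<integral>v. slab v * e' v * (if v < u (x - \<tau> *\<^sub>R a v) then 1 else 0) \<partial>lborel) \<partial>lborel)"
    unfolding Phi_def
  proof (rule integral_mono)
    show "integrable lborel (\<lambda>x. (\<eta> (T \<tau> u x) - \<eta> (-B)) * \<phi> (t, x))"
      by (rule Phi_eq(3)) (auto intro: T_range)
    show "integrable lborel (\<lambda>x. \<phi> (t, x) * (\<integral>v. slab v * e' v * (if v < u (x - \<tau> *\<^sub>R a v) then 1 else 0) \<partial>lborel))"
      using ct(2) by simp
    fix x
    show "(\<eta> (T \<tau> u x) - \<eta> (-B)) * \<phi> (t, x)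
       \<le> \<phi> (t, x) * (\<integral>v. slab v * e' v * (if v < u (x - \<tau> *\<^sub>R a v) then 1 else 0) \<partial>lborel)"
      using sign
    proof
      assume "\<forall>p. 0 \<le> \<phi> p"
      then show ?thesis using mult_right_mono[OF eta_collapse_le, of u "\<phi> (t, x)" \<tau> x] by (simp add: mult.commute)
    next
      assume e1: "\<forall>v. e' v = 1"
      have "\<bar>T \<tau> u x\<bar> \<le> B" by (rule T_range) auto
      from eta_integral[OF this] have "\<eta> (T \<tau> u x) - \<eta> (-B) = T \<tau> u x + B"
        using integral_slab_less[OF \<open>\<bar>T \<tau> u x\<bar> \<le> B\<close>] e1 by simp
      then show ?thesis using e1 by (simp add: tc_def mult.commute)
    qed
  qed
  also have "\<dots> = (\<integral>p. wgt u p * \<phi> (t, fst p + \<tau> *\<^sub>R a (snd p)) \<partial>lborel)"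
    using ct(1) by (simp add: wgt_def)
  finally show "Phi (T \<tau> u) t \<le> (\<integral>p. wgt u p * \<phi> (t, fst p + \<tau> *\<^sub>R a (snd p)) \<partial>lborel)" .
qed

lemma D_pair: "blinfun_apply (D p) (1, g) = blinfun_apply (D p) (1, 0) + blinfun_apply (D p) (0, g)"
  by (simp flip: blinfun.add_right)

lemma wgt_D_integrable:
  assumes [measurable]: "u \<in> borel_measurable borel"
  shows "integrable lborel (\<lambda>p. wgt u p * blinfun_apply (D (t, fst p)) (c, a (snd p)))"
proof (rule integrable_bounded_support[where C="M * (Md * (\<bar>c\<bar> + S))" and R="R + B"])
  \<comment> \<open>The derivative is applied to a vector that itself varies with \<open>p\<close>;
    expanding the vector in the basis reduces measurability to that of finitely many scalar
    functions.\<close>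
  have "(\<lambda>p. blinfun_apply (D (t, fst p)) (c, a (snd p)))
     = (\<lambda>p. c * blinfun_apply (D (t, fst p)) (1, 0) + (\<Sum>b\<in>Basis. (a (snd p) \<bullet> b) * blinfun_apply (D (t, fst p)) (0, b)))"
  proof
    fix p :: "'a \<times> real"
    have "(c, a (snd p)) = c *\<^sub>R (1, 0) + (\<Sum>b\<in>Basis. (a (snd p) \<bullet> b) *\<^sub>R (0, b))"
      by (simp add: prod_eq_iff fst_sum snd_sum euclidean_representation)
    then show "blinfun_apply (D (t, fst p)) (c, a (snd p))
      = c * blinfun_apply (D (t, fst p)) (1, 0) + (\<Sum>b\<in>Basis. (a (snd p) \<bullet> b) * blinfun_apply (D (t, fst p)) (0, b))"
      by (simp only: blinfun.add_right blinfun.scaleR_right blinfun.sum_right real_scaleR_def)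
  qed
  moreover have "(\<lambda>p. c * blinfun_apply (D (t, fst p)) (1, 0) + (\<Sum>b\<in>Basis. (a (snd p) \<bullet> b) * blinfun_apply (D (t, fst p)) (0, b)))
     \<in> borel_measurable (borel \<Otimes>\<^sub>M borel :: ('a \<times> real) measure)" by measurable
  ultimately have [measurable]: "(\<lambda>p. blinfun_apply (D (t, fst p)) (c, a (snd p))) \<in> borel_measurable (borel :: ('a \<times> real) measure)"
    by (simp add: borel_prod)
  show "(\<lambda>p. wgt u p * blinfun_apply (D (t, fst p)) (c, a (snd p))) \<in> borel_measurable borel" by measurable
  fix p :: "'a \<times> real"
  show "\<bar>wgt u p * blinfun_apply (D (t, fst p)) (c, a (snd p))\<bar> \<le> M * (Md * (\<bar>c\<bar> + S))"
  proof (cases "\<bar>snd p\<bar> \<le> B")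
    case True
    have "\<bar>blinfun_apply (D (t, fst p)) (c, a (snd p))\<bar> \<le> Md * norm (c, a (snd p))" by (rule D_apply_bound)
    also have "\<dots> \<le> Md * (\<bar>c\<bar> + S)"
      using norm_Pair_le[of c "a (snd p)"] a_bound[OF True] Md(1) by (intro mult_left_mono) auto
    finally show ?thesis using mult_mono[OF wgt_bound[of u p], of _ "Md * (\<bar>c\<bar> + S)"] M_nonneg
      by (simp add: abs_mult)
  next
    case False
    then show ?thesis using M_nonneg Md(1) S_nonneg by (simp add: wgt_zero)
  qed
next
  fix p :: "'a \<times> real" assume p: "R + B < norm p"
  have "norm p \<le> norm (fst p) + \<bar>snd p\<bar>" using norm_Pair_le[of "fst p" "snd p"] by simp
  then have "R < norm (fst p) \<or> B < \<bar>snd p\<bar>" using p by linarith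
  then show "wgt u p * blinfun_apply (D (t, fst p)) (c, a (snd p)) = 0"
    using far_snd(2)[of "fst p" t] wgt_zero[of p u] by auto
qed

text \<open>At a fixed point the derivative is linear in its flux argument and therefore commutes
  with the integral over \<open>v\<close> that represents \<open>Q (u x) - Q (-B)\<close>.\<close>

lemma jint_eq:
  assumes [measurable]: "u \<in> borel_measurable borel" and u: "\<And>x. \<bar>u x\<bar> \<le> B"
  shows "jint u t x = (\<integral>v. wgt u (x, v) * blinfun_apply (D (t, x)) (1, a v) \<partial>lborel)"
proof -
  define k where "k v = slab v * e' v * (if v < u x then 1 else 0)" for v
  have ki: "integrable lborel k"
    unfolding k_def using integrable_slab[of "\<lambda>v. e' v * (if v < u x then 1 else 0)" M] e'_bound M_nonneg
    by (auto simp: mult.assoc)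
  have kv: "(\<integral>v. k v \<partial>lborel) = \<eta> (u x) - \<eta> (-B)" unfolding k_def by (rule eta_integral[OF u])
  have Qi: "integrable lborel (\<lambda>v. k v *\<^sub>R a v)" "(\<integral>v. k v *\<^sub>R a v \<partial>lborel) = Q (u x) - Q (-B)"
    unfolding k_def by (rule Q_integral[OF u])+
  have bl: "bounded_linear (\<lambda>g. blinfun_apply (D (t, x)) (0, g))"
    by (intro bounded_linear_compose[OF blinfun.bounded_linear_right] bounded_linear_Pair bounded_linear_zero bounded_linear_ident)
  have i2: "integrable lborel (\<lambda>v. blinfun_apply (D (t, x)) (0, k v *\<^sub>R a v))"
    by (rule integrable_bounded_linear[OF bl Qi(1)])
  have eq: "blinfun_apply (D (t, x)) (0, k v *\<^sub>R a v) = k v * blinfun_apply (D (t, x)) (0, a v)" for v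
    by (metis blinfun.scaleR_right real_scaleR_def scaleR_Pair scaleR_zero_right)
  have "(\<integral>v. blinfun_apply (D (t, x)) (0, k v *\<^sub>R a v) \<partial>lborel) = blinfun_apply (D (t, x)) (0, Q (u x) - Q (-B))"
    using integral_bounded_linear[OF bl Qi(1)] Qi(2) by simp
  then have "jint u t x = (\<integral>v. k v * blinfun_apply (D (t, x)) (1, 0) \<partial>lborel) + (\<integral>v. k v * blinfun_apply (D (t, x)) (0, a v) \<partial>lborel)"
    using ki kv by (simp add: jint_def eq)
  also have "\<dots> = (\<integral>v. k v * blinfun_apply (D (t, x)) (1, 0) + k v * blinfun_apply (D (t, x)) (0, a v) \<partial>lborel)"
    using i2 ki by (intro Bochner_Integration.integral_add[symmetric]) (simp_all add: eq)
  also have "\<dots> = (\<integral>v. wgt u (x, v) * blinfun_apply (D (t, x)) (1, a v) \<partial>lborel)"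
    by (simp add: D_pair[of _ "a _"] ring_distribs k_def wgt_def)
  finally show ?thesis .
qed

lemma J_eq:
  assumes [measurable]: "u \<in> borel_measurable borel" and u: "\<And>x. \<bar>u x\<bar> \<le> B"
  shows "J u t = (\<integral>p. wgt u p * blinfun_apply (D (t, fst p)) (1, a (snd p)) \<partial>lborel)"
  unfolding J_def jint_eq[OF assms]
  using lborel_Fubini(1)[OF wgt_D_integrable[of u t 1]] by simp

definition C0 where "C0 = M * measure lborel (cball (0::'a \<times> real) (R + S + B))"

lemma C0_nonneg: "0 \<le> C0" by (simp add: C0_def M_nonneg)

text \<open>Once the displacement sits on the test function, the entropy increment is at most an
  integral of \<open>\<phi> (t + \<tau>, x + \<tau> *\<^sub>R a v) - \<phi> (t, x)\<close> against a
  weight bounded by \<open>M\<close>. The linear part is \<open>\<tau> * J u t\<close>. The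
  remainder is at most \<open>e * \<tau>\<close> pointwise and lives in the ball of radius
  \<open>R + S + B\<close>: support of \<open>\<phi>\<close>, displacement, slab. Hence
  \<open>C0\<close>.\<close>

lemma step_inequality:
  assumes e: "e > 0"
  obtains \<tau>0 where "\<tau>0 > 0" "\<tau>0 \<le> 1"
    "\<And>\<tau> u t. 0 \<le> \<tau> \<Longrightarrow> \<tau> \<le> \<tau>0 \<Longrightarrow> u \<in> borel_measurable borel \<Longrightarrow> (\<And>x. \<bar>u x\<bar> \<le> B) \<Longrightarrow>
      Phi (T \<tau> u) (t + \<tau>) - Phi u t \<le> \<tau> * J u t + \<tau> * e * C0"
proof -
  obtain \<tau>0 where \<tau>0: "\<tau>0 > 0" "\<tau>0 \<le> 1" and dq: "\<And>\<tau> k p. 0 \<le> \<tau> \<Longrightarrow> \<tau> \<le> \<tau>0 \<Longrightarrow> norm k \<le> 1 + S \<Longrightarrow>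
      \<bar>\<phi> (p + \<tau> *\<^sub>R k) - \<phi> p - \<tau> * blinfun_apply (D p) k\<bar> \<le> e * \<tau>"
    using difference_quotient[OF e, of "1 + S"] S_nonneg by auto
  have "Phi (T \<tau> u) (t + \<tau>) - Phi u t \<le> \<tau> * J u t + \<tau> * e * C0"
    if \<tau>: "0 \<le> \<tau>" "\<tau> \<le> \<tau>0" and [measurable]: "u \<in> borel_measurable borel" and u: "\<And>x. \<bar>u x\<bar> \<le> B" for \<tau> u t
  proof -
    have \<tau>1: "\<tau> \<le> 1" using \<tau> \<tau>0 by simp
    define E where "E p = wgt u p * \<phi> (t + \<tau>, fst p + \<tau> *\<^sub>R a (snd p)) - wgt u p * \<phi> (t, fst p)
       - \<tau> * (wgt u p * blinfun_apply (D (t, fst p)) (1, a (snd p)))" for p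
    note i1 = Phi_collapse_le(2)[OF \<open>u \<in> borel_measurable borel\<close> \<tau>(1) \<tau>1, of "t + \<tau>"]
    note i2 = Phi_eq(2)[OF \<open>u \<in> borel_measurable borel\<close> u, of t]
    note i3 = wgt_D_integrable[OF \<open>u \<in> borel_measurable borel\<close>, of t 1]
    have Ei: "integrable lborel E" unfolding E_def[abs_def]
      by (intro Bochner_Integration.integrable_diff integrable_mult_right i1 i2 i3)
    have EI: "integral\<^sup>L lborel E = (\<integral>p. wgt u p * \<phi> (t + \<tau>, fst p + \<tau> *\<^sub>R a (snd p)) \<partial>lborel) - Phi u t - \<tau> * J u t"
      unfolding E_def[abs_def] Phi_eq(1)[OF \<open>u \<in> borel_measurable borel\<close> u] J_eq[OF \<open>u \<in> borel_measurable borel\<close> u]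
      using i1 i2 i3 by simp
    have "\<bar>\<integral>p. E p \<partial>lborel\<bar> \<le> (M * (e * \<tau>)) * measure lborel (cball (0::'a \<times> real) (R + S + B))"
    proof (rule integral_bounded_support)
      show "E \<in> borel_measurable borel" using Ei by auto
      fix p :: "'a \<times> real"
      have E: "E p = wgt u p * (\<phi> ((t, fst p) + \<tau> *\<^sub>R (1, a (snd p))) - \<phi> (t, fst p) - \<tau> * blinfun_apply (D (t, fst p)) (1, a (snd p)))"
        by (simp add: E_def algebra_simps)
      show "\<bar>E p\<bar> \<le> M * (e * \<tau>)"
      proof (cases "\<bar>snd p\<bar> \<le> B")
        case True
        have "norm (1::real, a (snd p)) \<le> 1 + S" using norm_Pair_le[of "1::real" "a (snd p)"] a_bound[OF True] by simp
        from dq[OF \<tau> this, of "(t, fst p)"] show ?thesis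
          unfolding E abs_mult using M_nonneg by (intro mult_mono wgt_bound) auto
      next
        case False
        then show ?thesis using M_nonneg e \<tau> by (simp add: E wgt_zero)
      qed
      assume p: "R + S + B < norm p"
      have "norm p \<le> norm (fst p) + \<bar>snd p\<bar>" using norm_Pair_le[of "fst p" "snd p"] by simp
      then have "B < \<bar>snd p\<bar> \<or> (R + S < norm (fst p) \<and> \<bar>snd p\<bar> \<le> B)" using p by linarith
      then show "E p = 0"
      proof
        assume "B < \<bar>snd p\<bar>" then show ?thesis by (simp add: E wgt_zero)
      next
        assume *: "R + S < norm (fst p) \<and> \<bar>snd p\<bar> \<le> B"
        have "norm (\<tau> *\<^sub>R a (snd p)) \<le> 1 * S"
          using mult_mono[OF \<tau>1 a_bound, of "snd p"] * \<tau> by simp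
        then have "R < norm (fst p + \<tau> *\<^sub>R a (snd p))"
          using * norm_triangle_ineq2[of "fst p" "- (\<tau> *\<^sub>R a (snd p))"] by simp
        then show ?thesis using * far_snd S_nonneg by (simp add: E_def)
      qed
    qed
    then have "integral\<^sup>L lborel E \<le> \<tau> * e * C0" by (simp add: C0_def mult_ac abs_le_iff)
    then show ?thesis
      using EI Phi_collapse_le(1)[OF \<open>u \<in> borel_measurable borel\<close> \<tau>(1) \<tau>1, of "t + \<tau>"] by linarith
  qed
  with \<tau>0 show ?thesis using that by blast
qed

end

lemma joint_compose:
  fixes V :: "real \<Rightarrow> 'a::euclidean_space \<Rightarrow> real"
  assumes "(\<lambda>p. V (fst p) (snd p)) \<in> borel_measurable borel" "f \<in> borel_measurable N" "g \<in> borel_measurable N"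
  shows "(\<lambda>w. V (f w) (g w)) \<in> borel_measurable N"
proof -
  have "(\<lambda>w. (f w, g w)) \<in> measurable N borel"
    using assms(2,3) by (simp add: borel_prod[symmetric])
  from measurable_compose[OF this assms(1)] show ?thesis by simp
qed

context c1_test
begin

lemma D_comp [measurable]:
  assumes "f \<in> borel_measurable N" "g \<in> borel_measurable N"
  shows "(\<lambda>w. blinfun_apply (D (f w, g w)) k) \<in> borel_measurable N"
proof -
  have "(\<lambda>w. (f w, g w)) \<in> measurable N borel"
    using assms by (simp add: borel_prod[symmetric])
  from measurable_compose[OF this D_apply_borel] show ?thesis .
qed

lemma phi_comp [measurable]:
  assumes "f \<in> borel_measurable N" "g \<in> borel_measurable N"
  shows "(\<lambda>w. \<phi> (f w, g w)) \<in> borel_measurable N"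
proof -
  have "(\<lambda>w. (f w, g w)) \<in> measurable N borel"
    using assms by (simp add: borel_prod[symmetric])
  from measurable_compose[OF this phi_borel] show ?thesis .
qed

lemma D_flux_comp [measurable]:
  assumes [measurable]: "f \<in> borel_measurable N" "g \<in> borel_measurable N" "k \<in> borel_measurable N"
  shows "(\<lambda>w. blinfun_apply (D (f w, g w)) (0, k w)) \<in> borel_measurable N"
proof -
  have eq: "blinfun_apply (D p) (0, x) = (\<Sum>b\<in>Basis. (x \<bullet> b) * blinfun_apply (D p) (0, b))" for p x
  proof -
    have "(0, x) = (\<Sum>b\<in>Basis. (x \<bullet> b) *\<^sub>R (0 :: real, b))"
      by (simp add: prod_eq_iff fst_sum snd_sum euclidean_representation)
    then show ?thesis by (simp only: blinfun.scaleR_right blinfun.sum_right real_scaleR_def)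
  qed
  show ?thesis by (subst eq) measurable
qed

end

context collapse_test
begin

lemma eta_diff_bound: "\<bar>s\<bar> \<le> B \<Longrightarrow> \<bar>\<eta> s - \<eta> (-B)\<bar> \<le> M * (2 * B)"
proof -
  assume s: "\<bar>s\<bar> \<le> B"
  have "\<bar>\<eta> s - \<eta> (-B)\<bar> \<le> M * \<bar>s - (-B)\<bar>" using s B_nonneg by (intro eta_lipschitz) auto
  also have "\<dots> \<le> M * (2 * B)" using s M_nonneg by (intro mult_left_mono) auto
  finally show ?thesis .
qed

lemma Q_diff_bound: "\<bar>s\<bar> \<le> B \<Longrightarrow> norm (Q s - Q (-B)) \<le> M * S * (2 * B)"
proof -
  assume s: "\<bar>s\<bar> \<le> B"
  have "norm (Q s - Q (-B)) \<le> M * S * \<bar>s - (-B)\<bar>" using s B_nonneg by (intro Q_lipschitz) auto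
  also have "\<dots> \<le> M * S * (2 * B)" using s M_nonneg S_nonneg by (intro mult_left_mono) auto
  finally show ?thesis .
qed

lemma jint_bound:
  assumes "\<And>x. \<bar>w x\<bar> \<le> B"
  shows "\<bar>jint w t x\<bar> \<le> M * (2 * B) * Md + Md * (M * S * (2 * B))"
proof -
  have "\<bar>(\<eta> (w x) - \<eta> (-B)) * blinfun_apply (D (t, x)) (1, 0)\<bar> \<le> M * (2 * B) * Md"
    unfolding abs_mult using D_apply_bound[of "(t,x)" "(1,0)"] M_nonneg B_nonneg
    by (intro mult_mono eta_diff_bound assms) (auto simp: norm_Pair)
  moreover have "\<bar>blinfun_apply (D (t, x)) (0, Q (w x) - Q (-B))\<bar> \<le> Md * (M * S * (2 * B))"
    using D_apply_bound[of "(t,x)" "(0, Q (w x) - Q (-B))"] mult_left_mono[OF Q_diff_bound[OF assms[of x]] Md(1)]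
    by (simp add: norm_Pair)
  ultimately show ?thesis unfolding jint_def by linarith
qed

lemma jint_zero: "R < norm x \<Longrightarrow> jint w t x = 0" "h \<le> t \<Longrightarrow> jint w t x = 0"
  by (simp_all add: jint_def far_snd late)

lemma jint_comp [measurable]:
  assumes "(\<lambda>p. V (fst p) (snd p)) \<in> borel_measurable borel" and [measurable]: "f \<in> borel_measurable N" "g \<in> borel_measurable N"
  shows "(\<lambda>w. jint (V (f w)) (f w) (g w)) \<in> borel_measurable N"
proof -
  have [measurable]: "(\<lambda>w. V (f w) (g w)) \<in> borel_measurable N" by (rule joint_compose) fact+
  show ?thesis unfolding jint_def by measurable
qed

lemma integrable_J_product:
  assumes V: "(\<lambda>p. V (fst p) (snd p)) \<in> borel_measurable borel" and b: "\<And>t x. \<bar>V t x\<bar> \<le> B"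
  shows "integrable lborel (\<lambda>p. indicator {0..h} (fst p) * jint (V (fst p)) (fst p) (snd p))"
    and "integrable lborel (\<lambda>t. indicator {0..h} t * J (V t) t)"
    and "(\<integral>p. indicator {0..h} (fst p) * jint (V (fst p)) (fst p) (snd p) \<partial>lborel) = (\<integral>t. indicator {0..h} t * J (V t) t \<partial>lborel)"
proof -
  show i: "integrable lborel (\<lambda>p. indicator {0..h} (fst p) * jint (V (fst p)) (fst p) (snd p))"
  proof (rule integrable_bounded_support[where R="h + R" and C="M * (2 * B) * Md + Md * (M * S * (2 * B))"])
    have [measurable]: "fst \<in> borel_measurable (borel :: (real \<times> 'a) measure)" "snd \<in> borel_measurable (borel :: (real \<times> 'a) measure)"
      by (auto intro!: borel_measurable_continuous_onI continuous_intros)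
    show "(\<lambda>p. indicator {0..h} (fst p) * jint (V (fst p)) (fst p) (snd p)) \<in> borel_measurable borel"
      using V by measurable
    show "\<bar>indicator {0..h} (fst p) * jint (V (fst p)) (fst p) (snd p)\<bar> \<le> M * (2 * B) * Md + Md * (M * S * (2 * B))" for p
      using jint_bound[of "V (fst p)" "fst p" "snd p", OF b] by (auto split: split_indicator)
    fix p :: "real \<times> 'a" assume p: "h + R < norm p"
    have "norm p \<le> \<bar>fst p\<bar> + norm (snd p)" using norm_Pair_le[of "fst p" "snd p"] by simp
    then have "h < \<bar>fst p\<bar> \<or> R < norm (snd p)" using p by linarith
    then show "indicator {0..h} (fst p) * jint (V (fst p)) (fst p) (snd p) = 0"
      using jint_zero(1)[of "snd p" "V (fst p)" "fst p"] by (auto split: split_indicator)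
  qed
  show "integrable lborel (\<lambda>t. indicator {0..h} t * J (V t) t)"
    using lborel_Fubini(3)[OF i] by (simp add: J_def)
  show "(\<integral>p. indicator {0..h} (fst p) * jint (V (fst p)) (fst p) (snd p) \<partial>lborel) = (\<integral>t. indicator {0..h} t * J (V t) t \<partial>lborel)"
    using lborel_Fubini(1)[OF i] by (simp add: J_def)
qed

definition C1 where "C1 = M * (2 * B) * Md * measure lborel (cball (0::'a) R)"

lemma C1_nonneg: "0 \<le> C1" by (simp add: C1_def M_nonneg B_nonneg Md)

text \<open>The scheme stays at its initial datum throughout the first time step, where only the
  test function moves; it does so at rate at most \<open>Md\<close>.\<close>

lemma Phi_initial:
  assumes [measurable]: "u \<in> borel_measurable borel" and u: "\<And>x. \<bar>u x\<bar> \<le> B" and t: "0 \<le> t"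
  shows "Phi u t \<le> Phi u 0 + t * C1"
proof -
  note i = Phi_eq(3)[OF assms(1,2)]
  have "Phi u t - Phi u 0 = (\<integral>x. (\<eta> (u x) - \<eta> (-B)) * (\<phi> (t, x) - \<phi> (0, x)) \<partial>lborel)"
    unfolding Phi_def using i by (simp add: right_diff_distrib)
  moreover have "\<bar>\<integral>x. (\<eta> (u x) - \<eta> (-B)) * (\<phi> (t, x) - \<phi> (0, x)) \<partial>lborel\<bar> \<le> (M * (2 * B) * (Md * t)) * measure lborel (cball (0::'a) R)"
  proof (rule integral_bounded_support)
    show "\<bar>(\<eta> (u x) - \<eta> (-B)) * (\<phi> (t, x) - \<phi> (0, x))\<bar> \<le> M * (2 * B) * (Md * t)" for x
      unfolding abs_mult using phi_lipschitz[of "(t, x)" "(0, x)"] M_nonneg B_nonneg t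
      by (intro mult_mono eta_diff_bound u) (auto simp: norm_Pair)
  qed (auto simp: far_snd)
  ultimately show ?thesis by (simp add: C1_def mult_ac abs_le_iff)
qed

text \<open>The relation \<open>V (t + \<tau>) = T \<tau> (V t)\<close> holds at every
  \<open>t \<ge> 0\<close>, so the step inequality can be integrated in \<open>t\<close> instead of
  being summed over grid points. The telescoping sum becomes a shift of the integral, which leaves
  the first layer of length \<open>\<tau>\<close>; dividing by \<open>\<tau>\<close> produces the
  initial term.\<close>

lemma entropy_approx:
  assumes e: "e > 0"
  obtains \<tau>0 where "\<tau>0 > 0"
    "\<And>\<tau> V u0. 0 < \<tau> \<Longrightarrow> \<tau> \<le> \<tau>0 \<Longrightarrow> (\<lambda>p. V (fst p) (snd p)) \<in> borel_measurable borel \<Longrightarrow> (\<And>t x. \<bar>V t x\<bar> \<le> B)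
      \<Longrightarrow> (\<And>t. 0 \<le> t \<Longrightarrow> V (t + \<tau>) = T \<tau> (V t)) \<Longrightarrow> (\<And>t. 0 \<le> t \<Longrightarrow> t < \<tau> \<Longrightarrow> V t = u0)
      \<Longrightarrow> - Phi u0 0 - \<tau> * C1 \<le> (\<integral>t. indicator {0..h} t * J (V t) t \<partial>lborel) + h * e * C0"
proof -
  show ?thesis
  proof (rule step_inequality[OF e])
    fix \<tau>0 assume \<tau>0: "\<tau>0 > 0" and step: "\<And>\<tau> u t. 0 \<le> \<tau> \<Longrightarrow> \<tau> \<le> \<tau>0 \<Longrightarrow> u \<in> borel_measurable borel \<Longrightarrow> (\<And>x. \<bar>u x\<bar> \<le> B) \<Longrightarrow>
        Phi (T \<tau> u) (t + \<tau>) - Phi u t \<le> \<tau> * J u t + \<tau> * e * C0"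
    have "- Phi u0 0 - \<tau> * C1 \<le> (\<integral>t. indicator {0..h} t * J (V t) t \<partial>lborel) + h * e * C0"
      if \<tau>: "0 < \<tau>" "\<tau> \<le> \<tau>0" and V: "(\<lambda>p. V (fst p) (snd p)) \<in> borel_measurable borel" and b: "\<And>t x. \<bar>V t x\<bar> \<le> B"
        and shift: "\<And>t. 0 \<le> t \<Longrightarrow> V (t + \<tau>) = T \<tau> (V t)" and init: "\<And>t. 0 \<le> t \<Longrightarrow> t < \<tau> \<Longrightarrow> V t = u0" for \<tau> V u0
    proof -
      note [measurable] = joint_compose[OF V]
      have u0[measurable]: "u0 \<in> borel_measurable borel"
      proof -
        have "V 0 \<in> borel_measurable borel" by measurable
        then show ?thesis using init[of 0] \<tau> by simp
      qed
      have u0b: "\<bar>u0 x\<bar> \<le> B" for x using init[of 0] \<tau> b[of 0 x] by simp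
      have Vb[measurable]: "V t \<in> borel_measurable borel" for t by measurable
      define P where "P t = Phi (V t) t" for t
      have [measurable]: "P \<in> borel_measurable borel" unfolding P_def Phi_def by measurable
      obtain C where C: "\<And>p. \<bar>\<phi> p\<bar> \<le> C" using phi_bounded by blast
      have Pb: "\<bar>P t\<bar> \<le> M * (2 * B) * C * measure lborel (cball (0::'a) R)" for t
        unfolding P_def Phi_def
      proof (rule integral_bounded_support)
        show "\<bar>(\<eta> (V t x) - \<eta> (-B)) * \<phi> (t, x)\<bar> \<le> M * (2 * B) * C" for x
          unfolding abs_mult using M_nonneg B_nonneg by (intro mult_mono eta_diff_bound b C) auto
      qed (auto simp: far_snd)
      have P0: "P t = 0" if "h \<le> t" for t using that by (simp add: P_def Phi_def late)
      have Pi: "integrable lborel (\<lambda>t. indicator A t * P t)" if [measurable]: "A \<in> sets borel" and A: "A \<subseteq> {0..}" for A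
      proof (rule integrable_bounded_support[where R=h and C="M * (2 * B) * C * measure lborel (cball (0::'a) R)"])
        show "\<bar>indicator A t * P t\<bar> \<le> M * (2 * B) * C * measure lborel (cball (0::'a) R)" for t
          using Pb[of t] order_trans[OF abs_ge_zero Pb[of t]] by (cases "t \<in> A") auto
        show "indicator A t * P t = 0" if "h < norm t" for t
          using that A P0[of t] by (auto split: split_indicator)
      qed measurable
      have eq1: "(\<lambda>t. indicator {0..} t * P (t + \<tau>)) = (\<lambda>t. (\<lambda>s. indicator {\<tau>..} s * P s) (\<tau> + t))"
        by (auto simp: fun_eq_iff add.commute split: split_indicator)
      have i1: "integrable lborel (\<lambda>t. indicator {0..} t * P (t + \<tau>))"
        unfolding eq1 by (rule integrable_lborel_shift, rule Pi) (use \<tau> in auto)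
      have I1: "(\<integral>t. indicator {0..} t * P (t + \<tau>) \<partial>lborel) = (\<integral>t. indicator {\<tau>..} t * P t \<partial>lborel)"
        unfolding eq1 by (rule integral_lborel_shift) measurable
      have "(\<integral>t. indicator {0..} t * P t \<partial>lborel) = (\<integral>t. indicator {\<tau>..} t * P t + indicator {0..<\<tau>} t * P t \<partial>lborel)"
        using \<tau> by (intro Bochner_Integration.integral_cong) (auto split: split_indicator)
      also have "\<dots> = (\<integral>t. indicator {\<tau>..} t * P t \<partial>lborel) + (\<integral>t. indicator {0..<\<tau>} t * P t \<partial>lborel)"
        using \<tau> by (intro Bochner_Integration.integral_add Pi) auto
      \<comment> \<open>The shifted integral starts at \<open>\<tau>\<close>, so the difference is
        minus the integral over the initial layer; nothing comes from late times because
        \<open>P\<close> vanishes from \<open>h\<close> on.\<close>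
      finally have I2: "(\<integral>t. indicator {0..} t * P (t + \<tau>) - indicator {0..} t * P t \<partial>lborel) = - (\<integral>t. indicator {0..<\<tau>} t * P t \<partial>lborel)"
        using i1 Pi[of "{0..}"] I1 by simp
      have "(\<integral>t. indicator {0..<\<tau>} t * P t \<partial>lborel) \<le> (\<integral>t. indicator {0..<\<tau>} t * (Phi u0 0 + \<tau> * C1) \<partial>lborel)"
      proof (rule integral_mono)
        show "integrable lborel (\<lambda>t. indicator {0..<\<tau>} t * P t)" by (rule Pi) auto
        show "integrable lborel (\<lambda>t. indicator {0..<\<tau>} t * (Phi u0 0 + \<tau> * C1))"
          using \<tau> by (intro integrable_mult_left integrable_real_indicator) auto
        fix t
        show "indicator {0..<\<tau>} t * P t \<le> indicator {0..<\<tau>} t * (Phi u0 0 + \<tau> * C1)"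
        proof (cases "t \<in> {0..<\<tau>}")
          case True
          then have "P t \<le> Phi u0 0 + t * C1" using Phi_initial[OF u0 u0b, of t] init[of t] by (simp add: P_def)
          also have "\<dots> \<le> Phi u0 0 + \<tau> * C1" using True C1_nonneg by (simp add: mult_right_mono)
          finally show ?thesis using True by simp
        qed simp
      qed
      also have "\<dots> = \<tau> * (Phi u0 0 + \<tau> * C1)" using \<tau> by simp
      finally have lower: "- (\<tau> * (Phi u0 0 + \<tau> * C1)) \<le> (\<integral>t. indicator {0..} t * P (t + \<tau>) - indicator {0..} t * P t \<partial>lborel)"
        using I2 by simp
      note Ji = integrable_J_product(2)[OF V b]
      have ci: "integrable lborel (\<lambda>t. indicator {0..h} t * (e * C0))"
        using h_pos by (intro integrable_mult_left integrable_real_indicator) auto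
      have "(\<integral>t. indicator {0..} t * P (t + \<tau>) - indicator {0..} t * P t \<partial>lborel)
        \<le> (\<integral>t. \<tau> * (indicator {0..h} t * J (V t) t + indicator {0..h} t * (e * C0)) \<partial>lborel)"
      proof (rule integral_mono)
        show "integrable lborel (\<lambda>t. indicator {0..} t * P (t + \<tau>) - indicator {0..} t * P t)"
          by (intro Bochner_Integration.integrable_diff i1 Pi) auto
        show "integrable lborel (\<lambda>t. \<tau> * (indicator {0..h} t * J (V t) t + indicator {0..h} t * (e * C0)))"
          by (intro integrable_mult_right Bochner_Integration.integrable_add Ji ci)
        fix t
        show "indicator {0..} t * P (t + \<tau>) - indicator {0..} t * P t \<le> \<tau> * (indicator {0..h} t * J (V t) t + indicator {0..h} t * (e * C0))"
        proof (cases "0 \<le> t \<and> t \<le> h")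
          case True
          have "Phi (T \<tau> (V t)) (t + \<tau>) - Phi (V t) t \<le> \<tau> * J (V t) t + \<tau> * e * C0"
            using \<tau> by (intro step Vb b) auto
          then show ?thesis using True shift[of t] by (simp add: P_def algebra_simps)
        next
          case False
          then show ?thesis using P0[of t] P0[of "t + \<tau>"] \<tau> by (auto split: split_indicator)
        qed
      qed
      also have "\<dots> = \<tau> * ((\<integral>t. indicator {0..h} t * J (V t) t \<partial>lborel) + h * (e * C0))"
        using Ji ci h_pos by simp
      finally have "\<tau> * (- (Phi u0 0 + \<tau> * C1)) \<le> \<tau> * ((\<integral>t. indicator {0..h} t * J (V t) t \<partial>lborel) + h * (e * C0))"
        using lower by (simp only: mult_minus_right)
      then have "- (Phi u0 0 + \<tau> * C1) \<le> (\<integral>t. indicator {0..h} t * J (V t) t \<partial>lborel) + h * (e * C0)"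
        using \<tau>(1) by (rule mult_left_le_imp_le)
      then show ?thesis by (simp add: mult.assoc)
    qed
    with \<tau>0 show ?thesis by (rule that)
  qed
qed

definition C2 where "C2 = M * Md + Md * (M * S)"

lemma C2_nonneg: "0 \<le> C2" by (simp add: C2_def M_nonneg Md S_nonneg)

lemma jint_diff:
  assumes "\<And>x. \<bar>w x\<bar> \<le> B" "\<And>x. \<bar>w' x\<bar> \<le> B"
  shows "\<bar>jint w t x - jint w' t x\<bar> \<le> C2 * \<bar>w x - w' x\<bar>"
proof -
  have "jint w t x - jint w' t x = (\<eta> (w x) - \<eta> (w' x)) * blinfun_apply (D (t, x)) (1, 0)
     + blinfun_apply (D (t, x)) (0, Q (w x) - Q (w' x))"
  proof -
    have "(0::real, Q (w x) - Q (w' x)) = (0, Q (w x) - Q (-B)) - (0, Q (w' x) - Q (-B))" by simp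
    then have "blinfun_apply (D (t, x)) (0, Q (w x) - Q (w' x))
       = blinfun_apply (D (t, x)) (0, Q (w x) - Q (-B)) - blinfun_apply (D (t, x)) (0, Q (w' x) - Q (-B))"
      by (simp only: blinfun.diff_right)
    then show ?thesis by (simp add: jint_def algebra_simps)
  qed
  moreover have "\<bar>(\<eta> (w x) - \<eta> (w' x)) * blinfun_apply (D (t, x)) (1, 0)\<bar> \<le> (M * \<bar>w x - w' x\<bar>) * Md"
    unfolding abs_mult using D_apply_bound[of "(t,x)" "(1,0)"] M_nonneg
    by (intro mult_mono eta_lipschitz assms) (auto simp: norm_Pair)
  moreover have "\<bar>blinfun_apply (D (t, x)) (0, Q (w x) - Q (w' x))\<bar> \<le> Md * (M * S * \<bar>w x - w' x\<bar>)"
    using D_apply_bound[of "(t,x)" "(0, Q (w x) - Q (w' x))"] mult_left_mono[OF Q_lipschitz[OF assms, of x x] Md(1)]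
    by (simp add: norm_Pair)
  moreover have "C2 * \<bar>w x - w' x\<bar> = (M * \<bar>w x - w' x\<bar>) * Md + Md * (M * S * \<bar>w x - w' x\<bar>)"
    by (simp add: C2_def algebra_simps)
  ultimately show ?thesis by linarith
qed

lemma jint_integrable:
  assumes [measurable]: "w \<in> borel_measurable borel" and b: "\<And>x. \<bar>w x\<bar> \<le> B"
  shows "integrable lborel (jint w t)"
proof (rule integrable_bounded_support[where C="M * (2 * B) * Md + Md * (M * S * (2 * B))" and R=R])
  have "(\<lambda>x. jint w t x) \<in> borel_measurable borel" unfolding jint_def by measurable
  then show "jint w t \<in> borel_measurable borel" by simp
qed (auto intro: jint_bound b simp: jint_zero)

lemma J_diff:
  assumes [measurable]: "w \<in> borel_measurable borel" "w' \<in> borel_measurable borel"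
    and b: "\<And>x. \<bar>w x\<bar> \<le> B" "\<And>x. \<bar>w' x\<bar> \<le> B"
  shows "ennreal \<bar>J w t - J w' t\<bar> \<le> ennreal C2 * (\<integral>\<^sup>+x. indicator (cball 0 R) x * ennreal \<bar>w x - w' x\<bar> \<partial>lborel)"
proof -
  note i = jint_integrable[OF assms(1) b(1), of t] jint_integrable[OF assms(2) b(2), of t]
  have eq: "J w t - J w' t = (\<integral>x. jint w t x - jint w' t x \<partial>lborel)" unfolding J_def using i by simp
  have "ennreal \<bar>J w t - J w' t\<bar> \<le> (\<integral>\<^sup>+x. ennreal (norm (jint w t x - jint w' t x)) \<partial>lborel)"
    unfolding eq using integral_norm_bound_ennreal[OF Bochner_Integration.integrable_diff[OF i]] by simp
  also have "\<dots> \<le> (\<integral>\<^sup>+x. ennreal C2 * (indicator (cball 0 R) x * ennreal \<bar>w x - w' x\<bar>) \<partial>lborel)"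
  proof (intro nn_integral_mono)
    fix x
    show "ennreal (norm (jint w t x - jint w' t x)) \<le> ennreal C2 * (indicator (cball 0 R) x * ennreal \<bar>w x - w' x\<bar>)"
      using jint_diff[of w w' t x, OF b] C2_nonneg jint_zero(1)[of x]
      by (cases "R < norm x") (auto simp flip: ennreal_mult intro!: ennreal_leI)
  qed
  also have "\<dots> = ennreal C2 * (\<integral>\<^sup>+x. indicator (cball 0 R) x * ennreal \<bar>w x - w' x\<bar> \<partial>lborel)"
  proof (rule nn_integral_cmult)
    have [measurable]: "cball (0::'a) R \<in> sets borel" by simp
    show "(\<lambda>x. indicator (cball 0 R) x * ennreal \<bar>w x - w' x\<bar>) \<in> borel_measurable lborel" by simp
  qed
  finally show ?thesis .
qed

lemma entropy_limit:
  fixes V :: "nat \<Rightarrow> real \<Rightarrow> 'a \<Rightarrow> real"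
  assumes V: "\<And>n. (\<lambda>p. V n (fst p) (snd p)) \<in> borel_measurable borel" and b: "\<And>n t x. \<bar>V n t x\<bar> \<le> B"
    and shift: "\<And>n t. 0 \<le> t \<Longrightarrow> V n (t + \<tau> n) = T (\<tau> n) (V n t)" and init: "\<And>n t. 0 \<le> t \<Longrightarrow> t < \<tau> n \<Longrightarrow> V n t = u0"
    and \<tau>: "\<And>n. 0 < \<tau> n" "\<tau> \<longlonglongrightarrow> 0"
    and v: "(\<lambda>p. v (fst p) (snd p)) \<in> borel_measurable borel" "\<And>t x. \<bar>v t x\<bar> \<le> B"
    and conv: "\<And>e. e > 0 \<Longrightarrow> \<exists>N. \<forall>n\<ge>N. \<forall>t\<in>{0..h}. (\<integral>\<^sup>+x. indicator (cball 0 R) x * ennreal \<bar>V n t x - v t x\<bar> \<partial>lborel) \<le> ennreal e"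
  shows "0 \<le> (\<integral>p. indicator {0..h} (fst p) * jint (v (fst p)) (fst p) (snd p) \<partial>lborel) + Phi u0 0"
proof -
  have "- Phi u0 0 \<le> (\<integral>t. indicator {0..h} t * J (v t) t \<partial>lborel)"
  proof (rule field_le_epsilon)
    fix \<epsilon> :: real assume \<epsilon>: "\<epsilon> > 0"
    \<comment> \<open>Three errors are proportional to \<open>e\<close>: the Taylor remainder with
      \<open>C0 * h\<close>, the initial layer with \<open>C1\<close>, and the replacement of
      \<open>V n\<close> by its limit with \<open>C2 * h\<close>. The constant \<open>c\<close>
      dominates their sum and is positive.\<close>
    define c where "c = 3 * (C0 * h + C1 + C2 * h + 1)"
    have c: "c > 0" using C0_nonneg C1_nonneg C2_nonneg h_pos by (auto simp: c_def intro!: add_nonneg_pos add_nonneg_nonneg)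
    define e where "e = \<epsilon> / c"
    have e: "e > 0" using \<epsilon> c by (simp add: e_def)
    show "- Phi u0 0 \<le> (\<integral>t. indicator {0..h} t * J (v t) t \<partial>lborel) + \<epsilon>"
    proof (rule entropy_approx[OF e])
      fix \<tau>0 assume \<tau>0: "\<tau>0 > 0" and ap: "\<And>\<tau> V u0. 0 < \<tau> \<Longrightarrow> \<tau> \<le> \<tau>0 \<Longrightarrow> (\<lambda>p. V (fst p) (snd p)) \<in> borel_measurable borel \<Longrightarrow> (\<And>t x. \<bar>V t x\<bar> \<le> B)
        \<Longrightarrow> (\<And>t. 0 \<le> t \<Longrightarrow> V (t + \<tau>) = T \<tau> (V t)) \<Longrightarrow> (\<And>t. 0 \<le> t \<Longrightarrow> t < \<tau> \<Longrightarrow> V t = u0)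
        \<Longrightarrow> - Phi u0 0 - \<tau> * C1 \<le> (\<integral>t. indicator {0..h} t * J (V t) t \<partial>lborel) + h * e * C0"
      obtain N1 where N1: "\<And>n. n \<ge> N1 \<Longrightarrow> \<tau> n < min \<tau>0 e"
        using order_tendstoD(2)[OF \<tau>(2), of "min \<tau>0 e"] \<tau>0 e by (auto simp: eventually_sequentially)
      obtain N2 where N2: "\<And>n t. n \<ge> N2 \<Longrightarrow> t \<in> {0..h} \<Longrightarrow> (\<integral>\<^sup>+x. indicator (cball 0 R) x * ennreal \<bar>V n t x - v t x\<bar> \<partial>lborel) \<le> ennreal e"
        using conv[OF e] by blast
      define n where "n = max N1 N2"
      have \<tau>n: "\<tau> n \<le> \<tau>0" "\<tau> n \<le> e" using N1[of n] by (auto simp: n_def)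
      have 1: "- Phi u0 0 - \<tau> n * C1 \<le> (\<integral>t. indicator {0..h} t * J (V n t) t \<partial>lborel) + h * e * C0"
        by (rule ap[OF \<tau>(1) \<tau>n(1) V b shift init])
      note Ji = integrable_J_product(2)[OF V b, of n] integrable_J_product(2)[OF v]
      have ci: "integrable lborel (\<lambda>t. indicator {0..h} t * (C2 * e))"
        using h_pos by (intro integrable_mult_left integrable_real_indicator) auto
      have "(\<integral>t. indicator {0..h} t * J (V n t) t \<partial>lborel) \<le> (\<integral>t. indicator {0..h} t * J (v t) t + indicator {0..h} t * (C2 * e) \<partial>lborel)"
      proof (rule integral_mono)
        show "integrable lborel (\<lambda>t. indicator {0..h} t * J (v t) t + indicator {0..h} t * (C2 * e))"
          by (intro Bochner_Integration.integrable_add Ji ci)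
        fix t
        show "indicator {0..h} t * J (V n t) t \<le> indicator {0..h} t * J (v t) t + indicator {0..h} t * (C2 * e)"
        proof (cases "t \<in> {0..h}")
          case True
          have [measurable]: "V n t \<in> borel_measurable borel" "v t \<in> borel_measurable borel"
            using joint_compose[OF V, of "\<lambda>_. t" borel "\<lambda>x. x" n] joint_compose[OF v(1), of "\<lambda>_. t" borel "\<lambda>x. x"] by auto
          have "ennreal \<bar>J (V n t) t - J (v t) t\<bar> \<le> ennreal C2 * (\<integral>\<^sup>+x. indicator (cball 0 R) x * ennreal \<bar>V n t x - v t x\<bar> \<partial>lborel)"
            by (rule J_diff) (auto intro: b v)
          also have "\<dots> \<le> ennreal C2 * ennreal e" using N2[of n t] True by (intro mult_left_mono) (auto simp: n_def)
          also have "\<dots> = ennreal (C2 * e)" using C2_nonneg e by (simp add: ennreal_mult)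
          finally have "\<bar>J (V n t) t - J (v t) t\<bar> \<le> C2 * e" using C2_nonneg e by simp
          then show ?thesis using True by simp
        qed simp
      qed (rule Ji)
      also have "\<dots> = (\<integral>t. indicator {0..h} t * J (v t) t \<partial>lborel) + h * (C2 * e)" using Ji ci h_pos by simp
      finally have 2: "(\<integral>t. indicator {0..h} t * J (V n t) t \<partial>lborel) \<le> (\<integral>t. indicator {0..h} t * J (v t) t \<partial>lborel) + h * (C2 * e)" .
      have "\<tau> n * C1 \<le> e * C1" using \<tau>n C1_nonneg by (intro mult_right_mono)
      moreover have "e * C1 + h * (C2 * e) + h * e * C0 \<le> e * c"
        using e C0_nonneg C1_nonneg C2_nonneg h_pos by (simp add: c_def algebra_simps)
      moreover have "e * c = \<epsilon>" using c by (simp add: e_def)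
      ultimately show "- Phi u0 0 \<le> (\<integral>t. indicator {0..h} t * J (v t) t \<partial>lborel) + \<epsilon>"
        using 1 2 by linarith
    qed
  qed
  then show ?thesis using integrable_J_product(3)[OF v] by simp
qed

end

lemma (in collapse) T_top: "T \<tau> (\<lambda>_. B) = (\<lambda>_. B)"
  using integral_slab_less[of B] B_nonneg by (simp add: tc_def fun_eq_iff)

lemma c1_test_uminus:
  assumes "c1_test \<phi> D K h" shows "c1_test (\<lambda>p. - \<phi> p) (\<lambda>p. - D p) K h"
proof -
  interpret c1_test \<phi> D K h by fact
  show ?thesis
  proof
    show "continuous_on UNIV (\<lambda>p. - D p)" using D_cont by (intro continuous_intros)
    show "((\<lambda>p. - \<phi> p) has_derivative blinfun_apply (- D p)) (at p)" for p
    proof -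
      have "blinfun_apply (- D p) = (\<lambda>k. - blinfun_apply (D p) k)" by (simp add: fun_eq_iff blinfun.minus_left)
      then show ?thesis using has_derivative_minus[OF D[of p]] by simp
    qed
  qed (use K outside h_pos in auto)
qed

section \<open>The divergence theorem for test functions\<close>

context c1_test
begin

lemma fst_snd_borel [measurable]:
  "fst \<in> borel_measurable (borel :: (real \<times> 'a) measure)" "snd \<in> borel_measurable (borel :: (real \<times> 'a) measure)"
  by (auto intro!: borel_measurable_continuous_onI continuous_intros)

lemma integrable_D: "integrable lborel (\<lambda>p. indicator {0..h} (fst p) * blinfun_apply (D p) k)"
proof (rule integrable_bounded_support[where C="Md * norm k" and R=R])
  show "(\<lambda>p. indicator {0..h} (fst p) * blinfun_apply (D p) k) \<in> borel_measurable borel" by measurable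
  show "\<bar>indicator {0..h} (fst p) * blinfun_apply (D p) k\<bar> \<le> Md * norm k" for p
    using D_apply_bound[of p k] Md(1) by (auto split: split_indicator)
qed (simp add: far)

lemma integrable_phi0: "integrable lborel (\<lambda>x. \<phi> (0, x))"
proof -
  obtain C where C: "\<And>p. \<bar>\<phi> p\<bar> \<le> C" using phi_bounded by blast
  show ?thesis
    by (rule integrable_bounded_support[where C=C and R=R]) (auto simp: C far_snd)
qed

text \<open>Constant velocity: the constant function \<open>1/2\<close> is a fixed point of the scheme, for \<open>\<phi>\<close> and for \<open>-\<phi>\<close>.\<close>

lemma divergence_le: "0 \<le> (\<integral>p. indicator {0..h} (fst p) * blinfun_apply (D p) (1, g) \<partial>lborel) + (\<integral>x. \<phi> (0, x) \<partial>lborel)"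
proof -
  \<comment> \<open>With \<open>B = 1/2\<close> the normalised entropy and flux of the constant
    state \<open>1/2\<close> are exactly 1 and \<open>g\<close>, so \<open>jint\<close> reduces to
    the derivative along \<open>(1, g)\<close>. As \<open>e' = 1\<close>, no sign of
    \<open>\<phi>\<close> is demanded.\<close>
  interpret collapse_test "\<lambda>_. g" "1/2" "norm g" "\<lambda>v. v" "\<lambda>_. 1" "\<lambda>v. v *\<^sub>R g" \<phi> D K h
    by standard (auto simp: mono_def intro!: derivative_eq_intros)
  have "0 \<le> (\<integral>p. indicator {0..h} (fst p) * jint (\<lambda>_. 1/2) (fst p) (snd p) \<partial>lborel) + Phi (\<lambda>_. 1/2) 0"
  proof (rule entropy_limit[where V="\<lambda>_ _ _. 1/2" and \<tau>="\<lambda>n. inverse (real (Suc n))"])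
    show "(\<lambda>n. inverse (real (Suc n))) \<longlonglongrightarrow> 0" by (rule LIMSEQ_inverse_real_of_nat)
    show "(\<lambda>_. 1/2) = T (inverse (real (Suc n))) (\<lambda>_. 1/2)" for n
      using T_top[of "inverse (real (Suc n))"] by simp
  qed auto
  moreover have "jint (\<lambda>_. 1/2) (fst p) (snd p) = blinfun_apply (D p) (1, g)" for p
    by (simp add: jint_def D_pair[of p g] flip: scaleR_left.add scaleR_left.diff)
  ultimately show ?thesis by (simp add: Phi_def)
qed

end

lemma (in c1_test) divergence_eq:
  "(\<integral>p. indicator {0..h} (fst p) * blinfun_apply (D p) (1, g) \<partial>lborel) + (\<integral>x. \<phi> (0, x) \<partial>lborel) = 0"
proof -
  interpret m: c1_test "\<lambda>p. - \<phi> p" "\<lambda>p. - D p" K h by (rule c1_test_uminus) standard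
  from m.divergence_le[of g] divergence_le[of g] show ?thesis by (simp add: blinfun.minus_left)
qed

text \<open>The initial term is the same for every velocity, so it cancels between the identities
  for \<open>g\<close> and for 0.\<close>

lemma (in c1_test) divergence_flux_eq:
  "(\<integral>p. indicator {0..h} (fst p) * blinfun_apply (D p) (0, g) \<partial>lborel) = 0"
proof -
  have "blinfun_apply (D p) (0, g) = blinfun_apply (D p) (1, g) - blinfun_apply (D p) (1, 0)" for p
    by (simp flip: blinfun.diff_right)
  then have "(\<integral>p. indicator {0..h} (fst p) * blinfun_apply (D p) (0, g) \<partial>lborel)
     = (\<integral>p. indicator {0..h} (fst p) * blinfun_apply (D p) (1, g) - indicator {0..h} (fst p) * blinfun_apply (D p) (1, 0) \<partial>lborel)"
    by (simp add: right_diff_distrib)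
  also have "\<dots> = (\<integral>p. indicator {0..h} (fst p) * blinfun_apply (D p) (1, g) \<partial>lborel)
     - (\<integral>p. indicator {0..h} (fst p) * blinfun_apply (D p) (1, 0) \<partial>lborel)"
    by (intro Bochner_Integration.integral_diff integrable_D)
  finally show ?thesis using divergence_eq[of g] divergence_eq[of 0] by simp
qed

lemma (in c1_test) dt_test_eq: "dt_test \<phi> p = blinfun_apply (D p) (1, 0)"
  and flux_test_eq: "flux_test \<phi> p g = blinfun_apply (D p) (0, g)"
  using frechet_derivative_at[OF D[of p]] by (simp_all add: dt_test_def flux_test_def)

lemma test_funE:
  assumes "test_fun h \<phi>" "0 < h"
  obtains D K where "c1_test \<phi> D K h"
  using assms unfolding test_fun_def c1_test_def by metis

lemma test_fun_uminus:
  assumes "test_fun h \<phi>" "0 < h" shows "test_fun h (\<lambda>p. - \<phi> p)"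
proof -
  obtain D K where "c1_test \<phi> D K h" by (rule test_funE[OF assms])
  from c1_test_uminus[OF this] show ?thesis unfolding c1_test_def test_fun_def by metis
qed

text \<open>The integrand shared by both solution notions: the identity as entropy and the flux
  itself as entropy flux give the weak formulation.\<close>

definition entropy_production :: "real \<Rightarrow> (real \<Rightarrow> real) \<Rightarrow> (real \<Rightarrow> 'a::euclidean_space) \<Rightarrow> (real \<times> 'a \<Rightarrow> real) \<Rightarrow>
    (real \<Rightarrow> 'a \<Rightarrow> real) \<Rightarrow> real \<times> 'a \<Rightarrow> real" where
  "entropy_production h \<eta> Q \<phi> u p = indicator {0..h} (fst p) *
     (\<eta> (u (fst p) (snd p)) * dt_test \<phi> p + flux_test \<phi> p (Q (u (fst p) (snd p))))"

lemma weak_sol_iff: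
  "weak_sol h F u u0 \<longleftrightarrow> (\<forall>\<phi>. test_fun h \<phi> \<longrightarrow>
     integrable lborel (entropy_production h (\<lambda>v. v) F \<phi> u) \<and> integrable lborel (\<lambda>y. u0 y * \<phi> (0, y)) \<and>
     (\<integral>p. entropy_production h (\<lambda>v. v) F \<phi> u p \<partial>lborel) + (\<integral>y. u0 y * \<phi> (0, y) \<partial>lborel) = 0)"
  unfolding weak_sol_def Let_def entropy_production_def by (simp add: case_prod_unfold)

lemma entropy_ineq_iff:
  "entropy_ineq h F u u0 \<longleftrightarrow> (\<forall>\<eta> Q \<phi>. entropy_pair F \<eta> Q \<and> test_fun h \<phi> \<and> (\<forall>p. 0 \<le> \<phi> p) \<longrightarrow>
     integrable lborel (entropy_production h \<eta> Q \<phi> u) \<and> integrable lborel (\<lambda>y. \<eta> (u0 y) * \<phi> (0, y)) \<and>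
     0 \<le> (\<integral>p. entropy_production h \<eta> Q \<phi> u p \<partial>lborel) + (\<integral>y. \<eta> (u0 y) * \<phi> (0, y) \<partial>lborel))"
  unfolding entropy_ineq_def Let_def entropy_production_def by (simp add: case_prod_unfold)

text \<open>The limit inequality is available for entropy and flux normalised at \<open>-B\<close>.
  Restoring the constants adds \<open>\<eta> (-B)\<close> times the divergence identity and a
  constant flux term, and both contributions are 0.\<close>

lemma (in collapse_test) production_nonneg:
  fixes V :: "nat \<Rightarrow> real \<Rightarrow> 'a \<Rightarrow> real"
  assumes V: "\<And>n. (\<lambda>p. V n (fst p) (snd p)) \<in> borel_measurable borel" and b: "\<And>n t x. \<bar>V n t x\<bar> \<le> B"
    and shift: "\<And>n t. 0 \<le> t \<Longrightarrow> V n (t + \<tau> n) = T (\<tau> n) (V n t)" and init: "\<And>n t. 0 \<le> t \<Longrightarrow> t < \<tau> n \<Longrightarrow> V n t = u0"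
    and \<tau>: "\<And>n. 0 < \<tau> n" "\<tau> \<longlonglongrightarrow> 0"
    and u0: "u0 \<in> borel_measurable borel" "\<And>x. \<bar>u0 x\<bar> \<le> B"
    and v: "(\<lambda>p. v (fst p) (snd p)) \<in> borel_measurable borel" "\<And>t x. \<bar>v t x\<bar> \<le> B"
    and conv: "\<And>e. e > 0 \<Longrightarrow> \<exists>N. \<forall>n\<ge>N. \<forall>t\<in>{0..h}. (\<integral>\<^sup>+x. indicator (cball 0 R) x * ennreal \<bar>V n t x - v t x\<bar> \<partial>lborel) \<le> ennreal e"
  shows "integrable lborel (entropy_production h \<eta> Q \<phi> v)"
    and "integrable lborel (\<lambda>y. \<eta> (u0 y) * \<phi> (0, y))"
    and "0 \<le> (\<integral>p. entropy_production h \<eta> Q \<phi> v p \<partial>lborel) + (\<integral>y. \<eta> (u0 y) * \<phi> (0, y) \<partial>lborel)"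
proof -
  note main = entropy_limit[OF V b shift init \<tau> v conv]
  note ij = integrable_J_product(1)[OF v]
  have split: "\<eta> s * blinfun_apply (D p) (1, 0) + blinfun_apply (D p) (0, Q s)
     = (\<eta> s - \<eta> (-B)) * blinfun_apply (D p) (1, 0) + blinfun_apply (D p) (0, Q s - Q (-B))
       + \<eta> (-B) * blinfun_apply (D p) (1, 0) + blinfun_apply (D p) (0, Q (-B))" for s p
  proof -
    have "(0::real, Q s) = (0, Q s - Q (-B)) + (0, Q (-B))" by simp
    then have "blinfun_apply (D p) (0, Q s) = blinfun_apply (D p) (0, Q s - Q (-B)) + blinfun_apply (D p) (0, Q (-B))"
      by (simp only: blinfun.add_right)
    then show ?thesis by (simp add: algebra_simps)
  qed
  have eq: "entropy_production h \<eta> Q \<phi> v = (\<lambda>p. indicator {0..h} (fst p) * jint (v (fst p)) (fst p) (snd p)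
      + (\<eta> (-B) * (indicator {0..h} (fst p) * blinfun_apply (D p) (1, 0)) + indicator {0..h} (fst p) * blinfun_apply (D p) (0, Q (-B))))"
    unfolding entropy_production_def dt_test_eq flux_test_eq split jint_def
    by (simp add: fun_eq_iff algebra_simps)
  have ci: "integrable lborel (\<lambda>p. \<eta> (-B) * (indicator {0..h} (fst p) * blinfun_apply (D p) (1, 0)) + indicator {0..h} (fst p) * blinfun_apply (D p) (0, Q (-B)))"
    by (intro Bochner_Integration.integrable_add integrable_mult_right integrable_D)
  show "integrable lborel (entropy_production h \<eta> Q \<phi> v)"
    unfolding eq by (intro Bochner_Integration.integrable_add ij ci)
  note i0 = Phi_eq(3)[OF u0, of 0]
  have eq0: "(\<lambda>y. \<eta> (u0 y) * \<phi> (0, y)) = (\<lambda>y. (\<eta> (u0 y) - \<eta> (-B)) * \<phi> (0, y) + \<eta> (-B) * \<phi> (0, y))"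
    by (simp add: algebra_simps)
  show "integrable lborel (\<lambda>y. \<eta> (u0 y) * \<phi> (0, y))"
    unfolding eq0 by (intro Bochner_Integration.integrable_add i0 integrable_mult_right integrable_phi0)
  have 1: "(\<integral>p. entropy_production h \<eta> Q \<phi> v p \<partial>lborel) = (\<integral>p. indicator {0..h} (fst p) * jint (v (fst p)) (fst p) (snd p) \<partial>lborel)
     + \<eta> (-B) * (\<integral>p. indicator {0..h} (fst p) * blinfun_apply (D p) (1, 0) \<partial>lborel)"
    unfolding eq using ij ci integrable_D divergence_flux_eq[of "Q (-B)"]
    by (simp add: Bochner_Integration.integral_add)
  have 2: "(\<integral>y. \<eta> (u0 y) * \<phi> (0, y) \<partial>lborel) = Phi u0 0 + \<eta> (-B) * (\<integral>y. \<phi> (0, y) \<partial>lborel)"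
    unfolding eq0 Phi_def using i0 integrable_phi0 by simp
  have 3: "(\<integral>p. indicator {0..h} (fst p) * blinfun_apply (D p) (1, 0) \<partial>lborel) = - (\<integral>y. \<phi> (0, y) \<partial>lborel)"
    using divergence_eq[of 0] by linarith
  show "0 \<le> (\<integral>p. entropy_production h \<eta> Q \<phi> v p \<partial>lborel) + (\<integral>y. \<eta> (u0 y) * \<phi> (0, y) \<partial>lborel)"
    using main unfolding 1 2 3 by simp
qed

lemma C1_fun_derivative:
  fixes F :: "real \<Rightarrow> 'a::euclidean_space"
  assumes "C1_fun F"
  shows "(F has_vector_derivative vector_derivative F (at v)) (at v)"
    and "continuous_on UNIV (\<lambda>v. vector_derivative F (at v))"
proof -
  obtain F' where F': "continuous_on UNIV F'" "\<And>v. (F has_vector_derivative F' v) (at v)"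
    using assms unfolding C1_fun_def by blast
  then have "(\<lambda>v. vector_derivative F (at v)) = F'" by (auto intro: vector_derivative_at)
  with F' show "(F has_vector_derivative vector_derivative F (at v)) (at v)"
    "continuous_on UNIV (\<lambda>v. vector_derivative F (at v))" by metis+
qed

lemma C1_fun_collapse:
  fixes F :: "real \<Rightarrow> 'a::euclidean_space"
  assumes F: "C1_fun F" and B: "0 \<le> B"
  obtains S where "collapse (\<lambda>v. vector_derivative F (at v)) B S"
proof -
  let ?a = "\<lambda>v. vector_derivative F (at v)"
  have "compact (?a ` {-B..B})"
    by (intro compact_continuous_image continuous_on_subset[OF C1_fun_derivative(2)[OF F]]) auto
  then obtain S where S: "\<forall>y\<in>?a ` {-B..B}. norm y \<le> S" using compact_imp_bounded bounded_iff by metis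
  have "collapse ?a B (max 0 S)"
  proof
    show "?a \<in> borel_measurable borel"
      by (rule borel_measurable_continuous_onI[OF C1_fun_derivative(2)[OF F]])
    show "norm (?a v) \<le> max 0 S" if "\<bar>v\<bar> \<le> B" for v
    proof -
      have "v \<in> {-B..B}" using that by auto
      then have "norm (?a v) \<le> S" using S by blast
      then show ?thesis by simp
    qed
  qed (use B in auto)
  then show ?thesis by (rule that)
qed

text \<open>Adding the tangent inequalities of the convex \<open>\<eta>\<close> at two points gives
  the monotonicity of its derivative.\<close>

lemma entropy_pair_mono:
  assumes "entropy_pair F \<eta> Q"
  shows "mono (deriv \<eta>)" "(\<eta> has_vector_derivative deriv \<eta> v) (at v)"
proof -
  have d: "(\<eta> has_real_derivative deriv \<eta> v) (at v)" for v
    using assms unfolding entropy_pair_def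
    by (metis DERIV_deriv_iff_real_differentiable real_differentiableE)
  then show "(\<eta> has_vector_derivative deriv \<eta> v) (at v)"
    by (simp add: has_real_derivative_iff_has_vector_derivative)
  have tan: "deriv \<eta> c * (x - c) \<le> \<eta> x - \<eta> c" for x c
    by (rule convex_on_imp_above_tangent[of UNIV]) (use assms d in \<open>auto simp: entropy_pair_def\<close>)
  show "mono (deriv \<eta>)"
  proof
    fix x y :: real assume "x \<le> y"
    have "(deriv \<eta> x - deriv \<eta> y) * (y - x) \<le> 0" using tan[of x y] tan[of y x] by (simp add: algebra_simps)
    then show "deriv \<eta> x \<le> deriv \<eta> y" using \<open>x \<le> y\<close> by (cases "x = y") (auto simp: mult_le_0_iff)
  qed
qed

text \<open>The weak equation is the linear entropy tested with \<open>\<phi>\<close> and with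
  \<open>-\<phi>\<close>, where no sign condition applies. Convergence is asked only on balls: a
  test function sees no more, and on the product space no more is known.\<close>

theorem scheme_limit_is_solution:
  fixes F :: "real \<Rightarrow> 'a::euclidean_space" and V :: "nat \<Rightarrow> real \<Rightarrow> 'a \<Rightarrow> real"
  assumes F: "C1_fun F" and B: "0 \<le> B" and h: "0 < h"
    and V: "\<And>n. (\<lambda>p. V n (fst p) (snd p)) \<in> borel_measurable borel" and b: "\<And>n t x. \<bar>V n t x\<bar> \<le> B"
    and shift: "\<And>n t. 0 \<le> t \<Longrightarrow> V n (t + \<tau> n) = tc (\<lambda>v. vector_derivative F (at v)) B (\<tau> n) (V n t)"
    and init: "\<And>n t. 0 \<le> t \<Longrightarrow> t < \<tau> n \<Longrightarrow> V n t = u0"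
    and \<tau>: "\<And>n. 0 < \<tau> n" "\<tau> \<longlonglongrightarrow> 0"
    and u0: "u0 \<in> borel_measurable borel" "\<And>x. \<bar>u0 x\<bar> \<le> B"
    and v: "(\<lambda>p. v (fst p) (snd p)) \<in> borel_measurable borel" "\<And>t x. \<bar>v t x\<bar> \<le> B"
    and conv: "\<And>R e. e > 0 \<Longrightarrow> \<exists>N. \<forall>n\<ge>N. \<forall>t\<in>{0..h}. (\<integral>\<^sup>+x. indicator (cball 0 R) x * ennreal \<bar>V n t x - v t x\<bar> \<partial>lborel) \<le> ennreal e"
  shows "weak_sol h F v u0" "entropy_ineq h F v u0"
proof -
  obtain S where S: "collapse (\<lambda>v. vector_derivative F (at v)) B S" by (rule C1_fun_collapse[OF F B])
  show "entropy_ineq h F v u0"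
    unfolding entropy_ineq_iff
  proof (intro allI impI)
    fix \<eta> Q and \<phi> :: "real \<times> 'a \<Rightarrow> real" assume *: "entropy_pair F \<eta> Q \<and> test_fun h \<phi> \<and> (\<forall>p. 0 \<le> \<phi> p)"
    obtain D K where D: "c1_test \<phi> D K h" using test_funE h * by metis
    have "collapse_test (\<lambda>v. vector_derivative F (at v)) B S \<eta> (deriv \<eta>) Q \<phi> D K h"
      using * S D entropy_pair_mono[of F \<eta> Q]
      by (auto simp: collapse_test_def collapse_test_axioms_def collapse_entropy_def collapse_entropy_axioms_def entropy_pair_def)
    from collapse_test.production_nonneg[OF this V b shift init \<tau> u0 v conv]
    show "integrable lborel (entropy_production h \<eta> Q \<phi> v) \<and> integrable lborel (\<lambda>y. \<eta> (u0 y) * \<phi> (0, y)) \<and>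
     0 \<le> (\<integral>p. entropy_production h \<eta> Q \<phi> v p \<partial>lborel) + (\<integral>y. \<eta> (u0 y) * \<phi> (0, y) \<partial>lborel)" by blast
  qed
  have one: "integrable lborel (entropy_production h (\<lambda>v. v) F \<phi> v) \<and> integrable lborel (\<lambda>y. u0 y * \<phi> (0, y)) \<and>
     0 \<le> (\<integral>p. entropy_production h (\<lambda>v. v) F \<phi> v p \<partial>lborel) + (\<integral>y. u0 y * \<phi> (0, y) \<partial>lborel)" if \<phi>: "test_fun h \<phi>" for \<phi> :: "real \<times> 'a \<Rightarrow> real"
  proof -
    obtain D K where D: "c1_test \<phi> D K h" using test_funE h \<phi> by metis
    have "collapse_test (\<lambda>v. vector_derivative F (at v)) B S (\<lambda>v. v) (\<lambda>_. 1) F \<phi> D K h"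
      using S D C1_fun_derivative(1)[OF F]
      by (auto simp: collapse_test_def collapse_test_axioms_def collapse_entropy_def collapse_entropy_axioms_def mono_def)
    from collapse_test.production_nonneg[OF this V b shift init \<tau> u0 v conv]
    show ?thesis by blast
  qed
  show "weak_sol h F v u0"
    unfolding weak_sol_iff
  proof (intro allI impI)
    fix \<phi> :: "real \<times> 'a \<Rightarrow> real" assume \<phi>: "test_fun h \<phi>"
    obtain D K where D: "c1_test \<phi> D K h" using test_funE h \<phi> by metis
    interpret p: c1_test \<phi> D K h by fact
    interpret m: c1_test "\<lambda>p. - \<phi> p" "\<lambda>p. - D p" K h by (rule c1_test_uminus[OF D])
    have "entropy_production h (\<lambda>v. v) F (\<lambda>p. - \<phi> p) v = (\<lambda>p. - entropy_production h (\<lambda>v. v) F \<phi> v p)"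
      by (simp add: entropy_production_def fun_eq_iff p.dt_test_eq p.flux_test_eq m.dt_test_eq m.flux_test_eq blinfun.minus_left algebra_simps)
    then have "(\<integral>p. entropy_production h (\<lambda>v. v) F \<phi> v p \<partial>lborel) + (\<integral>y. u0 y * \<phi> (0, y) \<partial>lborel) \<le> 0"
      using one[OF test_fun_uminus[OF \<phi> h]] by simp
    with one[OF \<phi>] show "integrable lborel (entropy_production h (\<lambda>v. v) F \<phi> v) \<and> integrable lborel (\<lambda>y. u0 y * \<phi> (0, y)) \<and>
     (\<integral>p. entropy_production h (\<lambda>v. v) F \<phi> v p \<partial>lborel) + (\<integral>y. u0 y * \<phi> (0, y) \<partial>lborel) = 0" by auto
  qed
qed

section \<open>Convergence of the scheme\<close>

text \<open>The iterates are held constant between grid times rather than interpolated; this makes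
  the shift by one step an exact application of the operator at every
  \<open>t \<ge> 0\<close>.\<close>

definition appr :: "(real \<Rightarrow> 'a::euclidean_space) \<Rightarrow> real \<Rightarrow> nat \<Rightarrow> ('a \<Rightarrow> real) \<Rightarrow> real \<Rightarrow> 'a \<Rightarrow> real" where
  "appr a B n u t = (tc a B (inverse (real (Suc n))) ^^ nat \<lfloor>t * real (Suc n)\<rfloor>) u"

lemma L1d_integral:
  assumes "integrable lborel f" "integrable lborel g"
  shows "L1d f g = ennreal (\<integral>x. \<bar>f x - g x\<bar> \<partial>lborel)"
  unfolding L1d_def using assms by (intro nn_integral_eq_integral) auto

lemma L1d_finite_integrable:
  assumes f: "integrable lborel f" and [measurable]: "g \<in> borel_measurable borel" and fin: "L1d f g < \<infinity>"
  shows "integrable lborel g"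
proof -
  have [measurable]: "f \<in> borel_measurable borel" using f by auto
  have "integrable lborel (\<lambda>x. f x - g x)"
    by (rule integrableI_bounded) (use fin in \<open>auto simp: L1d_def\<close>)
  from Bochner_Integration.integrable_diff[OF f this] show ?thesis by simp
qed

context collapse
begin

lemma appr_eq: "appr a B n u t = iter (inverse (real (Suc n))) (nat \<lfloor>t * real (Suc n)\<rfloor>) u"
  by (simp add: appr_def iter_def)

lemma appr_borel [measurable]: "u \<in> borel_measurable borel \<Longrightarrow> appr a B n u t \<in> borel_measurable borel"
  by (simp add: appr_eq)

text \<open>The number of steps depends measurably on time and takes countably many values, so joint
  measurability reduces to that of each single iterate.\<close>

lemma appr_joint:
  assumes [measurable]: "u \<in> borel_measurable borel"
  shows "(\<lambda>p. appr a B n u (fst p) (snd p)) \<in> borel_measurable borel"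
proof -
  have "(\<lambda>p. (\<lambda>k p. iter (inverse (real (Suc n))) k u (snd p)) (nat \<lfloor>fst p * real (Suc n)\<rfloor>) p)
    \<in> borel_measurable (borel \<Otimes>\<^sub>M borel :: (real \<times> 'a) measure)"
    by (rule measurable_compose_countable) measurable
  then show ?thesis by (simp add: appr_eq borel_prod)
qed

lemma appr_range: "u \<in> borel_measurable borel \<Longrightarrow> (\<And>x. \<bar>u x\<bar> \<le> B) \<Longrightarrow> \<bar>appr a B n u t x\<bar> \<le> B"
  unfolding appr_eq by (rule iter_range)

lemma appr_shift:
  assumes "0 \<le> t"
  shows "appr a B n u (t + inverse (real (Suc n))) = T (inverse (real (Suc n))) (appr a B n u t)"
proof -
  have "(t + inverse (real (Suc n))) * real (Suc n) = t * real (Suc n) + 1"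
    by (simp add: distrib_right del: of_nat_Suc)
  then have "nat \<lfloor>(t + inverse (real (Suc n))) * real (Suc n)\<rfloor> = Suc (nat \<lfloor>t * real (Suc n)\<rfloor>)"
    using assms by (simp add: nat_add_distrib)
  then show ?thesis by (simp add: appr_eq)
qed

lemma appr_init:
  assumes "0 \<le> t" "t < inverse (real (Suc n))"
  shows "appr a B n u t = u"
proof -
  have "t * real (Suc n) < inverse (real (Suc n)) * real (Suc n)"
    using assms by (intro mult_strict_right_mono) auto
  also have "\<dots> = 1" by (simp del: of_nat_Suc)
  finally have "\<lfloor>t * real (Suc n)\<rfloor> = 0" using assms by (simp add: floor_eq_iff)
  then show ?thesis by (simp add: appr_eq)
qed

lemma appr_L1_bound:
  assumes [measurable]: "u \<in> borel_measurable borel"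
  shows "L1d (appr a B n u t) (\<lambda>_. 0) \<le> L1d u (\<lambda>_. 0)"
  unfolding appr_eq using iter_contraction[of u "\<lambda>_. 0"] by (simp add: iter_zero)

lemma L1d_zero_finite: "integrable lborel u \<Longrightarrow> L1d u (\<lambda>_. 0) < \<infinity>"
  by (simp add: L1d_integral)

lemma appr_integrable:
  assumes u: "integrable lborel u"
  shows "integrable lborel (appr a B n u t)"
proof (rule L1d_finite_integrable[where f="\<lambda>_. 0"])
  have [measurable]: "u \<in> borel_measurable borel" using u by auto
  show "appr a B n u t \<in> borel_measurable borel" by measurable
  show "L1d (\<lambda>_. 0) (appr a B n u t) < \<infinity>"
    using appr_L1_bound[of u n t] L1d_zero_finite[OF u] by (simp add: L1d_commute[of "\<lambda>_. 0"])
qed simp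

text \<open>Translations commute with the scheme, so this is the contraction property for
  \<open>u\<close> and its translate. The modulus on the right depends neither on \<open>n\<close>
  nor on \<open>t\<close>.\<close>

lemma appr_translation:
  assumes [measurable]: "u \<in> borel_measurable borel"
  shows "L1d (\<lambda>x. appr a B n u t (x + y)) (appr a B n u t) \<le> L1d (\<lambda>x. u (x + y)) u"
  unfolding appr_eq iter_shift[symmetric] by (rule iter_contraction) auto

text \<open>A compactly supported approximation of the datum bounds its tail beyond
  \<open>R\<close>; up to time \<open>h\<close> mass travels at most the distance
  \<open>h * S\<close>.\<close>

lemma appr_tail:
  assumes u: "integrable lborel u" and e: "e > 0"
  obtains R where "\<And>n t. t \<in> {0..h} \<Longrightarrow> (\<integral>\<^sup>+x. indicator {x. R < norm x} x * ennreal \<bar>appr a B n u t x\<bar> \<partial>lborel) \<le> ennreal e"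
proof -
  have [measurable]: "u \<in> borel_measurable borel" using u by auto
  obtain g L R where g: "\<And>x. R < norm x \<Longrightarrow> g x = 0" "L1d u g < ennreal e"
    by (rule lip_approxE[OF lip_approx_integrable[OF u] e]) auto
  have "(\<integral>\<^sup>+x. indicator {x. R + h * S < norm x} x * ennreal \<bar>appr a B n u t x\<bar> \<partial>lborel) \<le> ennreal e" if t: "t \<in> {0..h}" for n t
  proof -
    define k where "k = nat \<lfloor>t * real (Suc n)\<rfloor>"
    have "real k \<le> t * real (Suc n)" using t by (simp add: k_def)
    then have "real k * inverse (real (Suc n)) \<le> t"
      by (simp add: field_simps del: of_nat_Suc)
    then have le: "real k * inverse (real (Suc n)) * S \<le> h * S" using t S_nonneg by (intro mult_right_mono) auto
    have "(\<integral>\<^sup>+x. indicator {x. R + h * S < norm x} x * ennreal \<bar>appr a B n u t x\<bar> \<partial>lborel)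
       \<le> (\<integral>\<^sup>+x. indicator {x. R + real k * inverse (real (Suc n)) * S < norm x} x * ennreal \<bar>iter (inverse (real (Suc n))) k u x\<bar> \<partial>lborel)"
    proof (intro nn_integral_mono)
      fix x show "indicator {x. R + h * S < norm x} x * ennreal \<bar>appr a B n u t x\<bar>
         \<le> indicator {x. R + real k * inverse (real (Suc n)) * S < norm x} x * ennreal \<bar>iter (inverse (real (Suc n))) k u x\<bar>"
        using le by (cases "R + h * S < norm x") (auto simp: appr_eq k_def)
    qed
    also have "\<dots> \<le> (\<integral>\<^sup>+x. indicator {x. R < norm x} x * ennreal \<bar>u x\<bar> \<partial>lborel)"
      by (rule iter_tail) auto
    also have "\<dots> \<le> L1d u g"
      unfolding L1d_def
    proof (intro nn_integral_mono)
      fix x show "indicator {x. R < norm x} x * ennreal \<bar>u x\<bar> \<le> ennreal \<bar>u x - g x\<bar>"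
        using g(1)[of x] by (cases "R < norm x") auto
    qed
    finally show ?thesis using g(2) by simp
  qed
  then show ?thesis using that by blast
qed

text \<open>Contraction strips off the common iterates and leaves the distance of
  \<open>j - i\<close> steps from the datum. These steps cover at most the time
  \<open>(t - s) + \<tau>\<close>; the extra \<open>\<tau>\<close> from rounding to the grid is the
  reason for requiring \<open>n \<ge> N\<close>.\<close>

lemma appr_time:
  assumes u: "integrable lborel u" and uB: "\<And>x. \<bar>u x\<bar> \<le> B" and e: "e > 0"
  obtains d N where "d > 0" "\<And>n s t. n \<ge> N \<Longrightarrow> 0 \<le> s \<Longrightarrow> 0 \<le> t \<Longrightarrow> \<bar>s - t\<bar> < d \<Longrightarrow> L1d (appr a B n u s) (appr a B n u t) \<le> ennreal e"
proof -
  have [measurable]: "u \<in> borel_measurable borel" using u by auto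
  have e2: "e / 2 > 0" using e by simp
  obtain C where C: "C \<ge> 0" "\<And>\<tau> n. 0 \<le> \<tau> \<Longrightarrow> \<tau> \<le> 1 \<Longrightarrow> L1d (iter \<tau> n u) u \<le> ennreal (e/2 + real n * \<tau> * C)"
    using iter_dist_initial[OF u uB e2] by blast
  \<comment> \<open>Rounding included, the elapsed time is at most \<open>2 * d\<close>, and
    \<open>2 * d * C \<le> e/2\<close> leaves room for the error \<open>e/2\<close> of the Lipschitz
    approximation.\<close>
  define d where "d = e / (4 * (C + 1))"
  have d: "d > 0" using e C by (simp add: d_def)
  obtain N where N: "inverse (real (Suc N)) < d" using reals_Archimedean[OF d] by blast
  have ordered: "L1d (appr a B n u s) (appr a B n u t) \<le> ennreal e"
    if n: "n \<ge> N" and s: "0 \<le> s" and st: "s \<le> t" "t - s < d" for n s t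
  proof -
    define \<tau> where "\<tau> = inverse (real (Suc n))"
    have \<tau>: "0 \<le> \<tau>" "\<tau> \<le> 1" by (auto simp: \<tau>_def inverse_le_1_iff)
    have \<tau>d: "\<tau> < d"
    proof -
      have "\<tau> \<le> inverse (real (Suc N))" unfolding \<tau>_def using n by (intro le_imp_inverse_le) auto
      then show ?thesis using N by simp
    qed
    define i j where "i = nat \<lfloor>s * real (Suc n)\<rfloor>" and "j = nat \<lfloor>t * real (Suc n)\<rfloor>"
    have ij: "i \<le> j" unfolding i_def j_def using st by (intro nat_mono floor_mono mult_right_mono) auto
    have "real (j - i) \<le> (t - s) * real (Suc n) + 1"
    proof -
      have "0 \<le> s * real (Suc n)" "0 \<le> t * real (Suc n)" using s st by auto
      then have "real j \<le> t * real (Suc n)" "s * real (Suc n) < real i + 1"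
        unfolding i_def j_def by (simp_all add: of_nat_nat del: of_nat_Suc)
      then show ?thesis using ij by (simp add: of_nat_diff left_diff_distrib del: of_nat_Suc)
    qed
    moreover have "real (Suc n) * \<tau> = 1" by (simp add: \<tau>_def del: of_nat_Suc)
    ultimately have "real (j - i) * \<tau> \<le> (t - s) + \<tau>"
      using mult_right_mono[of "real (j - i)" "(t - s) * real (Suc n) + 1" \<tau>] \<tau>(1)
      by (simp only: distrib_right mult.assoc mult_1_left mult_1_right)
    then have m: "real (j - i) * \<tau> \<le> 2 * d" using st \<tau>d by linarith
    have "L1d (appr a B n u s) (appr a B n u t) = L1d (iter \<tau> i u) (iter \<tau> i (iter \<tau> (j - i) u))"
      using ij by (simp add: appr_eq \<tau>_def i_def j_def iter_add[symmetric])
    also have "\<dots> \<le> L1d u (iter \<tau> (j - i) u)" by (rule iter_contraction) auto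
    also have "\<dots> \<le> ennreal (e/2 + real (j - i) * \<tau> * C)" using C(2)[OF \<tau>] by (simp add: L1d_commute)
    also have "\<dots> \<le> ennreal e"
    proof (rule ennreal_leI)
      have "real (j - i) * \<tau> * C \<le> 2 * d * C" using m C by (intro mult_right_mono)
      also have "\<dots> \<le> 2 * d * (C + 1)" using d by simp
      also have "\<dots> = e / 2" using C(1) by (simp add: d_def field_simps)
      finally show "e/2 + real (j - i) * \<tau> * C \<le> e" by simp
    qed
    finally show ?thesis .
  qed
  have "L1d (appr a B n u s) (appr a B n u t) \<le> ennreal e"
    if "n \<ge> N" "0 \<le> s" "0 \<le> t" "\<bar>s - t\<bar> < d" for n s t
    using ordered[of n s t] ordered[of n t s] that by (cases "s \<le> t") (auto simp: L1d_commute)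
  with d show ?thesis using that by blast
qed

end

text \<open>Compactness is stated along an arbitrary given subsequence \<open>r\<close>, as a later
  argument by contradiction requires. The limit has to lie in the class in which uniqueness is
  assumed, hence the verification of \<open>Cb_L1\<close>.\<close>

lemma appr_subsequence_limit:
  fixes F :: "real \<Rightarrow> 'a::euclidean_space"
  defines "a \<equiv> (\<lambda>v. vector_derivative F (at v))"
  assumes F: "C1_fun F" and B: "0 \<le> B" and h: "0 < h"
    and u: "integrable lborel u" and uB: "\<And>x. \<bar>u x\<bar> \<le> B" and r: "strict_mono (r :: nat \<Rightarrow> nat)"
  obtains s :: "nat \<Rightarrow> nat" and v where "strict_mono s" "Cb_L1 h v" "weak_sol h F v u" "entropy_ineq h F v u"
    "\<And>e. e > 0 \<Longrightarrow> \<exists>N. \<forall>n\<ge>N. \<forall>t\<in>{0..h}. L1d (appr a B (r (s n)) u t) (v t) \<le> ennreal e"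
proof -
  obtain S where S: "collapse a B S" unfolding a_def by (rule C1_fun_collapse[OF F B])
  interpret collapse a B S by fact
  have [measurable]: "u \<in> borel_measurable borel" using u by auto
  have time: "\<exists>d>0. \<exists>N. \<forall>n\<ge>N. \<forall>s\<in>{0..h}. \<forall>t\<in>{0..h}. \<bar>s - t\<bar> < d \<longrightarrow> L1d (appr a B (r n) u s) (appr a B (r n) u t) \<le> ennreal e"
    if e: "e > 0" for e
  proof -
    obtain d N where d: "d > 0" "\<And>n s t. n \<ge> N \<Longrightarrow> 0 \<le> s \<Longrightarrow> 0 \<le> t \<Longrightarrow> \<bar>s - t\<bar> < d \<Longrightarrow> L1d (appr a B n u s) (appr a B n u t) \<le> ennreal e"
      using appr_time[OF u uB e] by blast
    have "L1d (appr a B (r n) u s) (appr a B (r n) u t) \<le> ennreal e"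
      if "n \<ge> N" "s \<in> {0..h}" "t \<in> {0..h}" "\<bar>s - t\<bar> < d" for n s t
      using that seq_suble[OF r, of n] by (intro d(2)) auto
    with d(1) show ?thesis by blast
  qed
  have trans: "\<exists>d>0. \<forall>n t y. norm y < d \<longrightarrow> L1d (\<lambda>x. appr a B (r n) u t (x + y)) (appr a B (r n) u t) \<le> ennreal e" if e: "e > 0" for e
  proof -
    obtain d where d: "d > 0" "\<And>y. norm y < d \<Longrightarrow> L1d (\<lambda>x. u (x + y)) u \<le> ennreal e"
      using L1d_translation_tendsto[OF u e] by blast
    have "L1d (\<lambda>x. appr a B (r n) u t (x + y)) (appr a B (r n) u t) \<le> ennreal e" if "norm y < d" for n t y
      by (rule order_trans[OF appr_translation d(2)[OF that]]) measurable
    with d(1) show ?thesis by blast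
  qed
  have tail: "\<exists>R. \<forall>n. \<forall>t\<in>{0..h}. (\<integral>\<^sup>+x. indicator {x. R < norm x} x * ennreal \<bar>appr a B (r n) u t x\<bar> \<partial>lborel) \<le> ennreal e" if e: "e > 0" for e
    by (rule appr_tail[OF u e, of h]) blast
  obtain s :: "nat \<Rightarrow> nat" where s: "strict_mono s"
    "\<And>e. e > 0 \<Longrightarrow> \<exists>N. \<forall>m\<ge>N. \<forall>n\<ge>N. \<forall>t\<in>{0..h}. L1d (appr a B (r (s m)) u t) (appr a B (r (s n)) u t) \<le> ennreal e"
    by (rule L1_compactness[of "\<lambda>n. appr a B (r n) u" B h])
       (use appr_integrable[OF u] appr_range[of u] uB h time trans tail in auto)
  have cauchy: "\<exists>N. \<forall>m\<ge>N. \<forall>n\<ge>N. \<forall>t\<in>{0..h}.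
      (\<integral>\<^sup>+x. indicator UNIV x * ennreal \<bar>appr a B (r (s m)) u t x - appr a B (r (s n)) u t x\<bar> \<partial>lborel) \<le> ennreal e"
    if "e > 0" for e using s(2)[OF that] by (simp add: L1d_def)
  obtain v where v: "(\<lambda>p. v (fst p) (snd p)) \<in> borel_measurable borel" "\<And>t x. \<bar>v t x\<bar> \<le> B"
    and lim0: "\<And>(k :: nat) e. e > 0 \<Longrightarrow> \<exists>N. \<forall>n\<ge>N. \<forall>t\<in>{0..h}.
      (\<integral>\<^sup>+x. indicator UNIV x * ennreal \<bar>appr a B (r (s n)) u t x - v t x\<bar> \<partial>lborel) \<le> ennreal e"
    by (rule uniform_L1_limit[where A="\<lambda>_. UNIV" and B=B and I="{0..h}" and V="\<lambda>n. appr a B (r (s n)) u"])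
       (use appr_joint[of u] appr_range[of u] uB cauchy in auto)
  have lim: "\<exists>N. \<forall>n\<ge>N. \<forall>t\<in>{0..h}. L1d (appr a B (r (s n)) u t) (v t) \<le> ennreal e" if "e > 0" for e
    using lim0[OF that] by (simp add: L1d_def)
  have vb[measurable]: "v t \<in> borel_measurable borel" for t
    using joint_compose[OF v(1), of "\<lambda>_. t" borel "\<lambda>x. x"] by auto
  have sol: "weak_sol h F v u" "entropy_ineq h F v u"
  proof -
    have *: "\<exists>N. \<forall>n\<ge>N. \<forall>t\<in>{0..h}. (\<integral>\<^sup>+x. indicator (cball 0 R) x * ennreal \<bar>appr a B (r (s n)) u t x - v t x\<bar> \<partial>lborel) \<le> ennreal e"
      if "e > 0" for R e
    proof -
      have "(\<integral>\<^sup>+x. indicator (cball 0 R) x * ennreal \<bar>appr a B (r (s n)) u t x - v t x\<bar> \<partial>lborel) \<le> L1d (appr a B (r (s n)) u t) (v t)" for n t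
        unfolding L1d_def by (intro nn_integral_mono) (auto split: split_indicator)
      then show ?thesis using lim[OF that] by (meson order_trans)
    qed
    have \<tau>: "(\<lambda>n. inverse (real (Suc (r (s n))))) \<longlonglongrightarrow> 0"
      using LIMSEQ_subseq_LIMSEQ[OF LIMSEQ_inverse_real_of_nat strict_mono_o[OF r s(1)]] by (simp add: o_def)
    have ub: "u \<in> borel_measurable borel" by measurable
    show "weak_sol h F v u" "entropy_ineq h F v u"
      using scheme_limit_is_solution[OF F B h, where V="\<lambda>n. appr a B (r (s n)) u" and v=v and \<tau>="\<lambda>n. inverse (real (Suc (r (s n))))",
       folded a_def, OF appr_joint[OF ub] appr_range[OF ub uB] appr_shift appr_init _ \<tau> ub uB v *]
      by simp_all
  qed
  have cb: "Cb_L1 h v"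
  proof -
    have vi: "integrable lborel (v t)" if t: "t \<in> {0..h}" for t
    proof -
      obtain n where "L1d (appr a B (r (s n)) u t) (v t) \<le> ennreal 1" using lim[of 1] t by (meson order_refl zero_less_one)
      then have "L1d (appr a B (r (s n)) u t) (v t) < \<infinity>" by (rule le_less_trans) simp
      from L1d_finite_integrable[OF appr_integrable[OF u] _ this] show ?thesis by simp
    qed
    have bound: "\<exists>C. \<forall>t\<in>{0..h}. (\<integral>y. \<bar>v t y\<bar> \<partial>lborel) \<le> C"
    proof -
      obtain n where n: "\<And>t. t \<in> {0..h} \<Longrightarrow> L1d (appr a B (r (s n)) u t) (v t) \<le> ennreal 1" using lim[of 1] by (meson order_refl zero_less_one)
      have "(\<integral>y. \<bar>v t y\<bar> \<partial>lborel) \<le> 1 + (\<integral>y. \<bar>u y\<bar> \<partial>lborel)" if t: "t \<in> {0..h}" for t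
      proof -
        have "L1d (v t) (\<lambda>_. 0) \<le> L1d (v t) (appr a B (r (s n)) u t) + L1d (appr a B (r (s n)) u t) (\<lambda>_. 0)"
          by (rule L1d_triangle) auto
        also have "\<dots> \<le> ennreal 1 + L1d u (\<lambda>_. 0)"
          using n[OF t] by (intro add_mono appr_L1_bound) (auto simp: L1d_commute)
        also have "\<dots> = ennreal (1 + (\<integral>y. \<bar>u y\<bar> \<partial>lborel))"
          using u by (subst ennreal_plus) (simp_all add: L1d_integral)
        finally have "ennreal (\<integral>y. \<bar>v t y - 0\<bar> \<partial>lborel) \<le> ennreal (1 + (\<integral>y. \<bar>u y\<bar> \<partial>lborel))"
          by (simp only: L1d_integral[OF vi[OF t] integrable_zero])
        then show ?thesis by (subst (asm) ennreal_le_iff) auto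
      qed
      then show ?thesis by blast
    qed
    \<comment> \<open>The comparison runs through one iterate \<open>V\<close>, late enough to be
      close to \<open>v\<close> uniformly in time and late enough for the time modulus of the scheme
      to apply.\<close>
    have cont: "((\<lambda>s. \<integral>y. \<bar>v s y - v t y\<bar> \<partial>lborel) \<longlongrightarrow> 0) (at t within {0..h})" if t: "t \<in> {0..h}" for t
    proof (rule tendstoI)
      fix e :: real assume e: "e > 0"
      have e6: "e / 6 > 0" using e by simp
      obtain N1 where N1: "\<And>n t. n \<ge> N1 \<Longrightarrow> t \<in> {0..h} \<Longrightarrow> L1d (appr a B (r (s n)) u t) (v t) \<le> ennreal (e/6)"
        using lim[OF e6] by blast
      obtain d N2 where d: "d > 0" "\<And>n s t. n \<ge> N2 \<Longrightarrow> s \<in> {0..h} \<Longrightarrow> t \<in> {0..h} \<Longrightarrow> \<bar>s - t\<bar> < d \<Longrightarrow>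
          L1d (appr a B (r n) u s) (appr a B (r n) u t) \<le> ennreal (e/6)"
        using time[OF e6] by blast
      define n where "n = max N1 N2"
      define V where "V = appr a B (r (s n)) u"
      have [measurable]: "V t \<in> borel_measurable borel" for t unfolding V_def by measurable
      have sn: "N2 \<le> s n" using seq_suble[OF s(1), of n] by (simp add: n_def)
      have "dist (\<integral>y. \<bar>v q y - v t y\<bar> \<partial>lborel) 0 < e" if q: "q \<in> {0..h}" "dist q t < d" for q
      proof -
        have "L1d (v q) (v t) \<le> L1d (v q) (V q) + L1d (V q) (v t)" by (rule L1d_triangle) auto
        also have "L1d (V q) (v t) \<le> L1d (V q) (V t) + L1d (V t) (v t)" by (rule L1d_triangle) auto
        finally have "L1d (v q) (v t) \<le> L1d (v q) (V q) + (L1d (V q) (V t) + L1d (V t) (v t))" by (simp add: add_left_mono)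
        also have "\<dots> \<le> ennreal (e/6) + (ennreal (e/6) + ennreal (e/6))"
          using N1[of n q] N1[of n t] d(2)[OF sn q(1) t] q t
          by (intro add_mono) (auto simp: V_def n_def dist_real_def L1d_commute)
        also have "\<dots> = ennreal (e/2)" using e by (simp flip: ennreal_plus)
        finally have "ennreal (\<integral>y. \<bar>v q y - v t y\<bar> \<partial>lborel) \<le> ennreal (e/2)"
          using vi q t by (simp add: L1d_integral)
        then have "(\<integral>y. \<bar>v q y - v t y\<bar> \<partial>lborel) \<le> e/2" using e by (simp add: ennreal_le_iff)
        then show ?thesis using e by (simp add: dist_real_def)
      qed
      then show "\<forall>\<^sub>F q in at t within {0..h}. dist (\<integral>y. \<bar>v q y - v t y\<bar> \<partial>lborel) 0 < e"
        unfolding eventually_at using d(1) by blast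
    qed
    show ?thesis unfolding Cb_L1_def using vi bound cont by blast
  qed
  show ?thesis by (rule that[OF s(1) cb sol lim])
qed

text \<open>The subsequence principle: infinitely many indices violating the bound would form a
  sequence with a further subsequence converging to a solution, and by uniqueness this solution
  agrees with \<open>w\<close> almost everywhere at each time.\<close>

lemma appr_converges:
  fixes F :: "real \<Rightarrow> 'a::euclidean_space"
  defines "a \<equiv> (\<lambda>v. vector_derivative F (at v))"
  assumes F: "C1_fun F" and B: "0 \<le> B" and h: "0 < h"
    and u: "integrable lborel u" and uB: "\<And>x. \<bar>u x\<bar> \<le> B"
    and uniq: "\<And>z. Cb_L1 h z \<Longrightarrow> weak_sol h F z u \<Longrightarrow> entropy_ineq h F z u \<Longrightarrow> \<forall>t\<in>{0..h}. AE x in lborel. z t x = w t x"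
    and e: "e > 0"
  shows "\<exists>N. \<forall>n\<ge>N. \<forall>t\<in>{0..h}. L1d (appr a B n u t) (w t) \<le> ennreal e"
proof (rule ccontr)
  define bad where "bad = {n. \<exists>t\<in>{0..h}. \<not> L1d (appr a B n u t) (w t) \<le> ennreal e}"
  assume "\<not> ?thesis"
  then have "\<forall>N. \<exists>n\<ge>N. n \<in> bad" unfolding bad_def by blast
  then have "infinite bad" by (simp add: infinite_nat_iff_unbounded_le)
  then obtain r :: "nat \<Rightarrow> nat" where r: "strict_mono r" "\<And>n. r n \<in> bad"
    using infinite_enumerate by blast
  show False
  proof (rule appr_subsequence_limit[OF F B h u uB r(1), folded a_def])
    fix s :: "nat \<Rightarrow> nat" and v assume s: "strict_mono s" and v: "Cb_L1 h v" "weak_sol h F v u" "entropy_ineq h F v u"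
      and lim: "\<And>e. e > 0 \<Longrightarrow> \<exists>N. \<forall>n\<ge>N. \<forall>t\<in>{0..h}. L1d (appr a B (r (s n)) u t) (v t) \<le> ennreal e"
    obtain N where N: "\<And>t. t \<in> {0..h} \<Longrightarrow> L1d (appr a B (r (s N)) u t) (v t) \<le> ennreal e"
      using lim[OF e] by (meson order_refl)
    have "L1d (appr a B (r (s N)) u t) (w t) \<le> ennreal e" if t: "t \<in> {0..h}" for t
    proof -
      have ae: "AE x in lborel. v t x = w t x" using uniq[OF v] t by blast
      have "L1d (appr a B (r (s N)) u t) (w t) = L1d (appr a B (r (s N)) u t) (v t)"
        unfolding L1d_def by (rule nn_integral_cong_AE) (use ae in \<open>auto elim: AE_mp\<close>)
      then show ?thesis using N[OF t] by simp
    qed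
    then show False using r(2)[of "s N"] by (auto simp: bad_def)
  qed
qed

section \<open>Localisation in the parameter\<close>

lemma AE_lborel_snd:
  assumes "AE w in (lborel :: 'w::euclidean_space measure). P w"
  shows "AE y in (lborel :: ('x::euclidean_space \<times> 'w) measure). P (snd y)"
proof -
  obtain N where N: "{w \<in> space lborel. \<not> P w} \<subseteq> N" "emeasure lborel N = 0" "N \<in> sets (lborel :: 'w measure)"
    using assms by (rule AE_E)
  have "emeasure (lborel \<Otimes>\<^sub>M lborel) ((UNIV :: 'x set) \<times> N) = emeasure lborel (UNIV :: 'x set) * emeasure lborel N"
    using N(3) by (intro lborel.emeasure_pair_measure_Times) auto
  then have "emeasure lborel ((UNIV :: 'x set) \<times> N) = 0" using N(2) by (simp add: lborel_prod)
  moreover have "(UNIV :: 'x set) \<times> N \<in> sets lborel"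
    using N(3) by (subst lborel_prod[symmetric]) (intro pair_measureI, auto)
  ultimately show ?thesis using N(1) by (intro AE_I[of _ _ "UNIV \<times> N"]) auto
qed

lemma AE_lborel_slices:
  assumes "AE y in (lborel :: ('x::euclidean_space \<times> 'w::euclidean_space) measure). P y"
  shows "AE w in lborel. AE x in lborel. P (x, w)"
proof -
  obtain N where N: "{y \<in> space lborel. \<not> P y} \<subseteq> N" "emeasure lborel N = 0" "N \<in> sets (lborel :: ('x \<times> 'w) measure)"
    using assms by (rule AE_E)
  have Ns: "N \<in> sets (lborel \<Otimes>\<^sub>M lborel)" unfolding lborel_prod by (rule N(3))
  have "0 = (\<integral>\<^sup>+w. emeasure lborel ((\<lambda>x. (x, w)) -` N) \<partial>lborel)"
    using lborel_pair.emeasure_pair_measure_alt2[OF Ns] N(2) by (simp add: lborel_prod)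
  moreover have "(\<lambda>w. emeasure lborel ((\<lambda>x. (x, w)) -` N)) \<in> borel_measurable lborel"
    by (rule lborel_pair.measurable_emeasure_Pair2[OF Ns])
  ultimately have ae: "AE w in lborel. emeasure lborel ((\<lambda>x. (x, w)) -` N) = 0"
    by (simp add: nn_integral_0_iff_AE)
  show ?thesis
  proof (rule AE_mp[OF ae], rule AE_I2, rule impI)
    fix w assume 0: "emeasure lborel ((\<lambda>x. (x, w)) -` N) = 0"
    have "(\<lambda>x. (x, w)) -` N \<in> sets lborel" using sets_Pair2[OF Ns] .
    then show "AE x in lborel. P (x, w)" using 0 N(1) by (intro AE_I[of _ _ "(\<lambda>x. (x, w)) -` N"]) auto
  qed
qed

text \<open>Mollify the indicator of \<open>A\<close> and exchange the integrals.\<close>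

lemma nonneg_on_sets_bounded:
  fixes g :: "'b::euclidean_space \<Rightarrow> real" and k :: "'c::euclidean_space \<Rightarrow> real"
    and \<pi> :: "'b \<Rightarrow> 'w::euclidean_space" and \<rho> :: "'c \<Rightarrow> 'w"
  assumes g: "integrable lborel g" and k: "integrable lborel k"
    and [measurable]: "\<pi> \<in> borel_measurable borel" "\<rho> \<in> borel_measurable borel"
    and \<pi>: "\<And>P. AE w in lborel. P w \<Longrightarrow> AE p in lborel. P (\<pi> p)" and \<rho>: "\<And>P. AE w in lborel. P w \<Longrightarrow> AE p in lborel. P (\<rho> p)"
    and nonneg: "\<And>\<theta> E. (\<And>w. 0 \<le> \<theta> w) \<Longrightarrow> continuous_on UNIV E \<Longrightarrow> (\<And>w. (\<theta> has_derivative blinfun_apply (E w)) (at w)) \<Longrightarrow>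
        0 \<le> (\<integral>p. \<theta> (\<pi> p) * g p \<partial>lborel) + (\<integral>y. \<theta> (\<rho> y) * k y \<partial>lborel)"
    and A[measurable]: "A \<in> sets borel" and Ab: "bounded A"
  shows "0 \<le> (\<integral>p. indicator A (\<pi> p) * g p \<partial>lborel) + (\<integral>y. indicator A (\<rho> y) * k y \<partial>lborel)"
proof -
  have gm[measurable]: "g \<in> borel_measurable borel" "k \<in> borel_measurable borel" using g k by auto
  have Ai: "integrable lborel (indicator A :: 'w \<Rightarrow> real)"
    using emeasure_bounded_finite[OF Ab] by (intro integrable_real_indicator) auto
  have "\<forall>j. \<exists>(\<kappa> :: 'w \<Rightarrow> real) C E. \<kappa> \<in> borel_measurable borel \<and> (\<forall>y. 0 \<le> \<kappa> y) \<and> (\<forall>y. \<kappa> y \<le> C) \<and> (\<integral>\<^sup>+y. ennreal (\<kappa> y) \<partial>lborel) = 1 \<and>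
      (\<forall>y. inverse (real (Suc j)) \<le> norm y \<longrightarrow> \<kappa> y = 0) \<and> continuous_on UNIV E \<and> (\<forall>y. (\<kappa> has_derivative blinfun_apply (E y)) (at y))"
  proof
    fix j
    show "\<exists>(\<kappa> :: 'w \<Rightarrow> real) C E. \<kappa> \<in> borel_measurable borel \<and> (\<forall>y. 0 \<le> \<kappa> y) \<and> (\<forall>y. \<kappa> y \<le> C) \<and> (\<integral>\<^sup>+y. ennreal (\<kappa> y) \<partial>lborel) = 1 \<and>
      (\<forall>y. inverse (real (Suc j)) \<le> norm y \<longrightarrow> \<kappa> y = 0) \<and> continuous_on UNIV E \<and> (\<forall>y. (\<kappa> has_derivative blinfun_apply (E y)) (at y))"
      by (rule ex_C1_kernel[of "inverse (real (Suc j))", where ?'a='w]) (simp, blast)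
  qed
  then obtain \<kappa> :: "nat \<Rightarrow> 'w \<Rightarrow> real" and C E where
    \<kappa>m [measurable]: "\<And>j. \<kappa> j \<in> borel_measurable borel" and \<kappa>: "\<And>j y. 0 \<le> \<kappa> j y" "\<And>j y. \<kappa> j y \<le> C j"
      "\<And>j. (\<integral>\<^sup>+y. ennreal (\<kappa> j y) \<partial>lborel) = 1" "\<And>j y. inverse (real (Suc j)) \<le> norm y \<Longrightarrow> \<kappa> j y = 0"
    and E: "\<And>j. continuous_on UNIV (E j)" "\<And>j y. (\<kappa> j has_derivative blinfun_apply (E j y)) (at y)"
    by metis
  have \<kappa>i: "integrable lborel (\<kappa> j)" "integral\<^sup>L lborel (\<kappa> j) = 1" for j
  proof -
    show "integrable lborel (\<kappa> j)" using \<kappa> by (intro integrableI_nonneg) auto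
    then show "integral\<^sup>L lborel (\<kappa> j) = 1" using \<kappa> by (subst integral_eq_nn_integral) auto
  qed
  define m where "m j = avg (\<kappa> j) (indicator A)" for j
  have [measurable]: "m j \<in> borel_measurable borel" for j unfolding m_def by measurable
  have mb: "\<bar>m j w\<bar> \<le> 1" for j w
    unfolding m_def by (rule avg_bound) (auto intro: \<kappa>i \<kappa> split: split_indicator)
  \<comment> \<open>After the substitution \<open>z = w + y\<close> the variable \<open>w\<close>
    occurs only in the kernel, so for each \<open>z\<close> the integrand is an admissible C1 weight
    in \<open>w\<close>.\<close>
  have m_shift: "m j w = (\<integral>z. indicator A z * \<kappa> j (z - w) \<partial>lborel)" for j w
    using integral_lborel_shift[of "\<lambda>z. indicator A z * \<kappa> j (z - w)" w] by (simp add: m_def avg_def mult.commute)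
  \<comment> \<open>One exchange of integrals serves both terms: \<open>g\<close> with
    \<open>\<pi>\<close> on space-time, and \<open>k\<close> with \<open>\<rho>\<close> at the
    initial time.\<close>
  have fub: "integrable lborel (\<lambda>z. indicator A z * (\<integral>p. \<kappa> j (z - q p) * f p \<partial>lborel))"
    "(\<integral>z. indicator A z * (\<integral>p. \<kappa> j (z - q p) * f p \<partial>lborel) \<partial>lborel) = (\<integral>p. m j (q p) * f p \<partial>lborel)"
    if f: "integrable lborel f" and [measurable]: "q \<in> borel_measurable borel"
    for f :: "'e::euclidean_space \<Rightarrow> real" and q :: "'e \<Rightarrow> 'w" and j
  proof -
    have [measurable]: "f \<in> borel_measurable borel" using f by auto
    have base: "integrable (lborel \<Otimes>\<^sub>M lborel) (\<lambda>(z, p). indicator A z * f p)"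
    proof (rule lborel_pair.Fubini_integrable)
      show "(\<lambda>(z, p). indicator A z * f p) \<in> borel_measurable (lborel \<Otimes>\<^sub>M lborel)" by measurable
      show "integrable lborel (\<lambda>z. \<integral>p. norm (case (z, p) of (z, p) \<Rightarrow> indicator A z * f p) \<partial>lborel)"
        using Ai by (simp add: abs_mult)
    qed (use f in auto)
    have i: "integrable (lborel \<Otimes>\<^sub>M lborel) (\<lambda>(z, p). indicator A z * (\<kappa> j (z - q p) * f p))"
    proof (rule Bochner_Integration.integrable_bound[of _ "\<lambda>x. C j * (case x of (z, p) \<Rightarrow> indicator A z * f p)"])
      show "integrable (lborel \<Otimes>\<^sub>M lborel) (\<lambda>x. C j * (case x of (z, p) \<Rightarrow> indicator A z * f p))"
        using base by (rule integrable_mult_right)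
      show "(\<lambda>(z, p). indicator A z * (\<kappa> j (z - q p) * f p)) \<in> borel_measurable (lborel \<Otimes>\<^sub>M lborel)" by measurable
      show "AE x in lborel \<Otimes>\<^sub>M lborel. norm (case x of (z, p) \<Rightarrow> indicator A z * (\<kappa> j (z - q p) * f p))
         \<le> norm (C j * (case x of (z, p) \<Rightarrow> indicator A z * f p))"
      proof (intro AE_I2, clarsimp simp: abs_mult)
        fix z p
        have "\<kappa> j (z - q p) * \<bar>f p\<bar> \<le> \<bar>C j\<bar> * \<bar>f p\<bar>"
          using \<kappa>(2)[of j "z - q p"] by (intro mult_right_mono) auto
        then show "indicator A z * (\<bar>\<kappa> j (z - q p)\<bar> * \<bar>f p\<bar>) \<le> \<bar>C j\<bar> * (indicator A z * \<bar>f p\<bar>)"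
          using \<kappa>(1)[of j "z - q p"] by (auto split: split_indicator)
      qed
    qed
    show "integrable lborel (\<lambda>z. indicator A z * (\<integral>p. \<kappa> j (z - q p) * f p \<partial>lborel))"
      using lborel_pair.integrable_fst[OF i] by simp
    have "(\<integral>z. indicator A z * (\<integral>p. \<kappa> j (z - q p) * f p \<partial>lborel) \<partial>lborel)
       = (\<integral>p. \<integral>z. indicator A z * (\<kappa> j (z - q p) * f p) \<partial>lborel \<partial>lborel)"
      using lborel_pair.Fubini_integral[OF i] by simp
    also have "\<dots> = (\<integral>p. m j (q p) * f p \<partial>lborel)"
      unfolding m_shift by (simp flip: mult.assoc)
    finally show "(\<integral>z. indicator A z * (\<integral>p. \<kappa> j (z - q p) * f p \<partial>lborel) \<partial>lborel) = (\<integral>p. m j (q p) * f p \<partial>lborel)" .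
  qed
  \<comment> \<open>The hypothesis is applied to the weight \<open>\<kappa> j (z - w)\<close> for
    each \<open>z\<close> and integrated over \<open>z \<in> A\<close>; what arises is the mollified
    indicator of \<open>A\<close>.\<close>
  have mol: "0 \<le> (\<integral>p. m j (\<pi> p) * g p \<partial>lborel) + (\<integral>y. m j (\<rho> y) * k y \<partial>lborel)" for j
  proof -
    have "0 \<le> (\<integral>p. \<kappa> j (z - \<pi> p) * g p \<partial>lborel) + (\<integral>y. \<kappa> j (z - \<rho> y) * k y \<partial>lborel)" for z
    proof (rule nonneg[of "\<lambda>w. \<kappa> j (z - w)" "\<lambda>w. - E j (z - w)"])
      show "continuous_on UNIV (\<lambda>w. - E j (z - w))"
        by (intro continuous_intros continuous_on_compose2[OF E(1)]) auto
      fix w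
      have "((\<lambda>w. z - w) has_derivative (\<lambda>h. - h)) (at w)" by (auto intro!: derivative_eq_intros)
      from has_derivative_compose[OF this E(2)]
      have "((\<lambda>w. \<kappa> j (z - w)) has_derivative (\<lambda>h. blinfun_apply (E j (z - w)) (- h))) (at w)" .
      then show "((\<lambda>w. \<kappa> j (z - w)) has_derivative blinfun_apply (- E j (z - w))) (at w)"
        by (simp add: blinfun.minus_left blinfun.minus_right uminus_blinfun.rep_eq)
    qed (rule \<kappa>)
    then have "0 \<le> (\<integral>z. indicator A z * (\<integral>p. \<kappa> j (z - \<pi> p) * g p \<partial>lborel) + indicator A z * (\<integral>y. \<kappa> j (z - \<rho> y) * k y \<partial>lborel) \<partial>lborel)"
      by (intro integral_nonneg_AE AE_I2) (simp flip: distrib_left)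
    also have "\<dots> = (\<integral>z. indicator A z * (\<integral>p. \<kappa> j (z - \<pi> p) * g p \<partial>lborel) \<partial>lborel)
        + (\<integral>z. indicator A z * (\<integral>y. \<kappa> j (z - \<rho> y) * k y \<partial>lborel) \<partial>lborel)"
      by (intro Bochner_Integration.integral_add fub g k) measurable
    also have "\<dots> = (\<integral>p. m j (\<pi> p) * g p \<partial>lborel) + (\<integral>y. m j (\<rho> y) * k y \<partial>lborel)"
      by (simp add: fub g k)
    finally show ?thesis .
  qed
  have mi: "integrable lborel (\<lambda>w. m j w - indicator A w)"
    and L1: "(\<lambda>j. \<integral>w. norm (m j w - indicator A w) \<partial>lborel) \<longlonglongrightarrow> 0" for j
  proof -
    have small: "\<exists>N. \<forall>j\<ge>N. L1d (m j) (indicator A) \<le> ennreal e" if "e > 0" for e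
    proof -
      obtain d where d: "d > 0" "\<And>y. norm y < d \<Longrightarrow> L1d (\<lambda>x. indicator A (x + y)) (indicator A) \<le> ennreal e"
        using L1d_translation_tendsto[OF Ai \<open>e > 0\<close>] by blast
      obtain N where N: "inverse (real (Suc N)) < d" using reals_Archimedean[OF d(1)] by blast
      have "L1d (m j) (indicator A) \<le> ennreal e" if "j \<ge> N" for j
        unfolding m_def
      proof (rule L1d_avg[of _ "C j" "inverse (real (Suc j))"])
        have "inverse (real (Suc j)) \<le> inverse (real (Suc N))" using that by (intro le_imp_inverse_le) auto
        then show "L1d (\<lambda>x. indicator A (x + y)) (indicator A) \<le> ennreal e" if "norm y < inverse (real (Suc j))" for y
          using that N by (intro d(2)) linarith
      qed (use \<kappa> Ai in auto)
      then show ?thesis by blast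
    qed
    \<comment> \<open>Smallness of the distance is known only for late \<open>j\<close>; for
      integrability at every \<open>j\<close> the crude bound by twice the measure of
      \<open>A\<close> suffices.\<close>
    have fin: "integrable lborel (\<lambda>w. m j w - indicator A w)" for j
    proof -
      obtain d where d: "d > 0" "\<And>y. norm y < d \<Longrightarrow> L1d (\<lambda>x. indicator A (x + y)) (indicator A) \<le> ennreal 1"
        using L1d_translation_tendsto[OF Ai, of 1] by auto
      have "L1d (m j) (indicator A) \<le> ennreal (2 * (\<integral>x. indicator A x \<partial>lborel))"
        unfolding m_def
      proof (rule L1d_avg[of _ "C j" "inverse (real (Suc j))"])
        fix y :: 'w
        have "L1d (\<lambda>x. indicator A (x + y)) (indicator A) \<le> L1d (\<lambda>x. indicator A (x + y)) (\<lambda>x. (\<lambda>_. 0) (x + y)) + L1d (\<lambda>_. 0) (indicator A)"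
          by (rule L1d_triangle) auto
        also have "\<dots> = L1d (indicator A) (\<lambda>_. 0) + L1d (indicator A) (\<lambda>_. 0)"
          by (subst L1d_shift) (auto simp: L1d_commute)
        also have "\<dots> = ennreal (2 * (\<integral>x. indicator A x \<partial>lborel))"
          using L1d_integral[OF Ai, of "\<lambda>_. 0"] by (simp flip: ennreal_plus)
        finally show "L1d (\<lambda>x. indicator A (x + y)) (indicator A) \<le> ennreal (2 * (\<integral>x. indicator A x \<partial>lborel))" .
      qed (use \<kappa> Ai in auto)
      then have "L1d (m j) (indicator A) < \<infinity>" by (rule le_less_trans) simp
      then show ?thesis unfolding L1d_def by (intro integrableI_bounded) auto
    qed
    show "integrable lborel (\<lambda>w. m j w - indicator A w)" by (rule fin)
    have eq: "L1d (m j) (indicator A) = ennreal (\<integral>w. norm (m j w - indicator A w) \<partial>lborel)" for j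
      unfolding L1d_def using fin[of j] by (subst nn_integral_eq_integral) auto
    show "(\<lambda>j. \<integral>w. norm (m j w - indicator A w) \<partial>lborel) \<longlonglongrightarrow> 0"
    proof (rule LIMSEQ_I)
      fix r :: real assume r: "0 < r"
      obtain N where N: "\<And>j. j \<ge> N \<Longrightarrow> L1d (m j) (indicator A) \<le> ennreal (r/2)" using small[of "r/2"] r by auto
      have "norm ((\<integral>w. norm (m j w - indicator A w) \<partial>lborel) - 0) < r" if "j \<ge> N" for j
        using N[OF that] r unfolding eq by (simp add: ennreal_le_iff)
      then show "\<exists>no. \<forall>n\<ge>no. norm ((\<integral>w. norm (m n w - indicator A w) \<partial>lborel) - 0) < r" by blast
    qed
  qed
  \<comment> \<open>L1 convergence yields convergence almost everywhere only along a subsequence.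
    The null set lies in parameter space, and \<open>\<pi>\<close> and \<open>\<rho>\<close> pull
    null sets back to null sets.\<close>
  obtain r where r: "strict_mono (r :: nat \<Rightarrow> nat)" "AE w in lborel. (\<lambda>j. m (r j) w - indicator A w) \<longlonglongrightarrow> 0"
    using tendsto_L1_AE_subseq[OF mi L1] by blast
  have ae: "AE w in lborel. (\<lambda>j. m (r j) w) \<longlonglongrightarrow> indicator A w"
    using r(2) by eventually_elim (simp add: LIM_zero_iff)
  have lim: "(\<lambda>j. \<integral>p. m (r j) (q p) * f p \<partial>lborel) \<longlonglongrightarrow> (\<integral>p. indicator A (q p) * f p \<partial>lborel)"
    if f: "integrable lborel f" and [measurable]: "q \<in> borel_measurable borel" and aeq: "AE p in lborel. (\<lambda>j. m (r j) (q p)) \<longlonglongrightarrow> indicator A (q p)"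
    for f :: "'e::euclidean_space \<Rightarrow> real" and q :: "'e \<Rightarrow> 'w"
  proof (rule integral_dominated_convergence[where w="\<lambda>p. \<bar>f p\<bar>"])
    have [measurable]: "f \<in> borel_measurable borel" using f by auto
    show "(\<lambda>p. indicator A (q p) * f p) \<in> borel_measurable lborel" "\<And>i. (\<lambda>p. m (r i) (q p) * f p) \<in> borel_measurable lborel" by measurable
    show "AE p in lborel. (\<lambda>i. m (r i) (q p) * f p) \<longlonglongrightarrow> indicator A (q p) * f p"
      using aeq by eventually_elim (intro tendsto_intros)
    show "AE p in lborel. norm (m (r i) (q p) * f p) \<le> \<bar>f p\<bar>" for i
      using mb by (intro AE_I2) (simp add: abs_mult mult_left_le_one_le)
  qed (use f in auto)
  have "(\<lambda>j. (\<integral>p. m (r j) (\<pi> p) * g p \<partial>lborel) + (\<integral>y. m (r j) (\<rho> y) * k y \<partial>lborel))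
     \<longlonglongrightarrow> (\<integral>p. indicator A (\<pi> p) * g p \<partial>lborel) + (\<integral>y. indicator A (\<rho> y) * k y \<partial>lborel)"
    by (intro tendsto_add lim g k \<pi>[OF ae] \<rho>[OF ae]) measurable
  then show ?thesis by (rule LIMSEQ_le_const) (use mol in auto)
qed

text \<open>Mollification required an integrable indicator, hence a bounded set. A general
  \<open>A\<close> is exhausted by its intersections with balls, with \<open>\<bar>g\<bar>\<close>
  and \<open>\<bar>k\<bar>\<close> as majorants.\<close>

lemma nonneg_on_sets:
  fixes g :: "'b::euclidean_space \<Rightarrow> real" and k :: "'c::euclidean_space \<Rightarrow> real"
    and \<pi> :: "'b \<Rightarrow> 'w::euclidean_space" and \<rho> :: "'c \<Rightarrow> 'w"
  assumes g: "integrable lborel g" and k: "integrable lborel k"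
    and [measurable]: "\<pi> \<in> borel_measurable borel" "\<rho> \<in> borel_measurable borel"
    and \<pi>: "\<And>P. AE w in lborel. P w \<Longrightarrow> AE p in lborel. P (\<pi> p)" and \<rho>: "\<And>P. AE w in lborel. P w \<Longrightarrow> AE p in lborel. P (\<rho> p)"
    and nonneg: "\<And>\<theta> E. (\<And>w. 0 \<le> \<theta> w) \<Longrightarrow> continuous_on UNIV E \<Longrightarrow> (\<And>w. (\<theta> has_derivative blinfun_apply (E w)) (at w)) \<Longrightarrow>
        0 \<le> (\<integral>p. \<theta> (\<pi> p) * g p \<partial>lborel) + (\<integral>y. \<theta> (\<rho> y) * k y \<partial>lborel)"
    and A[measurable]: "A \<in> sets borel"
  shows "0 \<le> (\<integral>p. indicator A (\<pi> p) * g p \<partial>lborel) + (\<integral>y. indicator A (\<rho> y) * k y \<partial>lborel)"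
proof -
  have lim: "(\<lambda>j. \<integral>p. indicator (A \<inter> cball 0 (real j)) (q p) * f p \<partial>lborel) \<longlonglongrightarrow> (\<integral>p. indicator A (q p) * f p \<partial>lborel)"
    if f: "integrable lborel f" and [measurable]: "q \<in> borel_measurable borel"
    for f :: "'e::euclidean_space \<Rightarrow> real" and q :: "'e \<Rightarrow> 'w"
  proof (rule integral_dominated_convergence[where w="\<lambda>p. \<bar>f p\<bar>"])
    have [measurable]: "f \<in> borel_measurable borel" using f by auto
    have [measurable]: "A \<inter> cball 0 (real j) \<in> sets borel" for j by auto
    show "(\<lambda>p. indicator A (q p) * f p) \<in> borel_measurable lborel"
       "\<And>i. (\<lambda>p. indicator (A \<inter> cball 0 (real i)) (q p) * f p) \<in> borel_measurable lborel" by measurable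
    show "AE p in lborel. (\<lambda>i. indicator (A \<inter> cball 0 (real i)) (q p) * f p) \<longlonglongrightarrow> indicator A (q p) * f p"
    proof (intro AE_I2 tendsto_eventually)
      fix p
      obtain N :: nat where "norm (q p) \<le> real N" using real_arch_simple by blast
      then have "indicator (A \<inter> cball 0 (real i)) (q p) * f p = indicator A (q p) * f p" if "i \<ge> N" for i
        using that by (auto split: split_indicator)
      then show "\<forall>\<^sub>F i in sequentially. indicator (A \<inter> cball 0 (real i)) (q p) * f p = indicator A (q p) * f p"
        using eventually_ge_at_top[of N] by (rule eventually_mono[rotated])
    qed
    show "AE p in lborel. norm (indicator (A \<inter> cball 0 (real i)) (q p) * f p) \<le> \<bar>f p\<bar>" for i
      by (intro AE_I2) (auto split: split_indicator)
  qed (use f in auto)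
  have "0 \<le> (\<integral>p. indicator (A \<inter> cball 0 (real j)) (\<pi> p) * g p \<partial>lborel) + (\<integral>y. indicator (A \<inter> cball 0 (real j)) (\<rho> y) * k y \<partial>lborel)" for j
    by (rule nonneg_on_sets_bounded[OF g k _ _ \<pi> \<rho> nonneg]) auto
  moreover have "(\<lambda>j. (\<integral>p. indicator (A \<inter> cball 0 (real j)) (\<pi> p) * g p \<partial>lborel) + (\<integral>y. indicator (A \<inter> cball 0 (real j)) (\<rho> y) * k y \<partial>lborel))
     \<longlonglongrightarrow> (\<integral>p. indicator A (\<pi> p) * g p \<partial>lborel) + (\<integral>y. indicator A (\<rho> y) * k y \<partial>lborel)"
    by (intro tendsto_add lim g k) auto
  ultimately show ?thesis by (intro LIMSEQ_le_const) auto
qed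

text \<open>The support of the product stays inside \<open>K\<close>, so \<open>\<theta>\<close> may
  be any C1 function of the parameter.\<close>

lemma c1_test_times:
  fixes \<phi> :: "real \<times> ('x::euclidean_space \<times> 'w::euclidean_space) \<Rightarrow> real"
  assumes "c1_test \<phi> D K h" and E: "continuous_on UNIV E" "\<And>w. (\<theta> has_derivative blinfun_apply (E w)) (at w)"
  shows "c1_test (\<lambda>p. \<phi> p * \<theta> (snd (snd p)))
     (\<lambda>p. \<theta> (snd (snd p)) *\<^sub>R D p + \<phi> p *\<^sub>R (E (snd (snd p)) o\<^sub>L (snd_blinfun o\<^sub>L snd_blinfun))) K h"
proof -
  interpret c1_test \<phi> D K h by fact
  have \<theta>c: "continuous_on UNIV \<theta>"
    by (intro continuous_at_imp_continuous_on ballI has_derivative_continuous[OF E(2)])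
  show ?thesis
  proof
    show "continuous_on UNIV (\<lambda>p. \<theta> (snd (snd p)) *\<^sub>R D p + \<phi> p *\<^sub>R (E (snd (snd p)) o\<^sub>L (snd_blinfun o\<^sub>L snd_blinfun)))"
      by (intro continuous_intros D_cont phi_cont bounded_bilinear.continuous_on[OF bounded_bilinear_blinfun_compose]
          continuous_on_compose2[OF \<theta>c] continuous_on_compose2[OF E(1)]) auto
    fix p :: "real \<times> ('x \<times> 'w)"
    have "((\<lambda>p. snd (snd p)) has_derivative (\<lambda>p. snd (snd p))) (at p)"
      by (auto intro!: derivative_eq_intros)
    from has_derivative_compose[OF this E(2)]
    have "((\<lambda>p. \<theta> (snd (snd p))) has_derivative (\<lambda>q. blinfun_apply (E (snd (snd p))) (snd (snd q)))) (at p)" .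
    from has_derivative_mult[OF D[of p] this]
    show "((\<lambda>p. \<phi> p * \<theta> (snd (snd p))) has_derivative blinfun_apply
      (\<theta> (snd (snd p)) *\<^sub>R D p + \<phi> p *\<^sub>R (E (snd (snd p)) o\<^sub>L (snd_blinfun o\<^sub>L snd_blinfun)))) (at p)"
      by (rule has_derivative_eq_rhs) (simp add: fun_eq_iff blinfun.add_left blinfun.scaleR_left snd_blinfun.rep_eq mult.commute)
  qed (use K outside h_pos in auto)
qed

text \<open>The derivative of \<open>\<theta>\<close> appears only in the parameter directions,
  where it is paired with \<open>snd (Q v) = 0\<close>, and \<open>\<theta>\<close> does not depend
  on time. Hence \<open>\<theta>\<close> factors out; this is where the vanishing flux components
  make localisation possible.\<close>

lemma production_times:
  fixes \<phi> :: "real \<times> ('x::euclidean_space \<times> 'w::euclidean_space) \<Rightarrow> real"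
  assumes "c1_test \<phi> D K h" and E: "continuous_on UNIV E" "\<And>w. (\<theta> has_derivative blinfun_apply (E w)) (at w)"
    and Q: "\<And>v. snd (Q v) = 0"
  shows "entropy_production h \<eta> Q (\<lambda>p. \<phi> p * \<theta> (snd (snd p))) u = (\<lambda>p. \<theta> (snd (snd p)) * entropy_production h \<eta> Q \<phi> u p)"
proof -
  interpret c1_test \<phi> D K h by fact
  interpret t: c1_test "\<lambda>p. \<phi> p * \<theta> (snd (snd p))"
     "\<lambda>p. \<theta> (snd (snd p)) *\<^sub>R D p + \<phi> p *\<^sub>R (E (snd (snd p)) o\<^sub>L (snd_blinfun o\<^sub>L snd_blinfun))" K h
    by (rule c1_test_times) fact+
  show ?thesis
    by (simp add: fun_eq_iff entropy_production_def dt_test_eq flux_test_eq t.dt_test_eq t.flux_test_eq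
        blinfun.add_left blinfun.scaleR_left snd_blinfun.rep_eq Q algebra_simps)
qed

lemma c1_test_imp_test_fun: "c1_test \<phi> D K h \<Longrightarrow> test_fun h \<phi>"
  unfolding c1_test_def test_fun_def by metis

lemma integrable_indicator_times:
  fixes g :: "'b::euclidean_space \<Rightarrow> real"
  assumes g: "integrable lborel g" and [measurable]: "A \<in> sets borel" "q \<in> borel_measurable borel"
  shows "integrable lborel (\<lambda>p. indicator A (q p :: 'c::euclidean_space) * g p)"
  by (rule integrable_bounded_mult[OF _ _ g, where C=1]) (auto split: split_indicator)

lemma snd_snd_borel: "(\<lambda>p. snd (snd p)) \<in> borel_measurable (borel :: (real \<times> ('x::euclidean_space \<times> 'w::euclidean_space)) measure)"
  by (intro borel_measurable_continuous_onI continuous_intros)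

lemma snd_borel: "snd \<in> borel_measurable (borel :: ('x::euclidean_space \<times> 'w::euclidean_space) measure)"
  by (intro borel_measurable_continuous_onI continuous_intros)

section \<open>Gluing solutions along a Borel set of parameters\<close>

context
  fixes F :: "real \<Rightarrow> 'x::euclidean_space \<times> 'w::euclidean_space" and h :: real and A :: "'w set"
  assumes F: "C1_fun F" and sF: "\<And>v. snd (F v) = 0" and h: "0 < h" and A: "A \<in> sets borel"
begin

abbreviation (input) "glue_u u1 u2 \<equiv> (\<lambda>(t::real) y. if snd y \<in> A then u1 t y else (u2 t y :: real))"
abbreviation (input) "glue_0 v1 v2 \<equiv> (\<lambda>y. if snd y \<in> A then v1 y else (v2 y :: real))"

lemma glue_production:
  assumes i1: "integrable lborel (entropy_production h \<eta> Q \<phi> u1)" "integrable lborel (\<lambda>y. \<eta> (v1 y) * \<phi> (0, y))"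
    and i2: "integrable lborel (entropy_production h \<eta> Q \<phi> u2)" "integrable lborel (\<lambda>y. \<eta> (v2 y) * \<phi> (0, y))"
  shows "integrable lborel (entropy_production h \<eta> Q \<phi> (glue_u u1 u2))"
    and "integrable lborel (\<lambda>y. \<eta> (glue_0 v1 v2 y) * \<phi> (0, y))"
    and "(\<integral>p. entropy_production h \<eta> Q \<phi> (glue_u u1 u2) p \<partial>lborel) + (\<integral>y. \<eta> (glue_0 v1 v2 y) * \<phi> (0, y) \<partial>lborel) =
     ((\<integral>p. indicator A (snd (snd p)) * entropy_production h \<eta> Q \<phi> u1 p \<partial>lborel) + (\<integral>y. indicator A (snd y) * (\<eta> (v1 y) * \<phi> (0, y)) \<partial>lborel))
     + ((\<integral>p. indicator (- A) (snd (snd p)) * entropy_production h \<eta> Q \<phi> u2 p \<partial>lborel) + (\<integral>y. indicator (- A) (snd y) * (\<eta> (v2 y) * \<phi> (0, y)) \<partial>lborel))"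
proof -
  have A': "- A \<in> sets borel" using A by auto
  have e1: "entropy_production h \<eta> Q \<phi> (glue_u u1 u2) = (\<lambda>p. indicator A (snd (snd p)) * entropy_production h \<eta> Q \<phi> u1 p
      + indicator (- A) (snd (snd p)) * entropy_production h \<eta> Q \<phi> u2 p)"
    by (auto simp: fun_eq_iff entropy_production_def)
  have e2: "(\<lambda>y. \<eta> (glue_0 v1 v2 y) * \<phi> (0, y)) = (\<lambda>y. indicator A (snd y) * (\<eta> (v1 y) * \<phi> (0, y)) + indicator (- A) (snd y) * (\<eta> (v2 y) * \<phi> (0, y)))"
    by (auto simp: fun_eq_iff)
  note ii = integrable_indicator_times[OF i1(1) A snd_snd_borel] integrable_indicator_times[OF i2(1) A' snd_snd_borel]
    integrable_indicator_times[OF i1(2) A snd_borel] integrable_indicator_times[OF i2(2) A' snd_borel]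
  show "integrable lborel (entropy_production h \<eta> Q \<phi> (glue_u u1 u2))"
    unfolding e1 by (intro Bochner_Integration.integrable_add ii)
  show "integrable lborel (\<lambda>y. \<eta> (glue_0 v1 v2 y) * \<phi> (0, y))"
    unfolding e2 by (intro Bochner_Integration.integrable_add ii)
  show "(\<integral>p. entropy_production h \<eta> Q \<phi> (glue_u u1 u2) p \<partial>lborel) + (\<integral>y. \<eta> (glue_0 v1 v2 y) * \<phi> (0, y) \<partial>lborel) =
     ((\<integral>p. indicator A (snd (snd p)) * entropy_production h \<eta> Q \<phi> u1 p \<partial>lborel) + (\<integral>y. indicator A (snd y) * (\<eta> (v1 y) * \<phi> (0, y)) \<partial>lborel))
     + ((\<integral>p. indicator (- A) (snd (snd p)) * entropy_production h \<eta> Q \<phi> u2 p \<partial>lborel) + (\<integral>y. indicator (- A) (snd y) * (\<eta> (v2 y) * \<phi> (0, y)) \<partial>lborel))"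
    unfolding e1 e2 Bochner_Integration.integral_add[OF ii(1,2)] Bochner_Integration.integral_add[OF ii(3,4)] by simp
qed

text \<open>Testing with \<open>\<phi>\<close> times a nonnegative C1 weight in the parameter gives
  the inequality for all such weights, and from these it passes to indicators.\<close>

lemma localized_nonneg:
  fixes \<phi> :: "real \<times> ('x \<times> 'w) \<Rightarrow> real"
  assumes ent: "entropy_ineq h F u v" and pair: "entropy_pair F \<eta> Q" and \<phi>: "test_fun h \<phi>" "\<And>p. 0 \<le> \<phi> p"
    and Q: "\<And>v. snd (Q v) = 0" and X: "X \<in> sets borel"
  shows "0 \<le> (\<integral>p. indicator X (snd (snd p)) * entropy_production h \<eta> Q \<phi> u p \<partial>lborel) + (\<integral>y. indicator X (snd y) * (\<eta> (v y) * \<phi> (0, y)) \<partial>lborel)"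
proof -
  obtain D K where D: "c1_test \<phi> D K h" by (rule test_funE[OF \<phi>(1) h])
  note e = ent[unfolded entropy_ineq_iff, rule_format]
  show ?thesis
  proof (rule nonneg_on_sets[OF _ _ snd_snd_borel snd_borel _ _ _ X])
    show "integrable lborel (entropy_production h \<eta> Q \<phi> u)" "integrable lborel (\<lambda>y. \<eta> (v y) * \<phi> (0, y))"
      using e[of \<eta> Q \<phi>] pair \<phi> by auto
    fix \<theta> :: "'w \<Rightarrow> real" and E
    assume \<theta>: "\<And>w. 0 \<le> \<theta> w" and E: "continuous_on UNIV E" "\<And>w. (\<theta> has_derivative blinfun_apply (E w)) (at w)"
    have "test_fun h (\<lambda>p. \<phi> p * \<theta> (snd (snd p)))"
      by (rule c1_test_imp_test_fun[OF c1_test_times[OF D E]])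
    then have "0 \<le> (\<integral>p. entropy_production h \<eta> Q (\<lambda>p. \<phi> p * \<theta> (snd (snd p))) u p \<partial>lborel) + (\<integral>y. \<eta> (v y) * (\<phi> (0, y) * \<theta> (snd y)) \<partial>lborel)"
      using e[of \<eta> Q "\<lambda>p. \<phi> p * \<theta> (snd (snd p))"] pair \<phi> \<theta> by auto
    then show "0 \<le> (\<integral>p. \<theta> (snd (snd p)) * entropy_production h \<eta> Q \<phi> u p \<partial>lborel) + (\<integral>y. \<theta> (snd y) * (\<eta> (v y) * \<phi> (0, y)) \<partial>lborel)"
      unfolding production_times[OF D E Q] by (simp add: mult_ac)
  qed (intro AE_lborel_snd | assumption)+
qed

text \<open>The weighted identity holds for C1 weights, so the passage to indicators can be applied
  to the integrands and to their negatives.\<close>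

lemma localized_zero:
  fixes \<phi> :: "real \<times> ('x \<times> 'w) \<Rightarrow> real"
  assumes weak: "weak_sol h F u v" and \<phi>: "test_fun h \<phi>" and X: "X \<in> sets borel"
  shows "(\<integral>p. indicator X (snd (snd p)) * entropy_production h (\<lambda>v. v) F \<phi> u p \<partial>lborel) + (\<integral>y. indicator X (snd y) * (v y * \<phi> (0, y)) \<partial>lborel) = 0"
proof -
  obtain D K where D: "c1_test \<phi> D K h" by (rule test_funE[OF \<phi> h])
  note e = weak[unfolded weak_sol_iff, rule_format]
  have zero: "(\<integral>p. \<theta> (snd (snd p)) * entropy_production h (\<lambda>v. v) F \<phi> u p \<partial>lborel) + (\<integral>y. \<theta> (snd y) * (v y * \<phi> (0, y)) \<partial>lborel) = 0"
    if E: "continuous_on UNIV E" "\<And>w. (\<theta> has_derivative blinfun_apply (E w)) (at w)" for \<theta> E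
  proof -
    have "test_fun h (\<lambda>p. \<phi> p * \<theta> (snd (snd p)))"
      by (rule c1_test_imp_test_fun[OF c1_test_times[OF D E]])
    from e[OF this] show ?thesis
      unfolding production_times[OF D E sF] by (simp add: mult_ac)
  qed
  have "0 \<le> (\<integral>p. indicator X (snd (snd p)) * entropy_production h (\<lambda>v. v) F \<phi> u p \<partial>lborel) + (\<integral>y. indicator X (snd y) * (v y * \<phi> (0, y)) \<partial>lborel)"
  proof (rule nonneg_on_sets[OF _ _ snd_snd_borel snd_borel _ _ _ X])
    show "integrable lborel (entropy_production h (\<lambda>v. v) F \<phi> u)" "integrable lborel (\<lambda>y. v y * \<phi> (0, y))"
      using e[OF \<phi>] by auto
  qed (simp add: zero | intro AE_lborel_snd | assumption)+
  moreover have "0 \<le> (\<integral>p. indicator X (snd (snd p)) * - entropy_production h (\<lambda>v. v) F \<phi> u p \<partial>lborel) + (\<integral>y. indicator X (snd y) * - (v y * \<phi> (0, y)) \<partial>lborel)"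
  proof (rule nonneg_on_sets[OF _ _ snd_snd_borel snd_borel _ _ _ X])
    show "integrable lborel (\<lambda>p. - entropy_production h (\<lambda>v. v) F \<phi> u p)" "integrable lborel (\<lambda>y. - (v y * \<phi> (0, y)))"
      using e[OF \<phi>] by auto
    fix \<theta> :: "'w \<Rightarrow> real" and E
    assume E: "continuous_on UNIV E" "\<And>w. (\<theta> has_derivative blinfun_apply (E w)) (at w)"
    show "0 \<le> (\<integral>p. \<theta> (snd (snd p)) * - entropy_production h (\<lambda>v. v) F \<phi> u p \<partial>lborel) + (\<integral>y. \<theta> (snd y) * - (v y * \<phi> (0, y)) \<partial>lborel)"
      using zero[OF E] by simp
  qed (intro AE_lborel_snd | assumption)+
  ultimately show ?thesis by simp
qed

lemma glue_weak_sol: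
  assumes "weak_sol h F u1 v1" "weak_sol h F u2 v2"
  shows "weak_sol h F (glue_u u1 u2) (glue_0 v1 v2)"
  unfolding weak_sol_iff
proof (intro allI impI)
  fix \<phi> :: "real \<times> ('x \<times> 'w) \<Rightarrow> real" assume \<phi>: "test_fun h \<phi>"
  have A': "- A \<in> sets borel" using A by auto
  note w = assms[unfolded weak_sol_iff, rule_format, OF \<phi>]
  note g = glue_production[of "\<lambda>v. v" F \<phi> u1 v1 u2 v2]
  show "integrable lborel (entropy_production h (\<lambda>v. v) F \<phi> (glue_u u1 u2)) \<and> integrable lborel (\<lambda>y. glue_0 v1 v2 y * \<phi> (0, y)) \<and>
     (\<integral>p. entropy_production h (\<lambda>v. v) F \<phi> (glue_u u1 u2) p \<partial>lborel) + (\<integral>y. glue_0 v1 v2 y * \<phi> (0, y) \<partial>lborel) = 0"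
    using g w localized_zero[OF assms(1) \<phi> A] localized_zero[OF assms(2) \<phi> A'] by auto
qed

text \<open>The last components of an entropy flux are constant; subtracting the constant changes nothing.\<close>

lemma glue_entropy_ineq:
  assumes "entropy_ineq h F u1 v1" "entropy_ineq h F u2 v2"
  shows "entropy_ineq h F (glue_u u1 u2) (glue_0 v1 v2)"
  unfolding entropy_ineq_iff
proof (intro allI impI)
  fix \<eta> Q and \<phi> :: "real \<times> ('x \<times> 'w) \<Rightarrow> real" assume *: "entropy_pair F \<eta> Q \<and> test_fun h \<phi> \<and> (\<forall>p. 0 \<le> \<phi> p)"
  then have pair: "entropy_pair F \<eta> Q" and \<phi>: "test_fun h \<phi>" "\<And>p. 0 \<le> \<phi> p" by auto
  obtain D K where "c1_test \<phi> D K h" by (rule test_funE[OF \<phi>(1) h])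
  then interpret c1_test \<phi> D K h .
  have A': "- A \<in> sets borel" using A by auto
  have sd: "snd (vector_derivative F (at v)) = 0" for v
  proof -
    have "((\<lambda>v. snd (F v)) has_vector_derivative snd (vector_derivative F (at v))) (at v)"
      by (rule bounded_linear.has_vector_derivative[OF bounded_linear_snd C1_fun_derivative(1)[OF F]])
    moreover have "((\<lambda>v. snd (F v)) has_vector_derivative 0) (at v)" by (simp add: sF)
    ultimately show ?thesis by (rule vector_derivative_unique_at)
  qed
  have Qd: "(Q has_vector_derivative deriv \<eta> v *\<^sub>R vector_derivative F (at v)) (at v)" for v
    using pair by (simp add: entropy_pair_def)
  have Qs0: "((\<lambda>v. snd (Q v)) has_vector_derivative 0) (at v)" for v
    using bounded_linear.has_vector_derivative[OF bounded_linear_snd Qd[of v]] by (simp add: sd)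
  obtain c where "\<And>v. v \<in> UNIV \<Longrightarrow> snd (Q v) = c"
    by (rule has_vector_derivative_zero_constant[of UNIV "\<lambda>v. snd (Q v)"]) (use Qs0 in simp_all)
  then have c: "\<And>v. snd (Q v) = c" by simp
  define Q' where "Q' v = Q v - (0, c)" for v
  have Q's: "snd (Q' v) = 0" for v by (simp add: Q'_def c)
  have pair': "entropy_pair F \<eta> Q'"
  proof -
    have "(Q' has_vector_derivative deriv \<eta> v *\<^sub>R vector_derivative F (at v)) (at v)" for v
      unfolding Q'_def using has_vector_derivative_diff[OF Qd[of v] has_vector_derivative_const[of "(0, c)"]] by simp
    then show ?thesis using pair by (simp add: entropy_pair_def)
  qed
  have prod: "entropy_production h \<eta> Q \<phi> u = (\<lambda>p. entropy_production h \<eta> Q' \<phi> u p + indicator {0..h} (fst p) * blinfun_apply (D p) (0, (0, c)))" for u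
  proof
    fix p
    have "(0::real, Q s) = (0, Q' s) + (0, (0, c))" for s by (simp add: Q'_def)
    then have "blinfun_apply (D p) (0, Q s) = blinfun_apply (D p) (0, Q' s) + blinfun_apply (D p) (0, (0, c))" for s
      by (simp only: blinfun.add_right)
    then show "entropy_production h \<eta> Q \<phi> u p = entropy_production h \<eta> Q' \<phi> u p + indicator {0..h} (fst p) * blinfun_apply (D p) (0, (0, c))"
      by (simp add: entropy_production_def flux_test_eq algebra_simps)
  qed
  have e: "integrable lborel (entropy_production h \<eta> Q' \<phi> u1)" "integrable lborel (\<lambda>y. \<eta> (v1 y) * \<phi> (0, y))"
     "integrable lborel (entropy_production h \<eta> Q' \<phi> u2)" "integrable lborel (\<lambda>y. \<eta> (v2 y) * \<phi> (0, y))"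
    using assms[unfolded entropy_ineq_iff, rule_format, of \<eta> Q' \<phi>] pair' \<phi> by auto
  note g = glue_production[OF e]
  have nn: "0 \<le> (\<integral>p. entropy_production h \<eta> Q' \<phi> (glue_u u1 u2) p \<partial>lborel) + (\<integral>y. \<eta> (glue_0 v1 v2 y) * \<phi> (0, y) \<partial>lborel)"
    unfolding g(3) using localized_nonneg[OF assms(1) pair' \<phi> Q's A] localized_nonneg[OF assms(2) pair' \<phi> Q's A'] by simp
  have "integrable lborel (entropy_production h \<eta> Q \<phi> (glue_u u1 u2))"
    unfolding prod by (intro Bochner_Integration.integrable_add g(1) integrable_D)
  moreover have "(\<integral>p. entropy_production h \<eta> Q \<phi> (glue_u u1 u2) p \<partial>lborel) = (\<integral>p. entropy_production h \<eta> Q' \<phi> (glue_u u1 u2) p \<partial>lborel)"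
    unfolding prod Bochner_Integration.integral_add[OF g(1) integrable_D] by (simp add: divergence_flux_eq)
  ultimately show "integrable lborel (entropy_production h \<eta> Q \<phi> (glue_u u1 u2)) \<and> integrable lborel (\<lambda>y. \<eta> (glue_0 v1 v2 y) * \<phi> (0, y)) \<and>
     0 \<le> (\<integral>p. entropy_production h \<eta> Q \<phi> (glue_u u1 u2) p \<partial>lborel) + (\<integral>y. \<eta> (glue_0 v1 v2 y) * \<phi> (0, y) \<partial>lborel)"
    using nn g(2) by simp
qed

end

text \<open>Initial data enter only through integrals, so they may be changed on a null set. This
  permits replacing the given data by representatives that are bounded everywhere or cut off in the
  parameter.\<close>

lemma initial_data_cong:
  fixes F :: "real \<Rightarrow> 'a::euclidean_space"
  assumes h: "0 < h" and v: "v \<in> borel_measurable borel" "v' \<in> borel_measurable borel" and ae: "AE x in lborel. v x = v' x"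
  shows "weak_sol h F u v \<Longrightarrow> weak_sol h F u v'" "entropy_ineq h F u v \<Longrightarrow> entropy_ineq h F u v'"
proof -
  have cong: "integrable lborel (\<lambda>y. \<eta> (v y) * \<phi> (0, y)) = integrable lborel (\<lambda>y. \<eta> (v' y) * \<phi> (0, y))"
    "(\<integral>y. \<eta> (v y) * \<phi> (0, y) \<partial>lborel) = (\<integral>y. \<eta> (v' y) * \<phi> (0, y) \<partial>lborel)"
    if [measurable]: "\<eta> \<in> borel_measurable borel" and \<phi>: "test_fun h \<phi>" for \<eta> :: "real \<Rightarrow> real" and \<phi> :: "real \<times> 'a \<Rightarrow> real"
  proof -
    obtain D K where "c1_test \<phi> D K h" by (rule test_funE[OF \<phi> h])
    then interpret c1_test \<phi> D K h .
    have m: "(\<lambda>y. \<eta> (v y) * \<phi> (0, y)) \<in> borel_measurable lborel" "(\<lambda>y. \<eta> (v' y) * \<phi> (0, y)) \<in> borel_measurable lborel"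
      using v by measurable
    have ae': "AE y in lborel. \<eta> (v y) * \<phi> (0, y) = \<eta> (v' y) * \<phi> (0, y)" using ae by eventually_elim simp
    show "integrable lborel (\<lambda>y. \<eta> (v y) * \<phi> (0, y)) = integrable lborel (\<lambda>y. \<eta> (v' y) * \<phi> (0, y))"
      by (rule integrable_cong_AE[OF m ae'])
    show "(\<integral>y. \<eta> (v y) * \<phi> (0, y) \<partial>lborel) = (\<integral>y. \<eta> (v' y) * \<phi> (0, y) \<partial>lborel)"
      by (rule integral_cong_AE[OF m ae'])
  qed
  show "weak_sol h F u v'" if "weak_sol h F u v"
    unfolding weak_sol_iff
  proof (intro allI impI)
    fix \<phi> :: "real \<times> 'a \<Rightarrow> real" assume \<phi>: "test_fun h \<phi>"
    show "integrable lborel (entropy_production h (\<lambda>v. v) F \<phi> u) \<and> integrable lborel (\<lambda>y. v' y * \<phi> (0, y)) \<and>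
     (\<integral>p. entropy_production h (\<lambda>v. v) F \<phi> u p \<partial>lborel) + (\<integral>y. v' y * \<phi> (0, y) \<partial>lborel) = 0"
      using that[unfolded weak_sol_iff, rule_format, OF \<phi>] cong[of "\<lambda>v. v" \<phi>] \<phi> by simp
  qed
  show "entropy_ineq h F u v'" if "entropy_ineq h F u v"
    unfolding entropy_ineq_iff
  proof (intro allI impI)
    fix \<eta> Q and \<phi> :: "real \<times> 'a \<Rightarrow> real" assume *: "entropy_pair F \<eta> Q \<and> test_fun h \<phi> \<and> (\<forall>p. 0 \<le> \<phi> p)"
    have "continuous_on UNIV \<eta>"
    proof (rule continuous_at_imp_continuous_on, rule ballI)
      fix x
      have "\<eta> differentiable (at x)" using * by (simp add: entropy_pair_def)
      then show "isCont \<eta> x" by (rule differentiable_imp_continuous_within)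
    qed
    then have "\<eta> \<in> borel_measurable borel" by (rule borel_measurable_continuous_onI)
    then show "integrable lborel (entropy_production h \<eta> Q \<phi> u) \<and> integrable lborel (\<lambda>y. \<eta> (v' y) * \<phi> (0, y)) \<and>
     0 \<le> (\<integral>p. entropy_production h \<eta> Q \<phi> u p \<partial>lborel) + (\<integral>y. \<eta> (v' y) * \<phi> (0, y) \<partial>lborel)"
      using that[unfolded entropy_ineq_iff, rule_format, OF *] cong[of \<eta> \<phi>] * by auto
  qed
qed

section \<open>Solutions depending on a parameter\<close>

lemma tc_slice:
  "tc (\<lambda>v. (b v, 0)) B \<tau> u (x, w) = tc b B \<tau> (\<lambda>x. u (x, w)) x"
  by (simp add: tc_def)

lemma appr_slice:
  "appr (\<lambda>v. (b v, 0)) B n u t (x, w) = appr b B n (\<lambda>x. u (x, w)) t x"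
proof -
  have "(tc (\<lambda>v. (b v, 0)) B \<tau> ^^ k) u (x, w) = (tc b B \<tau> ^^ k) (\<lambda>x. u (x, w)) x" for \<tau> k
    by (induction k arbitrary: x) (simp_all add: tc_slice)
  then show ?thesis by (simp add: appr_def)
qed

lemma snd_derivative_zero:
  fixes F :: "real \<Rightarrow> 'x::euclidean_space \<times> 'w::euclidean_space"
  assumes F: "C1_fun F" and sF: "\<And>v. snd (F v) = 0"
  shows "vector_derivative F (at v) = (fst (vector_derivative F (at v)), 0)"
    and "vector_derivative (\<lambda>v. fst (F v)) (at v) = fst (vector_derivative F (at v))"
proof -
  have "((\<lambda>v. snd (F v)) has_vector_derivative snd (vector_derivative F (at v))) (at v)"
    by (rule bounded_linear.has_vector_derivative[OF bounded_linear_snd C1_fun_derivative(1)[OF F]])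
  moreover have "((\<lambda>v. snd (F v)) has_vector_derivative 0) (at v)" by (simp add: sF)
  ultimately have "snd (vector_derivative F (at v)) = 0" by (rule vector_derivative_unique_at)
  then show "vector_derivative F (at v) = (fst (vector_derivative F (at v)), 0)" by (simp add: prod_eq_iff)
  show "vector_derivative (\<lambda>v. fst (F v)) (at v) = fst (vector_derivative F (at v))"
    by (rule vector_derivative_at[OF bounded_linear.has_vector_derivative[OF bounded_linear_fst C1_fun_derivative(1)[OF F]]])
qed

lemma C1_fun_fst:
  fixes F :: "real \<Rightarrow> 'x::euclidean_space \<times> 'w::euclidean_space"
  assumes F: "C1_fun F"
  shows "C1_fun (\<lambda>v. fst (F v))"
  unfolding C1_fun_def
proof (intro exI[of _ "\<lambda>v. fst (vector_derivative F (at v))"] conjI allI)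
  show "continuous_on UNIV (\<lambda>v. fst (vector_derivative F (at v)))"
    using C1_fun_derivative(2)[OF F] by (intro continuous_intros)
  show "((\<lambda>v. fst (F v)) has_vector_derivative fst (vector_derivative F (at v))) (at v)" for v
    by (rule bounded_linear.has_vector_derivative[OF bounded_linear_fst C1_fun_derivative(1)[OF F]])
qed

lemma nn_integral_lborel_slices:
  fixes f :: "'x::euclidean_space \<times> 'w::euclidean_space \<Rightarrow> ennreal"
  assumes "f \<in> borel_measurable borel"
  shows "(\<integral>\<^sup>+y. f y \<partial>lborel) = (\<integral>\<^sup>+w. \<integral>\<^sup>+x. f (x, w) \<partial>lborel \<partial>lborel)"
    and "(\<lambda>w. \<integral>\<^sup>+x. f (x, w) \<partial>lborel) \<in> borel_measurable borel"
proof -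
  have f: "f \<in> borel_measurable (lborel \<Otimes>\<^sub>M lborel)" using assms by (simp add: lborel_prod)
  show "(\<integral>\<^sup>+y. f y \<partial>lborel) = (\<integral>\<^sup>+w. \<integral>\<^sup>+x. f (x, w) \<partial>lborel \<partial>lborel)"
    using lborel_pair.nn_integral_snd[OF f] by (simp add: lborel_prod)
  have "(\<lambda>(w, x). f (x, w)) \<in> borel_measurable (lborel \<Otimes>\<^sub>M lborel)"
    using measurable_pair_swap[OF f] by simp
  from lborel.borel_measurable_nn_integral[OF this]
  show "(\<lambda>w. \<integral>\<^sup>+x. f (x, w) \<partial>lborel) \<in> borel_measurable borel" by simp
qed

lemma ennreal_tendsto_0I:
  fixes f :: "nat \<Rightarrow> ennreal"
  assumes "\<And>e. e > 0 \<Longrightarrow> \<exists>N. \<forall>n\<ge>N. f n \<le> ennreal e"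
  shows "f \<longlonglongrightarrow> 0"
proof (rule order_tendstoI)
  fix c :: ennreal assume "0 < c"
  then obtain e where e: "0 < e" "ennreal e < c"
    using dense[of 0 c] by (metis ennreal_cases ennreal_less_zero_iff infinity_ennreal_def not_less_iff_gr_or_eq top_greatest order_less_le_trans ennreal_top_neq_zero)
  obtain N where "\<forall>n\<ge>N. f n \<le> ennreal e" using assms[OF e(1)] by blast
  then show "\<forall>\<^sub>F n in sequentially. f n < c" using e(2) by (auto simp: eventually_sequentially intro: le_less_trans)
qed simp

text \<open>Dominated convergence in \<open>w\<close>: each slice integral is at most
  \<open>C\<close> times the volume of the ball in \<open>x\<close>, and it vanishes for
  \<open>w\<close> outside the ball of radius \<open>R\<close>.\<close>

lemma slices_tendsto_0:
  fixes f :: "nat \<Rightarrow> 'x::euclidean_space \<times> 'w::euclidean_space \<Rightarrow> real"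
  assumes f: "\<And>j. f j \<in> borel_measurable borel" and b: "\<And>j y. \<bar>f j y\<bar> \<le> C"
    and lim: "AE w in lborel. (\<lambda>j. \<integral>\<^sup>+x. indicator (cball 0 R) (x, w) * ennreal \<bar>f j (x, w)\<bar> \<partial>lborel) \<longlonglongrightarrow> 0"
  shows "(\<lambda>j. \<integral>\<^sup>+y. indicator (cball 0 R) y * ennreal \<bar>f j y\<bar> \<partial>lborel) \<longlonglongrightarrow> 0"
proof -
  have C: "0 \<le> C" using order_trans[OF abs_ge_zero b] .
  have cb: "cball (0 :: 'x \<times> 'w) R \<in> sets borel" by simp
  have m: "(\<lambda>y. indicator (cball 0 R) y * ennreal \<bar>f j y\<bar>) \<in> borel_measurable borel" for j
    using f cb by measurable
  have finx: "emeasure lborel (cball (0::'x) R) < \<infinity>" by (rule emeasure_bounded_finite) (rule bounded_cball)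
  have finw: "emeasure lborel (cball (0::'w) R) < \<infinity>" by (rule emeasure_bounded_finite) (rule bounded_cball)
  define D where "D = ennreal C * emeasure lborel (cball (0::'x) R)"
  have D: "D < \<infinity>" unfolding D_def using finx by (simp add: ennreal_mult_less_top)
  have le: "(\<integral>\<^sup>+x. indicator (cball 0 R) (x, w) * ennreal \<bar>f j (x, w)\<bar> \<partial>lborel) \<le> D * indicator (cball 0 R) w" for j w
  proof -
    have "(\<integral>\<^sup>+x. indicator (cball 0 R) (x, w) * ennreal \<bar>f j (x, w)\<bar> \<partial>lborel)
      \<le> (\<integral>\<^sup>+x. (ennreal C * indicator (cball 0 R) w) * indicator (cball (0::'x) R) x \<partial>lborel)"
    proof (intro nn_integral_mono)
      fix x
      show "indicator (cball 0 R) (x, w) * ennreal \<bar>f j (x, w)\<bar> \<le> (ennreal C * indicator (cball 0 R) w) * indicator (cball 0 R) x"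
      proof (cases "(x, w) \<in> cball 0 R")
        case True
        then have "norm x \<le> R" "norm w \<le> R"
          using norm_fst_le[of x w] norm_snd_le[of w x] by auto
        then show ?thesis using True b[of j "(x, w)"] by (simp add: ennreal_leI)
      qed simp
    qed
    also have "\<dots> = D * indicator (cball 0 R) w"
      by (subst nn_integral_cmult_indicator) (auto simp: D_def mult_ac)
    finally show ?thesis .
  qed
  have "(\<lambda>j. \<integral>\<^sup>+w. \<integral>\<^sup>+x. indicator (cball 0 R) (x, w) * ennreal \<bar>f j (x, w)\<bar> \<partial>lborel \<partial>lborel) \<longlonglongrightarrow> (\<integral>\<^sup>+(w::'w). 0 \<partial>lborel)"
  proof (rule nn_integral_dominated_convergence[where w="\<lambda>w. D * indicator (cball 0 R) w"])
    show "(\<lambda>w. \<integral>\<^sup>+x. indicator (cball 0 R) (x, w) * ennreal \<bar>f j (x, w)\<bar> \<partial>lborel) \<in> borel_measurable lborel" for j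
      using nn_integral_lborel_slices(2)[OF m[of j]] by simp
    show "(\<lambda>w. D * indicator (cball (0::'w) R) w) \<in> borel_measurable lborel"
    proof -
      have [measurable]: "cball (0::'w) R \<in> sets borel" by simp
      show ?thesis by measurable
    qed
    have "(\<integral>\<^sup>+w. D * indicator (cball (0::'w) R) w \<partial>lborel) = D * emeasure lborel (cball (0::'w) R)"
      by (rule nn_integral_cmult_indicator) simp
    then show "(\<integral>\<^sup>+w. D * indicator (cball (0::'w) R) w \<partial>lborel) < \<infinity>" using D finw by (simp add: ennreal_mult_less_top)
    show "AE w in lborel. (\<integral>\<^sup>+x. indicator (cball 0 R) (x, w) * ennreal \<bar>f j (x, w)\<bar> \<partial>lborel) \<le> D * indicator (cball 0 R) w" for j
      by (rule AE_I2) (rule le)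
  qed (use lim in auto)
  then show ?thesis by (simp add: nn_integral_lborel_slices(1)[OF m])
qed

lemma Cb_L1_integrable: "Cb_L1 h u \<Longrightarrow> t \<in> {0..h} \<Longrightarrow> integrable lborel (u t)"
  by (simp add: Cb_L1_def)

text \<open>Slicewise convergence to \<open>ubar\<close> is used to show that the scheme on the
  product space is Cauchy, not to define its limit: \<open>W\<close> comes from the iterates and is
  therefore jointly measurable, and its agreement with \<open>ubar\<close> on slices is proved
  afterwards. Zero data off \<open>A\<close> make all iterates vanish there, so those slices
  converge trivially.\<close>

lemma tensor_limit:
  fixes F :: "real \<Rightarrow> 'x::euclidean_space \<times> 'w::euclidean_space" and U0 :: "'x \<times> 'w \<Rightarrow> real"
    and ubar :: "'w \<Rightarrow> real \<Rightarrow> 'x \<Rightarrow> real"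
  assumes F: "C1_fun F" and sF: "\<And>v. snd (F v) = 0" and B: "0 \<le> B" and h: "0 < h"
    and A: "A \<in> sets borel" and U0: "U0 \<in> borel_measurable borel" "\<And>y. \<bar>U0 y\<bar> \<le> B" and off: "\<And>x w. w \<notin> A \<Longrightarrow> U0 (x, w) = 0"
    and cb: "\<And>w. Cb_L1 h (ubar w)"
    and conv: "\<And>w e. w \<in> A \<Longrightarrow> e > 0 \<Longrightarrow> \<exists>N. \<forall>n\<ge>N. \<forall>t\<in>{0..h}.
      L1d (appr (\<lambda>v. fst (vector_derivative F (at v))) B n (\<lambda>x. U0 (x, w)) t) (ubar w t) \<le> ennreal e"
  obtains W where "(\<lambda>p. W (fst p) (snd p)) \<in> borel_measurable borel" "\<And>t y. \<bar>W t y\<bar> \<le> B"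
    "weak_sol h F W U0" "entropy_ineq h F W U0"
    "\<And>t. t \<in> {0..h} \<Longrightarrow> AE w in lborel. w \<in> A \<longrightarrow> (AE x in lborel. W t (x, w) = ubar w t x)"
proof -
  define b where "b v = fst (vector_derivative F (at v))" for v
  have ab: "(\<lambda>v. vector_derivative F (at v)) = (\<lambda>v. (b v, 0))"
    using snd_derivative_zero(1)[OF F sF] by (simp add: b_def fun_eq_iff)
  obtain S where S: "collapse (\<lambda>v. (b v, 0::'w)) B S" by (rule C1_fun_collapse[OF F B, unfolded ab])
  obtain S' where S': "collapse b B S'"
    by (rule C1_fun_collapse[OF C1_fun_fst[OF F] B, unfolded snd_derivative_zero(2)[OF F sF], folded b_def])
  interpret c: collapse "\<lambda>v. (b v, 0::'w)" B S by fact
  interpret d: collapse b B S' by fact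
  define X where "X n = appr (\<lambda>v. (b v, 0::'w)) B n U0" for n
  have Xs: "X n t (x, w) = appr b B n (\<lambda>x. U0 (x, w)) t x" for n t x w
    unfolding X_def by (rule appr_slice)
  have X0: "X n t (x, w) = 0" if "w \<notin> A" for n t x w
    using off[OF that] by (simp add: Xs d.appr_eq d.iter_zero)
  have U0s [measurable]: "(\<lambda>x. U0 (x, w)) \<in> borel_measurable borel" for w
    by (rule measurable_compose[OF _ U0(1)]) (auto intro!: borel_measurable_continuous_onI continuous_intros)
  have Xj: "(\<lambda>p. X n (fst p) (snd p)) \<in> borel_measurable borel" for n
    unfolding X_def by (rule c.appr_joint[OF U0(1)])
  have Xm [measurable]: "X n t \<in> borel_measurable borel" for n t
    unfolding X_def by (rule c.appr_borel[OF U0(1)])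
  have Xb: "\<bar>X n t y\<bar> \<le> B" for n t y
    unfolding X_def by (rule c.appr_range[OF U0])
  have ubm [measurable]: "ubar w t \<in> borel_measurable borel" if "t \<in> {0..h}" for w t
    using Cb_L1_integrable[OF cb that] by auto
  have conv': "\<exists>N. \<forall>n\<ge>N. \<forall>t\<in>{0..h}. L1d (\<lambda>x. X n t (x, w)) (ubar w t) \<le> ennreal e" if "w \<in> A" "e > 0" for w e
    using conv[OF that] by (simp add: Xs b_def[symmetric])
  have Xsm [measurable]: "(\<lambda>x. X n t (x, w)) \<in> borel_measurable borel" for n t w
    by (rule measurable_compose[OF _ Xm]) (auto intro!: borel_measurable_continuous_onI continuous_intros)
  have cauchy: "\<exists>N. \<forall>m\<ge>N. \<forall>n\<ge>N. \<forall>t\<in>{0..h}.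
      (\<integral>\<^sup>+y. indicator (cball 0 (real k)) y * ennreal \<bar>X m t y - X n t y\<bar> \<partial>lborel) \<le> ennreal e" if e: "e > 0" for k e
  proof -
    define I where "I m n t = (\<integral>\<^sup>+y. indicator (cball 0 (real k)) y * ennreal \<bar>X m t y - X n t y\<bar> \<partial>lborel)" for m n t
    \<comment> \<open>Uniformity in time must survive the integration over \<open>w\<close>,
      although the slicewise thresholds depend on \<open>w\<close>. If it failed, there would be bad
      indices and times \<open>t j\<close>; uniform convergence on each slice still applies along
      them, and dominated convergence gives a contradiction.\<close>
    have "\<exists>N. \<forall>m\<ge>N. \<forall>n\<ge>N. \<forall>t\<in>{0..h}. I m n t \<le> ennreal e"
    proof (rule ccontr)
      assume "\<not> ?thesis"
      then obtain m n t where mn: "\<And>j. m j \<ge> j" "\<And>j. n j \<ge> j" "\<And>j. t j \<in> {0..h}"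
        and bad: "\<And>j::nat. \<not> I (m j) (n j) (t j) \<le> ennreal e"
        by metis
      have "(\<lambda>j. \<integral>\<^sup>+y. indicator (cball 0 (real k)) y * ennreal \<bar>X (m j) (t j) y - X (n j) (t j) y\<bar> \<partial>lborel) \<longlonglongrightarrow> 0"
      proof (rule slices_tendsto_0[where C="2 * B"])
        show "(\<lambda>y. X (m j) (t j) y - X (n j) (t j) y) \<in> borel_measurable borel" for j by measurable
        show "\<bar>X (m j) (t j) y - X (n j) (t j) y\<bar> \<le> 2 * B" for j y
          using Xb[of "m j" "t j" y] Xb[of "n j" "t j" y] by linarith
        show "AE w in lborel. (\<lambda>j. \<integral>\<^sup>+x. indicator (cball 0 (real k)) (x, w) * ennreal \<bar>X (m j) (t j) (x, w) - X (n j) (t j) (x, w)\<bar> \<partial>lborel) \<longlonglongrightarrow> 0"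
        proof (rule AE_I2, rule ennreal_tendsto_0I)
          fix w :: 'w and r :: real assume r: "r > 0"
          show "\<exists>N. \<forall>j\<ge>N. (\<integral>\<^sup>+x. indicator (cball 0 (real k)) (x, w) * ennreal \<bar>X (m j) (t j) (x, w) - X (n j) (t j) (x, w)\<bar> \<partial>lborel) \<le> ennreal r"
          proof (cases "w \<in> A")
            case True
            obtain N where N: "\<And>n t. n \<ge> N \<Longrightarrow> t \<in> {0..h} \<Longrightarrow> L1d (\<lambda>x. X n t (x, w)) (ubar w t) \<le> ennreal (r/2)"
              using conv'[OF True, of "r/2"] r by (meson half_gt_zero)
            have "(\<integral>\<^sup>+x. indicator (cball 0 (real k)) (x, w) * ennreal \<bar>X (m j) (t j) (x, w) - X (n j) (t j) (x, w)\<bar> \<partial>lborel) \<le> ennreal r"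
              if j: "j \<ge> N" for j
            proof -
              have "(\<integral>\<^sup>+x. indicator (cball 0 (real k)) (x, w) * ennreal \<bar>X (m j) (t j) (x, w) - X (n j) (t j) (x, w)\<bar> \<partial>lborel)
                \<le> L1d (\<lambda>x. X (m j) (t j) (x, w)) (\<lambda>x. X (n j) (t j) (x, w))"
                unfolding L1d_def by (intro nn_integral_mono) (auto split: split_indicator)
              also have "\<dots> \<le> L1d (\<lambda>x. X (m j) (t j) (x, w)) (ubar w (t j)) + L1d (ubar w (t j)) (\<lambda>x. X (n j) (t j) (x, w))"
                using mn(3)[of j] by (intro L1d_triangle) auto
              also have "\<dots> \<le> ennreal (r/2) + ennreal (r/2)"
                using N[OF order_trans[OF j mn(1)] mn(3), of j] N[OF order_trans[OF j mn(2)] mn(3), of j]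
                by (intro add_mono) (auto simp: L1d_commute)
              also have "\<dots> = ennreal r" using r by (simp flip: ennreal_plus)
              finally show ?thesis .
            qed
            then show ?thesis by blast
          qed (simp add: X0)
        qed
      qed
      then have "(\<lambda>j. I (m j) (n j) (t j)) \<longlonglongrightarrow> 0" by (simp add: I_def)
      from order_tendstoD(2)[OF this, of "ennreal e"] e
      obtain j where "I (m j) (n j) (t j) < ennreal e" by (auto simp: eventually_sequentially)
      then show False using bad[of j] by simp
    qed
    then show ?thesis unfolding I_def .
  qed
  have cover: "(\<Union>k. cball (0 :: 'x \<times> 'w) (real k)) = UNIV"
  proof -
    have "\<exists>k. y \<in> cball (0 :: 'x \<times> 'w) (real k)" for y
      using real_arch_simple[of "norm y"] by simp
    then show ?thesis by blast
  qed
  have cbm: "cball (0 :: 'x \<times> 'w) (real k) \<in> sets borel" for k by simp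
  show ?thesis
  proof (rule uniform_L1_limit[where V=X and A="\<lambda>k. cball 0 (real k)" and B=B and I="{0..h}", OF Xj cbm cover Xb cauchy])
    fix W assume W: "(\<lambda>p. W (fst p) (snd p)) \<in> borel_measurable borel" "\<And>t y. \<bar>W t y\<bar> \<le> B"
      and lim: "\<And>k e. e > 0 \<Longrightarrow> \<exists>N. \<forall>n\<ge>N. \<forall>t\<in>{0..h}.
        (\<integral>\<^sup>+y. indicator (cball 0 (real k)) y * ennreal \<bar>X n t y - W t y\<bar> \<partial>lborel) \<le> ennreal e"
    have Wm [measurable]: "W t \<in> borel_measurable borel" for t
      using joint_compose[OF W(1), of "\<lambda>_. t" borel "\<lambda>x. x"] by auto
    have Wsm [measurable]: "(\<lambda>x. W t (x, w)) \<in> borel_measurable borel" for t w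
      by (rule measurable_compose[OF _ Wm]) (auto intro!: borel_measurable_continuous_onI continuous_intros)
    have limR: "\<exists>N. \<forall>n\<ge>N. \<forall>t\<in>{0..h}. (\<integral>\<^sup>+y. indicator (cball 0 R) y * ennreal \<bar>X n t y - W t y\<bar> \<partial>lborel) \<le> ennreal e" if e: "e > 0" for R e
    proof -
      obtain k :: nat where k: "R \<le> real k" using real_arch_simple by blast
      obtain N where N: "\<And>n t. n \<ge> N \<Longrightarrow> t \<in> {0..h} \<Longrightarrow> (\<integral>\<^sup>+y. indicator (cball 0 (real k)) y * ennreal \<bar>X n t y - W t y\<bar> \<partial>lborel) \<le> ennreal e"
        using lim[OF e, of k] by blast
      have "(\<integral>\<^sup>+y. indicator (cball 0 R) y * ennreal \<bar>X n t y - W t y\<bar> \<partial>lborel)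
         \<le> (\<integral>\<^sup>+y. indicator (cball 0 (real k)) y * ennreal \<bar>X n t y - W t y\<bar> \<partial>lborel)" for n t
        using k by (intro nn_integral_mono mult_right_mono) (auto split: split_indicator)
      then show ?thesis using N by (meson order_trans)
    qed
    have sol: "weak_sol h F W U0" "entropy_ineq h F W U0"
    proof -
      have shift: "X n (t + inverse (real (Suc n))) = tc (\<lambda>v. vector_derivative F (at v)) B (inverse (real (Suc n))) (X n t)" if "0 \<le> t" for n t
        unfolding X_def ab by (rule c.appr_shift[OF that])
      have init: "X n t = U0" if "0 \<le> t" "t < inverse (real (Suc n))" for n t
        unfolding X_def by (rule c.appr_init[OF that])
      note sols = scheme_limit_is_solution[OF F B h Xj Xb shift init _ LIMSEQ_inverse_real_of_nat U0 W limR]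
      show "weak_sol h F W U0" "entropy_ineq h F W U0" using sols by simp_all
    qed
    \<comment> \<open>Convergence on the product space gives, by Fatou, a vanishing lower limit of
      the slice distances to \<open>W\<close> for almost every \<open>w\<close>. On slices over
      \<open>A\<close> the iterates also converge to \<open>ubar\<close>, so both limits agree
      there. Balls keep the integrals finite and are exhausted at the end.\<close>
    have slices: "AE w in lborel. w \<in> A \<longrightarrow> (AE x in lborel. W t (x, w) = ubar w t x)" if t: "t \<in> {0..h}" for t
    proof -
      have "AE w in lborel. w \<in> A \<longrightarrow> (AE x in lborel. (x, w) \<in> cball 0 (real k) \<longrightarrow> W t (x, w) = ubar w t x)" for k
      proof -
        have [measurable]: "cball (0 :: 'x \<times> 'w) (real k) \<in> sets borel" by simp
        define dd where "dd n w = (\<integral>\<^sup>+x. indicator (cball 0 (real k)) (x, w) * ennreal \<bar>X n t (x, w) - W t (x, w)\<bar> \<partial>lborel)" for n w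
        have m: "(\<lambda>y. indicator (cball 0 (real k)) y * ennreal \<bar>X n t y - W t y\<bar>) \<in> borel_measurable borel" for n by measurable
        have ddm [measurable]: "dd n \<in> borel_measurable borel" for n
          unfolding dd_def by (rule nn_integral_lborel_slices(2)[OF m])
        have "(\<lambda>n. \<integral>\<^sup>+y. indicator (cball 0 (real k)) y * ennreal \<bar>X n t y - W t y\<bar> \<partial>lborel) \<longlonglongrightarrow> 0"
        proof (rule ennreal_tendsto_0I)
          fix e :: real assume "e > 0"
          from lim[OF this, of k] t
          show "\<exists>N. \<forall>n\<ge>N. (\<integral>\<^sup>+y. indicator (cball 0 (real k)) y * ennreal \<bar>X n t y - W t y\<bar> \<partial>lborel) \<le> ennreal e" by blast
        qed
        then have "(\<lambda>n. \<integral>\<^sup>+w. dd n w \<partial>lborel) \<longlonglongrightarrow> 0"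
          unfolding dd_def by (simp add: nn_integral_lborel_slices(1)[OF m])
        then have "liminf (\<lambda>n. \<integral>\<^sup>+w. dd n w \<partial>lborel) = 0" by (intro lim_imp_Liminf) auto
        moreover have "(\<integral>\<^sup>+w. liminf (\<lambda>n. dd n w) \<partial>lborel) \<le> liminf (\<lambda>n. \<integral>\<^sup>+w. dd n w \<partial>lborel)"
          by (rule nn_integral_liminf) simp
        ultimately have "(\<integral>\<^sup>+w. liminf (\<lambda>n. dd n w) \<partial>lborel) = 0" by simp
        then have ae: "AE w in lborel. liminf (\<lambda>n. dd n w) = 0"
          by (subst (asm) nn_integral_0_iff_AE) auto
        show ?thesis
        proof (rule AE_mp[OF ae], rule AE_I2, intro impI)
          fix w assume l0: "liminf (\<lambda>n. dd n w) = 0" and wA: "w \<in> A"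
          define I where "I = (\<integral>\<^sup>+x. indicator (cball 0 (real k)) (x, w) * ennreal \<bar>W t (x, w) - ubar w t x\<bar> \<partial>lborel)"
          have [measurable]: "(\<lambda>x::'x. indicator (cball 0 (real k)) (x, w) :: ennreal) \<in> borel_measurable borel"
          proof -
            have pm: "(\<lambda>x::'x. (x, w)) \<in> borel_measurable borel"
              by (intro borel_measurable_continuous_onI continuous_intros)
            show ?thesis by (rule measurable_compose[OF pm]) (rule borel_measurable_indicator[OF cbm])
          qed
          have [measurable]: "ubar w t \<in> borel_measurable borel" by (rule ubm[OF t])
          have Ile: "I \<le> dd n w + L1d (\<lambda>x. X n t (x, w)) (ubar w t)" for n
          proof -
            have "I \<le> (\<integral>\<^sup>+x. indicator (cball 0 (real k)) (x, w) * ennreal \<bar>X n t (x, w) - W t (x, w)\<bar> + ennreal \<bar>X n t (x, w) - ubar w t x\<bar> \<partial>lborel)"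
              unfolding I_def
            proof (intro nn_integral_mono)
              fix x
              have "\<bar>W t (x, w) - ubar w t x\<bar> \<le> \<bar>X n t (x, w) - W t (x, w)\<bar> + \<bar>X n t (x, w) - ubar w t x\<bar>" by linarith
              then have "ennreal \<bar>W t (x, w) - ubar w t x\<bar> \<le> ennreal \<bar>X n t (x, w) - W t (x, w)\<bar> + ennreal \<bar>X n t (x, w) - ubar w t x\<bar>"
                by (simp flip: ennreal_plus add: ennreal_leI)
              then show "indicator (cball 0 (real k)) (x, w) * ennreal \<bar>W t (x, w) - ubar w t x\<bar>
                \<le> indicator (cball 0 (real k)) (x, w) * ennreal \<bar>X n t (x, w) - W t (x, w)\<bar> + ennreal \<bar>X n t (x, w) - ubar w t x\<bar>"
                by (auto split: split_indicator)
            qed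
            also have "\<dots> = dd n w + L1d (\<lambda>x. X n t (x, w)) (ubar w t)"
              unfolding dd_def L1d_def by (rule nn_integral_add) measurable
            finally show ?thesis .
          qed
          have small: "I \<le> ennreal e" if e: "e > 0" for e
          proof -
            have e2: "e / 2 > 0" using e by simp
            obtain N where N: "\<And>n. n \<ge> N \<Longrightarrow> L1d (\<lambda>x. X n t (x, w)) (ubar w t) \<le> ennreal (e/2)"
              using conv'[OF wA e2] t by blast
            \<comment> \<open>Only a lower limit is available, but infinitely many good indices are
              enough: one of them lies beyond the threshold for convergence to
              \<open>ubar\<close>.\<close>
            have "\<exists>n\<ge>N. dd n w < ennreal (e/2)"
            proof (rule ccontr)
              assume "\<not> ?thesis"
              then have "\<forall>\<^sub>F n in sequentially. ennreal (e/2) \<le> dd n w"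
                by (auto simp: eventually_sequentially not_less)
              then have "ennreal (e/2) \<le> liminf (\<lambda>n. dd n w)" by (rule Liminf_bounded)
              then show False using l0 e by simp
            qed
            then obtain n where n: "n \<ge> N" "dd n w < ennreal (e/2)" by blast
            have "I \<le> ennreal (e/2) + ennreal (e/2)"
              by (rule order_trans[OF Ile add_mono[OF less_imp_le[OF n(2)] N[OF n(1)]]])
            also have "\<dots> = ennreal e" using e by (simp flip: ennreal_plus)
            finally show ?thesis .
          qed
          have "I \<le> 0" by (rule ennreal_le_epsilon) (simp add: small)
          then have "I = 0" by simp
          then have "AE x in lborel. indicator (cball 0 (real k)) (x, w) * ennreal \<bar>W t (x, w) - ubar w t x\<bar> = 0"
            unfolding I_def by (subst (asm) nn_integral_0_iff_AE) auto
          then show "AE x in lborel. (x, w) \<in> cball 0 (real k) \<longrightarrow> W t (x, w) = ubar w t x"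
            by eventually_elim (auto split: split_indicator_asm)
        qed
      qed
      then have "AE w in lborel. \<forall>k. w \<in> A \<longrightarrow> (AE x in lborel. (x, w) \<in> cball 0 (real k) \<longrightarrow> W t (x, w) = ubar w t x)"
        unfolding AE_all_countable by blast
      then show ?thesis
      proof (rule AE_mp[OF _ AE_I2], intro impI)
        fix w assume "\<forall>k. w \<in> A \<longrightarrow> (AE x in lborel. (x, w) \<in> cball 0 (real k) \<longrightarrow> W t (x, w) = ubar w t x)" "w \<in> A"
        then have "AE x in lborel. \<forall>k. (x, w) \<in> cball 0 (real k) \<longrightarrow> W t (x, w) = ubar w t x"
          unfolding AE_all_countable by blast
        then show "AE x in lborel. W t (x, w) = ubar w t x"
        proof (rule AE_mp[OF _ AE_I2], intro impI)
          fix x assume "\<forall>k. (x, w) \<in> cball 0 (real k) \<longrightarrow> W t (x, w) = ubar w t x"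
          moreover obtain k where "(x, w) \<in> cball 0 (real k)" using cover by blast
          ultimately show "W t (x, w) = ubar w t x" by blast
        qed
      qed
    qed
    show ?thesis by (rule that[OF W sol slices])
  qed
qed

text \<open>Time continuity is inherited from \<open>ubar\<close>, but the null set on which
  \<open>W\<close> and \<open>ubar\<close> differ depends on the time. Continuity is therefore
  tested along sequences, where only countably many exceptional sets occur.\<close>

lemma tensor_continuous:
  fixes W :: "real \<Rightarrow> 'x::euclidean_space \<times> 'w::euclidean_space \<Rightarrow> real" and ubar :: "'w \<Rightarrow> real \<Rightarrow> 'x \<Rightarrow> real"
  assumes W: "\<And>t. W t \<in> borel_measurable borel" "\<And>t y. \<bar>W t y\<bar> \<le> B" and A: "A \<in> sets borel"
    and cb: "\<And>w. Cb_L1 h (ubar w)" and K: "compact K"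
    and slices: "\<And>t. t \<in> {0..h} \<Longrightarrow> AE w in lborel. w \<in> A \<longrightarrow> (AE x in lborel. W t (x, w) = ubar w t x)"
    and t: "t \<in> {0..h}"
  shows "((\<lambda>s. \<integral>y. indicator K y * (indicator A (snd y) * \<bar>W s y - W t y\<bar>) \<partial>lborel) \<longlongrightarrow> 0) (at t within {0..h})"
  unfolding tendsto_at_iff_sequentially
proof (intro allI impI)
  fix q :: "nat \<Rightarrow> real" assume q: "\<forall>i. q i \<in> {0..h} - {t}" "q \<longlonglongrightarrow> t"
  note [measurable] = W(1) A snd_borel
  have Km [measurable]: "K \<in> sets borel" using compact_imp_closed[OF K] by simp
  obtain R where R: "K \<subseteq> cball 0 R" using compact_imp_bounded[OF K] unfolding bounded_iff by (auto simp: subset_iff)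
  define f where "f j y = indicator A (snd y) * (W (q j) y - W t y)" for j y
  have fm [measurable]: "f j \<in> borel_measurable borel" for j unfolding f_def by measurable
  have B: "0 \<le> B" using order_trans[OF abs_ge_zero W(2)] .
  have fb: "\<bar>f j y\<bar> \<le> 2 * B" for j y
  proof -
    have "\<bar>f j y\<bar> \<le> \<bar>W (q j) y - W t y\<bar>" unfolding f_def by (auto split: split_indicator)
    also have "\<dots> \<le> 2 * B" using W(2)[of "q j" y] W(2)[of t y] by linarith
    finally show ?thesis .
  qed
  have N: "(\<lambda>j. \<integral>\<^sup>+y. indicator (cball 0 R) y * ennreal \<bar>f j y\<bar> \<partial>lborel) \<longlonglongrightarrow> 0"
  proof (rule slices_tendsto_0[OF fm fb])
    have "AE w in lborel. \<forall>j. w \<in> A \<longrightarrow> (AE x in lborel. W (q j) (x, w) = ubar w (q j) x)"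
      unfolding AE_all_countable using slices q(1) by blast
    moreover have "AE w in lborel. w \<in> A \<longrightarrow> (AE x in lborel. W t (x, w) = ubar w t x)" by (rule slices[OF t])
    ultimately show "AE w in lborel. (\<lambda>j. \<integral>\<^sup>+x. indicator (cball 0 R) (x, w) * ennreal \<bar>f j (x, w)\<bar> \<partial>lborel) \<longlonglongrightarrow> 0"
    proof eventually_elim
      case (elim w)
      show ?case
      proof (cases "w \<in> A")
        case True
        have le: "(\<integral>\<^sup>+x. indicator (cball 0 R) (x, w) * ennreal \<bar>f j (x, w)\<bar> \<partial>lborel) \<le> ennreal (\<integral>x. \<bar>ubar w (q j) x - ubar w t x\<bar> \<partial>lborel)" for j
        proof -
          have "AE x in lborel. W (q j) (x, w) = ubar w (q j) x" "AE x in lborel. W t (x, w) = ubar w t x" using elim True by auto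
          then have "AE x in lborel. indicator (cball 0 R) (x, w) * ennreal \<bar>f j (x, w)\<bar> \<le> ennreal \<bar>ubar w (q j) x - ubar w t x\<bar>"
            by eventually_elim (auto simp: f_def True split: split_indicator)
          then have "(\<integral>\<^sup>+x. indicator (cball 0 R) (x, w) * ennreal \<bar>f j (x, w)\<bar> \<partial>lborel) \<le> L1d (ubar w (q j)) (ubar w t)"
            unfolding L1d_def by (rule nn_integral_mono_AE)
          also have "\<dots> = ennreal (\<integral>x. \<bar>ubar w (q j) x - ubar w t x\<bar> \<partial>lborel)"
            using q(1) t by (intro L1d_integral Cb_L1_integrable[OF cb]) auto
          finally show ?thesis .
        qed
        have "((\<lambda>s. \<integral>x. \<bar>ubar w s x - ubar w t x\<bar> \<partial>lborel) \<longlongrightarrow> 0) (at t within {0..h})"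
          using cb[of w] t by (simp add: Cb_L1_def)
        then have "(\<lambda>j. \<integral>x. \<bar>ubar w (q j) x - ubar w t x\<bar> \<partial>lborel) \<longlonglongrightarrow> 0"
          using q unfolding tendsto_at_iff_sequentially by (auto simp: o_def)
        from tendsto_ennrealI[OF this]
        have "(\<lambda>j. ennreal (\<integral>x. \<bar>ubar w (q j) x - ubar w t x\<bar> \<partial>lborel)) \<longlonglongrightarrow> 0" by simp
        then show ?thesis
          by (rule tendsto_sandwich[rotated 2, OF tendsto_const]) (use le in auto)
      qed (simp add: f_def)
    qed
  qed
  have le: "ennreal (\<integral>y. indicator K y * (indicator A (snd y) * \<bar>W (q j) y - W t y\<bar>) \<partial>lborel)
     \<le> (\<integral>\<^sup>+y. indicator (cball 0 R) y * ennreal \<bar>f j y\<bar> \<partial>lborel)" for j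
  proof -
    have i: "integrable lborel (\<lambda>y. indicator K y * (indicator A (snd y) * \<bar>W (q j) y - W t y\<bar>))"
    proof (rule integrable_bounded_support[where R=R and C="2 * B"])
      show "\<bar>indicator K y * (indicator A (snd y) * \<bar>W (q j) y - W t y\<bar>)\<bar> \<le> 2 * B" for y
        using fb[of j y] B unfolding f_def by (auto split: split_indicator)
      show "indicator K y * (indicator A (snd y) * \<bar>W (q j) y - W t y\<bar>) = 0" if "R < norm y" for y
        using that R by (auto split: split_indicator)
    qed measurable
    have "ennreal (\<integral>y. indicator K y * (indicator A (snd y) * \<bar>W (q j) y - W t y\<bar>) \<partial>lborel)
      = (\<integral>\<^sup>+y. ennreal (indicator K y * (indicator A (snd y) * \<bar>W (q j) y - W t y\<bar>)) \<partial>lborel)"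
      using i by (intro nn_integral_eq_integral[symmetric]) auto
    also have "\<dots> \<le> (\<integral>\<^sup>+y. indicator (cball 0 R) y * ennreal \<bar>f j y\<bar> \<partial>lborel)"
    proof (intro nn_integral_mono)
      fix y show "ennreal (indicator K y * (indicator A (snd y) * \<bar>W (q j) y - W t y\<bar>)) \<le> indicator (cball 0 R) y * ennreal \<bar>f j y\<bar>"
        using subsetD[OF R, of y] by (cases "y \<in> K"; cases "snd y \<in> A") (auto simp: f_def)
    qed
    finally show ?thesis .
  qed
  have "(\<lambda>j. ennreal (\<integral>y. indicator K y * (indicator A (snd y) * \<bar>W (q j) y - W t y\<bar>) \<partial>lborel)) \<longlonglongrightarrow> 0"
    by (rule tendsto_sandwich[OF _ _ tendsto_const N]) (use le in auto)
  then have "(\<lambda>j. ennreal (\<integral>y. indicator K y * (indicator A (snd y) * \<bar>W (q j) y - W t y\<bar>) \<partial>lborel)) \<longlonglongrightarrow> ennreal 0"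
    by simp
  then have "(\<lambda>j. \<integral>y. indicator K y * (indicator A (snd y) * \<bar>W (q j) y - W t y\<bar>) \<partial>lborel) \<longlonglongrightarrow> 0"
    by (subst (asm) tendsto_ennreal_iff) (auto intro!: always_eventually integral_nonneg_AE)
  then show "((\<lambda>s. \<integral>y. indicator K y * (indicator A (snd y) * \<bar>W s y - W t y\<bar>) \<partial>lborel) \<circ> q) \<longlonglongrightarrow> 0"
    by (simp add: o_def)
qed

text \<open>An increment of the glued function is at most the increment of \<open>W\<close> over
  \<open>A\<close> plus that of \<open>u\<close> over all of \<open>K\<close>; likewise its size is
  at most \<open>B\<close> over \<open>A\<close> plus \<open>\<bar>u\<bar>\<close> over
  \<open>K\<close>.\<close>

lemma glue_Cb_L1loc:
  fixes W u :: "real \<Rightarrow> 'x::euclidean_space \<times> 'w::euclidean_space \<Rightarrow> real"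
  assumes u: "Cb_L1loc h u" and W: "\<And>t. W t \<in> borel_measurable borel" "\<And>t y. \<bar>W t y\<bar> \<le> B" and A: "A \<in> sets borel"
    and cont: "\<And>K t. compact K \<Longrightarrow> t \<in> {0..h} \<Longrightarrow>
      ((\<lambda>s. \<integral>y. indicator K y * (indicator A (snd y) * \<bar>W s y - W t y\<bar>) \<partial>lborel) \<longlongrightarrow> 0) (at t within {0..h})"
  shows "Cb_L1loc h (\<lambda>t y. if snd y \<in> A then W t y else u t y)"
  unfolding Cb_L1loc_def
proof (intro allI impI)
  fix K :: "('x \<times> 'w) set" assume K: "compact K"
  note [measurable] = W(1) A snd_borel
  have A': "- A \<in> sets borel" using A by auto
  have Km [measurable]: "K \<in> sets borel" using compact_imp_closed[OF K] by simp
  obtain R where R: "\<And>y. y \<in> K \<Longrightarrow> norm y \<le> R" using compact_imp_bounded[OF K] unfolding bounded_iff by blast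
  have B: "0 \<le> B" using order_trans[OF abs_ge_zero W(2)] .
  let ?g = "\<lambda>t y. if snd y \<in> A then W t y else u t y"
  have uK: "(\<forall>t\<in>{0..h}. set_integrable lborel K (u t)) \<and>
     (\<forall>t\<in>{0..h}. ((\<lambda>s. \<integral>y\<in>K. \<bar>u s y - u t y\<bar> \<partial>lborel) \<longlongrightarrow> 0) (at t within {0..h})) \<and>
     (\<exists>B. \<forall>t\<in>{0..h}. (\<integral>y\<in>K. \<bar>u t y\<bar> \<partial>lborel) \<le> B)"
    by (rule u[unfolded Cb_L1loc_def, rule_format, OF K])
  have ui: "integrable lborel (\<lambda>y. indicator K y * u t y)" if "t \<in> {0..h}" for t
    using bspec[OF conjunct1[OF uK] that] by (simp add: set_integrable_def)
  have Wi: "integrable lborel (\<lambda>y. indicator K y * (indicator A (snd y) * f y))"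
    if [measurable]: "f \<in> borel_measurable borel" and f: "\<And>y. \<bar>f y\<bar> \<le> C" for f :: "'x \<times> 'w \<Rightarrow> real" and C
  proof (rule integrable_bounded_support[where R=R and C=C])
    have C: "0 \<le> C" using order_trans[OF abs_ge_zero f] .
    show "\<bar>indicator K y * (indicator A (snd y) * f y)\<bar> \<le> C" for y
      using f[of y] C by (auto split: split_indicator)
    show "indicator K y * (indicator A (snd y) * f y) = 0" if "R < norm y" for y
      using that R[of y] by (auto split: split_indicator)
  qed measurable
  have Wdi: "integrable lborel (\<lambda>y. indicator K y * (indicator A (snd y) * \<bar>W s y - W t y\<bar>))" for s t
  proof (rule Wi[where C="2 * B"])
    show "\<bar>\<bar>W s y - W t y\<bar>\<bar> \<le> 2 * B" for y using W(2)[of s y] W(2)[of t y] by linarith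
  qed measurable
  have gi: "set_integrable lborel K (?g t)" if t: "t \<in> {0..h}" for t
  proof -
    have "(\<lambda>y. indicator K y *\<^sub>R ?g t y) = (\<lambda>y. indicator K y * (indicator A (snd y) * W t y) + indicator (- A) (snd y) * (indicator K y * u t y))"
      by (auto simp: fun_eq_iff split: split_indicator)
    then show ?thesis unfolding set_integrable_def
      using Wi[OF W] integrable_indicator_times[OF ui[OF t] A' snd_borel] by simp
  qed
  have ud: "integrable lborel (\<lambda>y. indicator K y * \<bar>u s y - u t y\<bar>)" if "s \<in> {0..h}" "t \<in> {0..h}" for s t
  proof -
    have "integrable lborel (\<lambda>y. \<bar>indicator K y * u s y - indicator K y * u t y\<bar>)"
      by (intro integrable_abs Bochner_Integration.integrable_diff ui that)
    moreover have "(\<lambda>y. \<bar>indicator K y * u s y - indicator K y * u t y\<bar>) = (\<lambda>y. indicator K y * \<bar>u s y - u t y\<bar>)"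
      by (auto simp: fun_eq_iff split: split_indicator)
    ultimately show ?thesis by simp
  qed
  have cont': "((\<lambda>s. \<integral>y\<in>K. \<bar>?g s y - ?g t y\<bar> \<partial>lborel) \<longlongrightarrow> 0) (at t within {0..h})" if t: "t \<in> {0..h}" for t
  proof (rule tendsto_sandwich[OF _ _ tendsto_const])
    have "((\<lambda>s. \<integral>y\<in>K. \<bar>u s y - u t y\<bar> \<partial>lborel) \<longlongrightarrow> 0) (at t within {0..h})"
      by (rule bspec[OF conjunct1[OF conjunct2[OF uK]] t])
    from tendsto_add[OF cont[OF K t] this]
    show "((\<lambda>s. (\<integral>y. indicator K y * (indicator A (snd y) * \<bar>W s y - W t y\<bar>) \<partial>lborel) + (\<integral>y\<in>K. \<bar>u s y - u t y\<bar> \<partial>lborel)) \<longlongrightarrow> 0) (at t within {0..h})"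
      by simp
    show "\<forall>\<^sub>F s in at t within {0..h}. 0 \<le> (\<integral>y\<in>K. \<bar>?g s y - ?g t y\<bar> \<partial>lborel)"
      unfolding set_lebesgue_integral_def by (intro always_eventually allI integral_nonneg_AE AE_I2) auto
    have "(\<integral>y\<in>K. \<bar>?g s y - ?g t y\<bar> \<partial>lborel) \<le> (\<integral>y. indicator K y * (indicator A (snd y) * \<bar>W s y - W t y\<bar>) \<partial>lborel) + (\<integral>y\<in>K. \<bar>u s y - u t y\<bar> \<partial>lborel)"
      if s: "s \<in> {0..h}" for s
    proof -
      have i: "integrable lborel (\<lambda>y. indicator K y * \<bar>?g s y - ?g t y\<bar>)"
      proof -
        have "integrable lborel (\<lambda>y. \<bar>indicator K y *\<^sub>R ?g s y - indicator K y *\<^sub>R ?g t y\<bar>)"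
          using gi[OF s] gi[OF t] unfolding set_integrable_def by (intro integrable_abs Bochner_Integration.integrable_diff)
        moreover have "(\<lambda>y. \<bar>indicator K y *\<^sub>R ?g s y - indicator K y *\<^sub>R ?g t y\<bar>) = (\<lambda>y. indicator K y * \<bar>?g s y - ?g t y\<bar>)"
          by (auto simp: fun_eq_iff split: split_indicator)
        ultimately show ?thesis by simp
      qed
      have "(\<integral>y. indicator K y * \<bar>?g s y - ?g t y\<bar> \<partial>lborel)
        \<le> (\<integral>y. indicator K y * (indicator A (snd y) * \<bar>W s y - W t y\<bar>) + indicator K y * \<bar>u s y - u t y\<bar> \<partial>lborel)"
      proof (rule integral_mono[OF i])
        show "integrable lborel (\<lambda>y. indicator K y * (indicator A (snd y) * \<bar>W s y - W t y\<bar>) + indicator K y * \<bar>u s y - u t y\<bar>)"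
          by (intro Bochner_Integration.integrable_add Wdi ud s t)
        show "indicator K y * \<bar>?g s y - ?g t y\<bar> \<le> indicator K y * (indicator A (snd y) * \<bar>W s y - W t y\<bar>) + indicator K y * \<bar>u s y - u t y\<bar>" for y
          by (cases "snd y \<in> A") (simp_all add: mult_left_mono)
      qed
      also have "\<dots> = (\<integral>y. indicator K y * (indicator A (snd y) * \<bar>W s y - W t y\<bar>) \<partial>lborel) + (\<integral>y. indicator K y * \<bar>u s y - u t y\<bar> \<partial>lborel)"
        by (intro Bochner_Integration.integral_add Wdi ud s t)
      finally show ?thesis by (simp add: set_lebesgue_integral_def)
    qed
    then have "\<forall>s\<in>{0..h}. (\<integral>y\<in>K. \<bar>?g s y - ?g t y\<bar> \<partial>lborel)
      \<le> (\<integral>y. indicator K y * (indicator A (snd y) * \<bar>W s y - W t y\<bar>) \<partial>lborel) + (\<integral>y\<in>K. \<bar>u s y - u t y\<bar> \<partial>lborel)" by blast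
    then show "\<forall>\<^sub>F s in at t within {0..h}. (\<integral>y\<in>K. \<bar>?g s y - ?g t y\<bar> \<partial>lborel)
      \<le> (\<integral>y. indicator K y * (indicator A (snd y) * \<bar>W s y - W t y\<bar>) \<partial>lborel) + (\<integral>y\<in>K. \<bar>u s y - u t y\<bar> \<partial>lborel)"
      unfolding eventually_at by (intro exI[of _ 1] conjI ballI impI zero_less_one) (erule (1) bspec)
  qed
  obtain C where C: "\<And>t. t \<in> {0..h} \<Longrightarrow> (\<integral>y\<in>K. \<bar>u t y\<bar> \<partial>lborel) \<le> C"
    using conjunct2[OF conjunct2[OF uK]] by (elim exE) (rule that, erule (1) bspec)
  have bound: "(\<integral>y\<in>K. \<bar>?g t y\<bar> \<partial>lborel) \<le> (\<integral>y. indicator K y * (indicator A (snd y) * B) \<partial>lborel) + C" if t: "t \<in> {0..h}" for t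
  proof -
    have i: "integrable lborel (\<lambda>y. indicator K y * \<bar>?g t y\<bar>)"
      using integrable_abs[OF gi[OF t, unfolded set_integrable_def]] by (simp add: abs_mult)
    have i1: "integrable lborel (\<lambda>y. indicator K y * (indicator A (snd y) * B))" using B by (intro Wi[of _ B]) auto
    have i2: "integrable lborel (\<lambda>y. indicator K y * \<bar>u t y\<bar>)"
      using integrable_abs[OF ui[OF t]] by (simp add: abs_mult)
    have "(\<integral>y. indicator K y * \<bar>?g t y\<bar> \<partial>lborel) \<le> (\<integral>y. indicator K y * (indicator A (snd y) * B) + indicator K y * \<bar>u t y\<bar> \<partial>lborel)"
    proof (rule integral_mono[OF i])
      show "integrable lborel (\<lambda>y. indicator K y * (indicator A (snd y) * B) + indicator K y * \<bar>u t y\<bar>)"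
        by (intro Bochner_Integration.integrable_add i1 i2)
      show "indicator K y * \<bar>?g t y\<bar> \<le> indicator K y * (indicator A (snd y) * B) + indicator K y * \<bar>u t y\<bar>" for y
        using W(2)[of t y] by (auto split: split_indicator)
    qed
    also have "\<dots> = (\<integral>y. indicator K y * (indicator A (snd y) * B) \<partial>lborel) + (\<integral>y. indicator K y * \<bar>u t y\<bar> \<partial>lborel)"
      by (rule Bochner_Integration.integral_add[OF i1 i2])
    finally show ?thesis using C[OF t] by (simp add: set_lebesgue_integral_def)
  qed
  show "(\<forall>t\<in>{0..h}. set_integrable lborel K (?g t)) \<and>
    (\<forall>t\<in>{0..h}. ((\<lambda>s. \<integral>y\<in>K. \<bar>?g s y - ?g t y\<bar> \<partial>lborel) \<longlongrightarrow> 0) (at t within {0..h})) \<and>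
    (\<exists>B. \<forall>t\<in>{0..h}. (\<integral>y\<in>K. \<bar>?g t y\<bar> \<partial>lborel) \<le> B)"
  proof (intro conjI ballI)
    show "\<exists>B. \<forall>t\<in>{0..h}. (\<integral>y\<in>K. \<bar>?g t y\<bar> \<partial>lborel) \<le> B"
      by (rule exI, rule ballI, rule bound)
  qed (fact gi, fact cont')
qed

text \<open>Since random entropy solutions need not depend measurably on the parameter, uniqueness of the random
  solution gives uniqueness for almost every fixed parameter: otherwise choose a second solution there.\<close>

lemma random_entropy_sol_unique_AE:
  assumes sol: "random_entropy_sol P h f ubar0 ubar"
    and uniq: "\<forall>v. random_entropy_sol P h f ubar0 v \<longrightarrow> (AE \<omega> in P. \<forall>t\<in>{0..h}. AE x in lborel. v \<omega> t x = ubar \<omega> t x)"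
  shows "AE \<omega> in P. \<forall>z. Cb_L1 h z \<longrightarrow> weak_sol h f z (ubar0 \<omega>) \<longrightarrow> entropy_ineq h f z (ubar0 \<omega>) \<longrightarrow>
      (\<forall>t\<in>{0..h}. AE x in lborel. z t x = ubar \<omega> t x)"
proof -
  define other where "other \<omega> z \<longleftrightarrow> Cb_L1 h z \<and> weak_sol h f z (ubar0 \<omega>) \<and> entropy_ineq h f z (ubar0 \<omega>) \<and>
      \<not> (\<forall>t\<in>{0..h}. AE x in lborel. z t x = ubar \<omega> t x)" for \<omega> z
  define v where "v \<omega> = (if \<exists>z. other \<omega> z then SOME z. other \<omega> z else ubar \<omega>)" for \<omega>
  have v: "other \<omega> (v \<omega>)" if "other \<omega> z" for \<omega> z
    using that someI[of "other \<omega>" z] by (auto simp: v_def)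
  have v': "v \<omega> = ubar \<omega>" if "\<not> (\<exists>z. other \<omega> z)" for \<omega> using that by (simp add: v_def)
  have cb: "Cb_L1 h (v \<omega>)" for \<omega>
    using v[of \<omega>] v'[of \<omega>] sol by (metis other_def random_entropy_sol_def)
  have "AE \<omega> in P. weak_sol h f (ubar \<omega>) (ubar0 \<omega>) \<and> entropy_ineq h f (ubar \<omega>) (ubar0 \<omega>)"
    using sol by (simp add: random_entropy_sol_def)
  then have "AE \<omega> in P. weak_sol h f (v \<omega>) (ubar0 \<omega>) \<and> entropy_ineq h f (v \<omega>) (ubar0 \<omega>)"
    by (rule eventually_mono) (metis v v' other_def)
  then have "random_entropy_sol P h f ubar0 v" using cb by (simp add: random_entropy_sol_def)
  then have "AE \<omega> in P. \<forall>t\<in>{0..h}. AE x in lborel. v \<omega> t x = ubar \<omega> t x" using uniq by blast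
  then have "AE \<omega> in P. \<not> (\<exists>z. other \<omega> z)"
    by (rule eventually_mono) (metis v other_def)
  then show ?thesis by (rule eventually_mono) (auto simp: other_def)
qed

section \<open>Identification of the two solutions\<close>

theorem theorem3:
  fixes M :: "'w measure" and \<xi> :: "'w \<Rightarrow> real^('k::finite)" and p :: "real^'k \<Rightarrow> real"
    and F :: "real \<Rightarrow> (real^('n::finite)) \<times> (real^'k)" and T :: real
    and ubar0 :: "real^'k \<Rightarrow> real^'n \<Rightarrow> real" and u0 :: "(real^'n) \<times> (real^'k) \<Rightarrow> real"
    and ubar :: "real^'k \<Rightarrow> real \<Rightarrow> real^'n \<Rightarrow> real"
    and u :: "real \<Rightarrow> (real^'n) \<times> (real^'k) \<Rightarrow> real"
  assumes "prob_space M"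
    and "\<xi> \<in> borel_measurable M"
    and "p \<in> borel_measurable lborel" and "\<forall>w. 0 \<le> p w"
    and "distributed M lborel \<xi> (\<lambda>w. ennreal (p w))"
    and "\<exists>B. AE w in lborel. p w \<le> B"
    and "(\<forall>w. 0 < p w) \<or> (\<exists>K. compact K \<and> (\<forall>w. w \<notin> K \<longrightarrow> p w = 0))"
    and "T > 0"
    and "C1_fun F" and "\<forall>v. snd (F v) = 0"
    and "(\<lambda>(x, \<omega>). ubar0 \<omega> x) \<in> borel_measurable lborel"
    and "\<forall>\<omega>. integrable lborel (ubar0 \<omega>)"
    and "AE \<omega> in distr M lborel \<xi>. \<exists>B. AE x in lborel. \<bar>ubar0 \<omega> x\<bar> \<le> B"
    and "u0 \<in> borel_measurable lborel" and "\<exists>B. AE y in lborel. \<bar>u0 y\<bar> \<le> B"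
    and "AE \<omega> in distr M lborel \<xi>. AE x in lborel. u0 (x, \<omega>) = ubar0 \<omega> x"
    and "random_entropy_sol (distr M lborel \<xi>) T (\<lambda>v. fst (F v)) ubar0 ubar"
    and "\<forall>v. random_entropy_sol (distr M lborel \<xi>) T (\<lambda>v. fst (F v)) ubar0 v \<longrightarrow>
           (AE \<omega> in distr M lborel \<xi>. \<forall>t\<in>{0..T}. AE x in lborel. v \<omega> t x = ubar \<omega> t x)"
    and "entropy_sol T F u u0"
    and "\<forall>v. entropy_sol T F v u0 \<longrightarrow> (\<forall>t\<in>{0..T}. AE y in lborel. v t y = u t y)"
  shows "\<forall>t\<in>{0..T}. AE \<omega> in distr M lborel \<xi>. AE x in lborel. u t (x, \<omega>) = ubar \<omega> t x"
proof -
  let ?P = "distr M lborel \<xi>"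
  let ?f = "\<lambda>v. fst (F v)"
  have F: "C1_fun F" and sF: "\<And>v. snd (F v) = 0" using assms(9,10) by auto
  have T: "0 < T" by fact
  have pm [measurable]: "p \<in> borel_measurable borel" using assms(3) by simp
  have u0m [measurable]: "u0 \<in> borel_measurable borel" using assms(14) by simp
  \<comment> \<open>The law of \<open>\<xi>\<close> has density \<open>p\<close>, so its null sets
    are those that are Lebesgue-null within the set where \<open>p\<close> is positive.\<close>
  have AE_P: "(AE \<omega> in ?P. R \<omega>) \<longleftrightarrow> (AE \<omega> in lborel. 0 < p \<omega> \<longrightarrow> R \<omega>)" for R
    unfolding distributed_distr_eq_density[OF assms(5)] by (subst AE_density) auto
  obtain B0 where B0: "AE y in lborel. \<bar>u0 y\<bar> \<le> B0" using assms(15) by blast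
  define B where "B = max 0 B0"
  have B: "0 \<le> B" by (simp add: B_def)
  \<comment> \<open>A Borel representative bounded everywhere, as the scheme demands; it differs
    from \<open>u0\<close> only on a null set.\<close>
  define U where "U y = max (-B) (min B (u0 y))" for y
  have Um [measurable]: "U \<in> borel_measurable borel" unfolding U_def[abs_def] by measurable
  have Ub: "\<bar>U y\<bar> \<le> B" for y using B by (auto simp: U_def)
  have Uae: "AE y in lborel. U y = u0 y"
    using B0 by eventually_elim (auto simp: U_def B_def)
  \<comment> \<open>For a good parameter the uniqueness class of its slice contains only
    \<open>ubar\<close>, and the slice of the clipped datum is the random datum.\<close>
  define good where "good \<omega> \<longleftrightarrow> (\<forall>z. Cb_L1 T z \<longrightarrow> weak_sol T ?f z (ubar0 \<omega>) \<longrightarrow> entropy_ineq T ?f z (ubar0 \<omega>) \<longrightarrow>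
      (\<forall>t\<in>{0..T}. AE x in lborel. z t x = ubar \<omega> t x)) \<and> (AE x in lborel. U (x, \<omega>) = ubar0 \<omega> x)" for \<omega>
  have "AE \<omega> in lborel. 0 < p \<omega> \<longrightarrow> good \<omega>"
  proof -
    have "AE \<omega> in lborel. 0 < p \<omega> \<longrightarrow> (\<forall>z. Cb_L1 T z \<longrightarrow> weak_sol T ?f z (ubar0 \<omega>) \<longrightarrow> entropy_ineq T ?f z (ubar0 \<omega>) \<longrightarrow>
      (\<forall>t\<in>{0..T}. AE x in lborel. z t x = ubar \<omega> t x))"
      using random_entropy_sol_unique_AE[OF assms(17,18)] unfolding AE_P .
    moreover have "AE \<omega> in lborel. 0 < p \<omega> \<longrightarrow> (AE x in lborel. u0 (x, \<omega>) = ubar0 \<omega> x)"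
      using assms(16) unfolding AE_P .
    moreover have "AE \<omega> in lborel. AE x in lborel. U (x, \<omega>) = u0 (x, \<omega>)"
      by (rule AE_lborel_slices[OF Uae])
    ultimately show ?thesis
    proof eventually_elim
      case (elim \<omega>)
      show ?case
      proof
        assume p: "0 < p \<omega>"
        have "AE x in lborel. u0 (x, \<omega>) = ubar0 \<omega> x" using elim p by blast
        with elim(3) have "AE x in lborel. U (x, \<omega>) = ubar0 \<omega> x" by eventually_elim simp
        then show "good \<omega>" using elim p unfolding good_def by blast
      qed
    qed
  qed
  then obtain N where N: "{\<omega> \<in> space lborel. \<not> (0 < p \<omega> \<longrightarrow> good \<omega>)} \<subseteq> N" "emeasure lborel N = 0" "N \<in> sets (lborel :: (real^'k) measure)"
    by (rule AE_E)
  \<comment> \<open>Nothing makes the set of good parameters measurable, since it quantifies over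
    all solutions. Removing a Borel null set that covers the bad ones leaves a Borel set.\<close>
  define A where "A = {\<omega>. 0 < p \<omega>} - N"
  have A [measurable]: "A \<in> sets borel"
  proof -
    have "{\<omega>. 0 < p \<omega>} \<in> sets borel" by measurable
    then show ?thesis using N(3) by (auto simp: A_def)
  qed
  have Agood: "good \<omega>" if "\<omega> \<in> A" for \<omega> using that N(1) by (auto simp: A_def)
  have inA: "AE \<omega> in lborel. 0 < p \<omega> \<longrightarrow> \<omega> \<in> A"
    using N(2,3) by (intro AE_I[of _ _ N]) (auto simp: A_def)
  \<comment> \<open>Off \<open>A\<close> the slices of \<open>U\<close> need not be integrable and
    no limit of the scheme is known there, so the datum is set to 0; the given \<open>u\<close>
    takes over later.\<close>
  define U0 where "U0 y = (if snd y \<in> A then U y else 0)" for y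
  have U0m: "U0 \<in> borel_measurable borel"
  proof -
    note [measurable] = snd_borel[where 'x="real^'n" and 'w="real^'k"]
    show ?thesis unfolding U0_def[abs_def] by measurable
  qed
  have U0b: "\<bar>U0 y\<bar> \<le> B" for y using Ub B by (auto simp: U0_def)
  have cb: "Cb_L1 T (ubar \<omega>)" for \<omega> using assms(17) by (simp add: random_entropy_sol_def)
  have conv: "\<exists>N. \<forall>n\<ge>N. \<forall>t\<in>{0..T}. L1d (appr (\<lambda>v. fst (vector_derivative F (at v))) B n (\<lambda>x. U0 (x, \<omega>)) t) (ubar \<omega> t) \<le> ennreal e"
    if \<omega>: "\<omega> \<in> A" and e: "e > 0" for \<omega> e
  proof -
    have sl: "(\<lambda>x. U0 (x, \<omega>)) = (\<lambda>x. U (x, \<omega>))" using \<omega> by (simp add: U0_def)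
    have m: "(\<lambda>x. U (x, \<omega>)) \<in> borel_measurable borel"
      by (rule measurable_compose[OF _ Um]) (auto intro!: borel_measurable_continuous_onI continuous_intros)
    have ui: "integrable lborel (ubar0 \<omega>)" using assms(12) by simp
    then have m': "ubar0 \<omega> \<in> borel_measurable borel" by auto
    have ae: "AE x in lborel. U (x, \<omega>) = ubar0 \<omega> x" using Agood[OF \<omega>] by (simp add: good_def)
    have i: "integrable lborel (\<lambda>x. U (x, \<omega>))"
      using ui m m' ae by (subst integrable_cong_AE[of _ _ "ubar0 \<omega>"]) auto
    \<comment> \<open>Uniqueness is known for the datum \<open>ubar0\<close>, while the scheme
      starts from the clipped slice; the two agree almost everywhere.\<close>
    have "\<forall>t\<in>{0..T}. AE x in lborel. z t x = ubar \<omega> t x"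
      if "Cb_L1 T z" "weak_sol T ?f z (\<lambda>x. U (x, \<omega>))" "entropy_ineq T ?f z (\<lambda>x. U (x, \<omega>))" for z
      using Agood[OF \<omega>] that(1) initial_data_cong[OF T m m' ae] that(2,3) unfolding good_def by blast
    from appr_converges[OF C1_fun_fst[OF F] B T i Ub this e]
    show ?thesis unfolding sl snd_derivative_zero(2)[OF F sF] .
  qed
  show ?thesis
  proof (rule tensor_limit[OF F sF B T A U0m U0b _ cb conv])
    show "U0 (x, \<omega>) = 0" if "\<omega> \<notin> A" for x \<omega> using that by (simp add: U0_def)
    fix W
    assume W: "(\<lambda>q. W (fst q) (snd q)) \<in> borel_measurable borel" "\<And>t y. \<bar>W t y\<bar> \<le> B"
      and solW: "weak_sol T F W U0" "entropy_ineq T F W U0"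
      and slices: "\<And>t. t \<in> {0..T} \<Longrightarrow> AE \<omega> in lborel. \<omega> \<in> A \<longrightarrow> (AE x in lborel. W t (x, \<omega>) = ubar \<omega> t x)"
    have Wm: "W t \<in> borel_measurable borel" for t
      using joint_compose[OF W(1), of "\<lambda>_. t" borel "\<lambda>x. x"] by auto
    define v where "v = (\<lambda>t y. if snd y \<in> A then W t y else u t y)"
    \<comment> \<open>On \<open>A\<close> this is the clipped datum and off \<open>A\<close> it is
      \<open>u0\<close> itself, so it equals \<open>u0\<close> almost everywhere and
      \<open>v\<close> solves the original problem.\<close>
    define v0 where "v0 = (\<lambda>y. if snd y \<in> A then U0 y else u0 y)"
    have solu: "Cb_L1loc T u" "weak_sol T F u u0" "entropy_ineq T F u u0" using assms(19) by (auto simp: entropy_sol_def)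
    have v0m: "v0 \<in> borel_measurable borel"
    proof -
      note [measurable] = snd_borel[where 'x="real^'n" and 'w="real^'k"] U0m
      show ?thesis unfolding v0_def by measurable
    qed
    have v0ae: "AE y in lborel. v0 y = u0 y"
      using Uae by eventually_elim (simp add: v0_def U0_def)
    have "entropy_sol T F v u0"
      unfolding entropy_sol_def
    proof (intro conjI)
      show "Cb_L1loc T v"
        unfolding v_def by (rule glue_Cb_L1loc[OF solu(1) Wm W(2) A tensor_continuous[OF Wm W(2) A cb _ slices]])
      have "weak_sol T F v v0" unfolding v_def v0_def by (rule glue_weak_sol[OF F sF T A solW(1) solu(2)])
      then show "weak_sol T F v u0" by (rule initial_data_cong(1)[OF T v0m u0m v0ae])
      have "entropy_ineq T F v v0" unfolding v_def v0_def by (rule glue_entropy_ineq[OF F sF T A solW(2) solu(3)])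
      then show "entropy_ineq T F v u0" by (rule initial_data_cong(2)[OF T v0m u0m v0ae])
    qed
    then have vu: "AE y in lborel. v t y = u t y" if "t \<in> {0..T}" for t using assms(20) that by blast
    show "\<forall>t\<in>{0..T}. AE \<omega> in ?P. AE x in lborel. u t (x, \<omega>) = ubar \<omega> t x"
    proof
      fix t assume t: "t \<in> {0..T}"
      have "AE \<omega> in lborel. AE x in lborel. v t (x, \<omega>) = u t (x, \<omega>)" by (rule AE_lborel_slices[OF vu[OF t]])
      with slices[OF t] inA have "AE \<omega> in lborel. 0 < p \<omega> \<longrightarrow> (AE x in lborel. u t (x, \<omega>) = ubar \<omega> t x)"
      proof eventually_elim
        case (elim \<omega>)
        show ?case
        proof
          assume "0 < p \<omega>"
          then have \<omega>: "\<omega> \<in> A" using elim by blast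
          have "AE x in lborel. W t (x, \<omega>) = ubar \<omega> t x" using elim \<omega> by blast
          with elim(3) show "AE x in lborel. u t (x, \<omega>) = ubar \<omega> t x"
            by eventually_elim (simp add: v_def \<omega>)
        qed
      qed
      then show "AE \<omega> in ?P. AE x in lborel. u t (x, \<omega>) = ubar \<omega> t x" unfolding AE_P .
    qed
  qed
qed

end
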